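(* Let $t\geq 1$ and $k\geq 3$ be integers and let $n=t(k-1)+2$. Then \[\operatorname{pd}(I(\mathrm{GA}(t,k)'))=n-t-2=t(k-2).\]
   Context: For integers $t\ge 1$, $k\ge 2$, put $n=t(k-1)+2$. $\mathrm{GA}(t,k)'$ is the simple graph with vertex set $\mathbb Z_n$ in which $a$ and $b$ are adjacent iff $b-a\in\{1+jt \mid j\in\{1,2,\dots,k-2\}\}$ modulo $n$. (This set is closed under negation modulo $n$. Equivalently, for integers $0\le i<j<n$, $\{i,j\}$ is an edge iff $j-i\equiv 1 \pmod t$ and $j-i\notin\{1,n-1\}$.) It is the Generalized Andrásfai graph $\mathrm{GA}(t,k)$, i.e. the Cayley graph of $\mathbb Z_n$ with connection set $\{1+jt\mid 0\le j\le k-1\}$, with the edges $\{i,i+1\}$, $i\in\mathbb Z_n$, removed. Let $\mathbb K$ be an arbitrary field. For a graph $G$ with vertices $x_1,\dots,x_n$, the edge ideal is $I(G)=\langle x_ix_j \mid \{x_i,x_j\}\in E(G)\rangle\subseteq R=\mathbb K[x_1,\dots,x_n]$. $\operatorname{pd}(I(G))$ is the projective dimension of the ideal $I(G)$ (not of $R/I(G)$), i.e. the length $p$ of the minimal graded free resolution $0\to F_p\to\cdots\to F_0\to I(G)\to 0$. *)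

theory Defs
  imports
    "HOL-Library.Poly_Mapping"
    "HOL-Number_Theory.Cong"
    "HOL-Algebra.Ideal"
    "Jordan_Normal_Form.Matrix"
begin

section \<open>The polynomial ring in finitely many variables\<close>

text \<open>
  A monomial is its exponent vector \<open>nat \<Rightarrow>\<^sub>0 nat\<close>. The type \<open>'a mpoly\<close> has one variable for each
  natural number; \<open>K[x\<^sub>0, \<dots>, x\<^bsub>n-1\<^esub>]\<close> is the subring of the polynomials that involve
  only the variables with index below \<open>n\<close>.
\<close>

type_synonym 'a mpoly = "(nat \<Rightarrow>\<^sub>0 nat) \<Rightarrow>\<^sub>0 'a"

definition var :: "nat \<Rightarrow> 'a::field mpoly" where
  "var i = Poly_Mapping.single (Poly_Mapping.single i 1) 1"

definition poly_ring :: "nat \<Rightarrow> 'a::field mpoly ring" where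
  "poly_ring n =
    \<lparr>carrier = {f. \<forall>m \<in> Poly_Mapping.keys f. Poly_Mapping.keys m \<subseteq> {..<n}},
     monoid.mult = (*), one = 1, ring.zero = 0, add = (+)\<rparr>"

definition irrelevant_ideal :: "nat \<Rightarrow> 'a::field mpoly set" where
  "irrelevant_ideal n = genideal (poly_ring n) (var ` {..<n})"

definition monomial_degree :: "(nat \<Rightarrow>\<^sub>0 nat) \<Rightarrow> nat" where
  "monomial_degree m = (\<Sum>i \<in> Poly_Mapping.keys m. Poly_Mapping.lookup m i)"

text \<open>The zero polynomial is homogeneous of every degree, and it is the only one of negative degree.\<close>

definition homogeneous :: "int \<Rightarrow> 'a::field mpoly \<Rightarrow> bool" where
  "homogeneous e f \<longleftrightarrow> (\<forall>m \<in> Poly_Mapping.keys f. int (monomial_degree m) = e)"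

lemma cring_poly_ring: "cring (poly_ring n :: 'a::field mpoly ring)"
proof -
  let ?P = "\<lambda>f :: 'a mpoly. \<forall>m \<in> Poly_Mapping.keys f. Poly_Mapping.keys m \<subseteq> {..<n}"
  have add: "?P (f + g)" if "?P f" "?P g" for f g
    using that Poly_Mapping.keys_add[of f g] by blast
  have mult: "?P (f * g)" if "?P f" "?P g" for f g
  proof
    fix m assume "m \<in> Poly_Mapping.keys (f * g)"
    then obtain a b where "m = a + b" "a \<in> Poly_Mapping.keys f" "b \<in> Poly_Mapping.keys g"
      using Poly_Mapping.keys_mult[of f g] by blast
    then show "Poly_Mapping.keys m \<subseteq> {..<n}"
      using that Poly_Mapping.keys_add[of a b] by blast
  qed
  have zero: "?P 0" by simp
  have one: "?P 1" by simp
  have neg: "\<exists>g. ?P g \<and> g + f = 0" if "?P f" for f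
    using that by (intro exI[of _ "- f"]) (simp add: keys_minus)
  let ?R = "poly_ring n :: 'a mpoly ring"
  have R: "f \<in> carrier ?R \<longleftrightarrow> ?P f" "f \<otimes>\<^bsub>?R\<^esub> g = f * g" "\<one>\<^bsub>?R\<^esub> = 1"
    "\<zero>\<^bsub>?R\<^esub> = 0" "f \<oplus>\<^bsub>?R\<^esub> g = f + g" for f g
    by (simp_all add: poly_ring_def)
  have "abelian_group ?R"
  proof (rule abelian_groupI, unfold R)
    show "?P (f + g)" if "?P f" "?P g" for f g by (rule add[OF that])
    show "?P 0" by (rule zero)
    show "\<exists>g \<in> carrier ?R. g + f = 0" if "?P f" for f
      using neg[OF that] unfolding R(1) Bex_def .
  qed (simp_all only: ac_simps add_0_left add_0_right)
  moreover have "comm_monoid ?R"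
  proof (rule comm_monoidI, unfold R)
    show "?P (f * g)" if "?P f" "?P g" for f g by (rule mult[OF that])
    show "?P 1" by (rule one)
  qed (simp_all only: ac_simps mult_1_left mult_1_right)
  ultimately show ?thesis
    by (rule cringI) (simp only: R distrib_right)
qed

section \<open>Minimal graded free resolutions\<close>

text \<open>
  The graded free module with generators in degrees \<open>d 0, \<dots>, d (b - 1)\<close>, that is, the direct sum
  of the \<open>R(-d j)\<close>, is represented by its rank \<open>b\<close> and the function \<open>d\<close>; its elements are the
  vectors of length \<open>b\<close> over \<open>R\<close>.
\<close>

definition free_module :: "nat \<Rightarrow> nat \<Rightarrow> 'a::field mpoly vec set" where
  "free_module n b = {v \<in> carrier_vec b. \<forall>j<b. v $ j \<in> carrier (poly_ring n)}"

text \<open>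
  \<open>graded_maps n b' d' b d\<close> consists of the matrices of the degree-preserving \<open>R\<close>-linear maps from
  the graded free module \<open>(b, d)\<close> to the graded free module \<open>(b', d')\<close>.
\<close>

definition graded_maps ::
    "nat \<Rightarrow> nat \<Rightarrow> (nat \<Rightarrow> int) \<Rightarrow> nat \<Rightarrow> (nat \<Rightarrow> int) \<Rightarrow> 'a::field mpoly mat set" where
  "graded_maps n b' d' b d =
    {A \<in> carrier_mat b' b. \<forall>r<b'. \<forall>c<b.
       A $$ (r, c) \<in> carrier (poly_ring n) \<and> homogeneous (d c - d' r) (A $$ (r, c))}"

definition map_image :: "nat \<Rightarrow> 'a::field mpoly mat \<Rightarrow> 'a mpoly vec set" where
  "map_image n A = (\<lambda>v. A *\<^sub>v v) ` free_module n (dim_col A)"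

definition map_kernel :: "nat \<Rightarrow> 'a::field mpoly mat \<Rightarrow> 'a mpoly vec set" where
  "map_kernel n A = {v \<in> free_module n (dim_col A). A *\<^sub>v v = 0\<^sub>v (dim_row A)}"

text \<open>
  A graded free resolution \<open>0 \<rightarrow> F\<^sub>p \<rightarrow> \<dots> \<rightarrow> F\<^sub>0 \<rightarrow> I \<rightarrow> 0\<close> of an ideal \<open>I\<close>, where \<open>F\<^sub>i\<close> is given by
  \<open>(b i, d i)\<close>. The matrix \<open>D 0\<close> has one row and describes \<open>F\<^sub>0 \<rightarrow> I \<subseteq> R\<close>; the matrix \<open>D (Suc i)\<close>
  describes \<open>F\<^bsub>i+1\<^esub> \<rightarrow> F\<^sub>i\<close>. Since \<open>F\<^sub>p\<close> is required to be nonzero, the length is exactly \<open>p\<close>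
  (and the zero ideal has no resolution in this sense).
\<close>

definition graded_free_resolution ::
    "nat \<Rightarrow> 'a::field mpoly set \<Rightarrow> nat \<Rightarrow> (nat \<Rightarrow> nat) \<Rightarrow> (nat \<Rightarrow> nat \<Rightarrow> int) \<Rightarrow>
     (nat \<Rightarrow> 'a mpoly mat) \<Rightarrow> bool" where
  "graded_free_resolution n I p b d D \<longleftrightarrow>
     D 0 \<in> graded_maps n 1 (\<lambda>_. 0) (b 0) (d 0) \<and>
     (\<forall>i<p. D (Suc i) \<in> graded_maps n (b i) (d i) (b (Suc i)) (d (Suc i))) \<and>
     (\<lambda>w. w $ 0) ` map_image n (D 0) = I \<and>
     (\<forall>i<p. map_image n (D (Suc i)) = map_kernel n (D i)) \<and>
     map_kernel n (D p) = {0\<^sub>v (b p)} \<and>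
     b p \<noteq> 0"

text \<open>Minimality: the image of \<open>F\<^bsub>i+1\<^esub>\<close> lies in \<open>\<mm> F\<^sub>i\<close>, where \<open>\<mm>\<close> is the irrelevant ideal.\<close>

definition minimal_graded_free_resolution ::
    "nat \<Rightarrow> 'a::field mpoly set \<Rightarrow> nat \<Rightarrow> (nat \<Rightarrow> nat) \<Rightarrow> (nat \<Rightarrow> nat \<Rightarrow> int) \<Rightarrow>
     (nat \<Rightarrow> 'a mpoly mat) \<Rightarrow> bool" where
  "minimal_graded_free_resolution n I p b d D \<longleftrightarrow>
     graded_free_resolution n I p b d D \<and>
     (\<forall>i<p. \<forall>w \<in> map_image n (D (Suc i)). \<forall>r < b i. w $ r \<in> irrelevant_ideal n)"

text \<open>
  The description determines \<open>p\<close> for every nonzero homogeneous ideal \<open>I\<close> of \<open>poly_ring n\<close>, because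
  minimal graded free resolutions exist and are unique up to isomorphism.
\<close>

definition projective_dimension :: "nat \<Rightarrow> 'a::field mpoly set \<Rightarrow> nat" where
  "projective_dimension n I = (THE p. \<exists>b d D. minimal_graded_free_resolution n I p b d D)"

section \<open>Edge ideals and the graphs \<open>GA(t,k)'\<close>\<close>

text \<open>A graph on the vertices \<open>0, \<dots>, n - 1\<close> is given by its set of edges, which are two-element sets.\<close>

definition edge_ideal :: "nat \<Rightarrow> nat set set \<Rightarrow> 'a::field mpoly set" where
  "edge_ideal n E = genideal (poly_ring n) {var i * var j | i j. {i, j} \<in> E}"

definition GA_order :: "nat \<Rightarrow> nat \<Rightarrow> nat" where
  "GA_order t k = t * (k - 1) + 2"

text \<open>The vertex set is \<open>\<int>/n\<close> with \<open>n = GA_order t k\<close>, represented by the residues \<open>0, \<dots>, n - 1\<close>.\<close>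

definition GA'_edges :: "nat \<Rightarrow> nat \<Rightarrow> nat set set" where
  "GA'_edges t k =
    {{a, b} | a b. a < GA_order t k \<and> b < GA_order t k \<and>
       (\<exists>j \<in> {1..k - 2}. [int b - int a = 1 + int j * int t] (mod int (GA_order t k)))}"

end

theory Submission
  imports Defs
begin

text \<open>
  Write \<open>I\<close> for the edge ideal and \<open>H\<^sub>j(Y; M)\<close> for the Koszul homology of a graded module \<open>M\<close> with
  respect to a set \<open>Y\<close> of variables. Free modules have no Koszul homology in positive degrees, so
  an exact sequence \<open>0 \<rightarrow> N \<rightarrow> F \<rightarrow> M \<rightarrow> 0\<close> with \<open>F\<close> free shifts \<open>H\<^sub>j(Y; M)\<close> to \<open>H\<^bsub>j-1\<^esub>(Y; N)\<close>
  (\<open>koszul_exact_image\<close>, \<open>koszul_exact_kernel\<close>). Two consequences for a minimal resolution of \<open>I\<close> of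
  length \<open>p\<close> fix \<open>p\<close>: first, \<open>H\<^sub>j(Y; I) = 0\<close> for \<open>j > p\<close> and every \<open>Y\<close>; second, if \<open>Y\<close> consists of all
  variables and \<open>H\<^sub>j(Y; I) = 0\<close> for all \<open>j \<ge> q\<close>, then \<open>p < q\<close>, since otherwise the last module of the
  resolution would vanish by Nakayama's lemma. The same shifting gives the existence of a minimal
  resolution: as \<open>H\<^sub>j(Y; I)\<close> vanishes in all degrees above \<open>n\<close>, each syzygy module is generated in
  degrees up to \<open>n\<close>, hence finitely generated, and as it vanishes for large \<open>j\<close>, the process stops.

  It remains to find a nonzero class in \<open>H\<^sub>j(Y; I)\<close> for \<open>j = t (k - 2)\<close> and some \<open>Y\<close>, and to show
  that \<open>H\<^sub>j(Y; I) = 0\<close> for \<open>j > t (k - 2)\<close> and all variables \<open>Y\<close>. For the first part, \<open>{0..t}\<close> is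
  a maximal independent set: every one of the remaining \<open>n - t - 1 = t (k - 2) + 1\<close> variables
  multiplies \<open>x\<^sub>0 \<cdots> x\<^sub>t\<close> into \<open>I\<close>, and this yields a class in the top Koszul homology of the quotient
  by \<open>I\<close> with respect to those variables, which is shifted once to \<open>I\<close>.

  For the second part, the Koszul complex of a monomial ideal splits by multidegree into simplicial
  chain complexes over the field, the upper Koszul complexes. For a squarefree multidegree with
  support \<open>W\<close> the faces are the \<open>S \<subseteq> W\<close> such that \<open>W - S\<close> contains an edge; for the other
  multidegrees the complex is a cone. Deletion and link of a vertex \<open>v\<close> in such a complex correspond
  to removing the closed neighbourhood of \<open>v\<close> from the graph and to removing \<open>v\<close>. Hence the depth
  of a graph is at least the minimum of the depth without \<open>v\<close> and one more than the depth without
  the closed neighbourhood of \<open>v\<close>. Eliminating the vertices of any graph in decreasing order, one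
  obtains a set of kept vertices whose size bounds the depth from below (\<open>ex_elimination_set\<close>). A counting argument modulo \<open>t\<close> shows that for \<open>GA(t,k)'\<close> at least \<open>t + 1\<close>
  vertices are kept (\<open>card_elimination_set_GA'\<close>).
\<close>

section \<open>The Koszul differential\<close>

text \<open>The differential uses of the signs only that they square to \<open>1\<close> and that adding two elements
  in the other order changes the sign; both the square of the differential and the cone homotopy rest
  on the second fact.\<close>

definition ksign :: "nat \<Rightarrow> nat set \<Rightarrow> 'r::comm_ring_1" where
  "ksign y S = (- 1) ^ card {z \<in> S. z < y}"

lemma ksign_square: "ksign y S * (ksign y S * a) = (a :: 'r::comm_ring_1)"
  unfolding ksign_def by (simp flip: mult.assoc power_add mult_2)

lemma ksign_exchange:
  assumes "finite S" "y \<notin> S" "z \<notin> S" "y \<noteq> z"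
  shows "ksign y S * ksign z (insert y S) = - (ksign z S * ksign y (insert z S) :: 'r::comm_ring_1)"
proof -
  have less: "ksign y S * ksign z (insert y S) = - (ksign z S * ksign y (insert z S) :: 'r)"
    if "y < z" "y \<notin> S" for y z
  proof -
    have "{x \<in> insert y S. x < z} = insert y {x \<in> S. x < z}"
      using that by auto
    then have "card {x \<in> insert y S. x < z} = Suc (card {x \<in> S. x < z})"
      using assms(1) that by simp
    moreover have "{x \<in> insert z S. x < y} = {x \<in> S. x < y}"
      using that by auto
    ultimately show ?thesis
      by (simp add: ksign_def mult.commute)
  qed
  show ?thesis
  proof (cases "y < z")
    case True
    then show ?thesis using less assms by blast
  next
    case False
    then have "z < y" using assms by simp
    then show ?thesis using less[of z y] assms by simp
  qed
qed

text \<open>The ring of coefficients and the elements \<open>x\<close> are left open: with the variables of a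
  polynomial ring this is the Koszul complex, with \<open>x = (\<lambda>_. 1)\<close> over a field it is the augmented
  chain complex of a simplicial complex.\<close>

definition kdiff :: "(nat \<Rightarrow> 'r) \<Rightarrow> nat set \<Rightarrow> (nat set \<Rightarrow> 'r) \<Rightarrow> nat set \<Rightarrow> 'r::comm_ring_1" where
  "kdiff x Y u S = (\<Sum>y \<in> Y - S. ksign y S * x y * u (insert y S))"

lemma kdiff_add: "kdiff x Y (\<lambda>S. u S + w S) S = kdiff x Y u S + kdiff x Y w S"
  by (simp add: kdiff_def distrib_left sum.distrib)

lemma kdiff_diff: "kdiff x Y (\<lambda>S. u S - w S) S = kdiff x Y u S - kdiff x Y w S"
  by (simp add: kdiff_def right_diff_distrib sum_subtractf)

lemma kdiff_outside:
  assumes "\<And>S. u S \<noteq> 0 \<Longrightarrow> S \<subseteq> Y" "\<not> S \<subseteq> Y"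
  shows "kdiff x Y u S = 0"
proof -
  have "u (insert y S) = 0" for y using assms by blast
  then show ?thesis by (simp add: kdiff_def)
qed

text \<open>The terms are grouped into the pairs \<open>y < z\<close>, which cancel. A sum equal to its own negative
  would not be enough in characteristic \<open>2\<close>.\<close>

lemma kdiff_kdiff:
  assumes "finite Y" "finite S"
  shows "kdiff x Y (kdiff x Y u) S = 0"
proof -
  define f where "f y z = ksign y S * x y * (ksign z (insert y S) * x z * u (insert z (insert y S)))"
    for y z
  let ?T = "Y - S"
  have anti: "f y z = - f z y" if "y \<in> ?T" "z \<in> ?T" "y \<noteq> z" for y z
  proof -
    have "f y z = (ksign y S * ksign z (insert y S)) * (x y * x z * u (insert z (insert y S)))"
      by (simp add: f_def mult_ac)
    also have "\<dots> = - (ksign z S * ksign y (insert z S)) * (x y * x z * u (insert z (insert y S)))"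
      using ksign_exchange[of S y z, where 'r='a] assms that by simp
    also have "\<dots> = - f z y"
      by (simp add: f_def mult_ac insert_commute)
    finally show ?thesis .
  qed
  have fin: "finite ?T" using assms by simp
  have "kdiff x Y (kdiff x Y u) S = (\<Sum>y \<in> ?T. \<Sum>z \<in> ?T - {y}. f y z)"
    unfolding kdiff_def f_def sum_distrib_left
    by (intro sum.cong refl) auto
  also have "\<dots> = (\<Sum>y \<in> ?T. (\<Sum>z \<in> {z \<in> ?T. z < y}. f y z) + (\<Sum>z \<in> {z \<in> ?T. y < z}. f y z))"
  proof (intro sum.cong refl)
    fix y
    have eq: "?T - {y} = {z \<in> ?T. z < y} \<union> {z \<in> ?T. y < z}" by auto
    show "(\<Sum>z \<in> ?T - {y}. f y z) =
        (\<Sum>z \<in> {z \<in> ?T. z < y}. f y z) + (\<Sum>z \<in> {z \<in> ?T. y < z}. f y z)"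
      unfolding eq by (rule sum.union_disjoint) (rule finite_subset[OF _ fin], blast, rule finite_subset[OF _ fin], blast, force)
  qed
  also have "\<dots> = (\<Sum>y \<in> ?T. \<Sum>z \<in> {z \<in> ?T. z < y}. f y z) + (\<Sum>y \<in> ?T. \<Sum>z \<in> {z \<in> ?T. y < z}. f y z)"
    by (simp add: sum.distrib)
  also have "(\<Sum>y \<in> ?T. \<Sum>z \<in> {z \<in> ?T. y < z}. f y z) = (\<Sum>z \<in> ?T. \<Sum>y \<in> {y \<in> ?T. y < z}. f y z)"
    by (rule sum.swap_restrict[OF fin fin])
  also have "(\<Sum>z \<in> ?T. \<Sum>y \<in> {y \<in> ?T. y < z}. f y z) = (\<Sum>z \<in> ?T. \<Sum>y \<in> {y \<in> ?T. y < z}. - f z y)"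
    by (intro sum.cong refl anti) auto
  also have "(\<Sum>y \<in> ?T. \<Sum>z \<in> {z \<in> ?T. z < y}. f y z) + \<dots> = 0"
    by (simp add: sum_negf)
  finally show ?thesis .
qed

definition kcone :: "nat \<Rightarrow> (nat set \<Rightarrow> 'r) \<Rightarrow> nat set \<Rightarrow> 'r::comm_ring_1" where
  "kcone v u S = (if v \<in> S then ksign v (S - {v}) * u (S - {v}) else 0)"

text \<open>Prepending \<open>v\<close> is a homotopy between multiplication by \<open>x v\<close> and zero; this one identity gives
  the acyclicity of cones and the exact sequence of a vertex.\<close>

lemma kdiff_kcone:
  assumes "finite Y" "finite S" "v \<in> Y"
  shows "kdiff x Y (kcone v u) S + kcone v (kdiff x Y u) S = x v * u S"
proof (cases "v \<in> S")
  case False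
  have "kdiff x Y (kcone v u) S = (\<Sum>y \<in> {v}. ksign y S * x y * kcone v u (insert y S))"
    unfolding kdiff_def
    by (rule sum.mono_neutral_right) (use assms False in \<open>auto simp: kcone_def\<close>)
  also have "\<dots> = x v * (ksign v S * (ksign v S * u S))"
    using False by (simp add: kcone_def mult_ac)
  also have "\<dots> = x v * u S"
    by (simp only: ksign_square)
  finally show ?thesis
    using False by (simp add: kcone_def)
next
  case True
  then obtain T where T: "S = insert v T" "v \<notin> T" by (metis mk_disjoint_insert)
  let ?f = "\<lambda>y. ksign v T * (ksign y T * x y * u (insert y T))"
  have fin: "finite T" using assms T by simp
  have "kdiff x Y (kcone v u) S = (\<Sum>y \<in> Y - S. - ?f y)"
    unfolding kdiff_def
  proof (intro sum.cong refl)
    fix y assume "y \<in> Y - S"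
    then have y: "y \<notin> T" "y \<noteq> v" using T by auto
    then have eq: "insert y S - {v} = insert y T" using T by auto
    have "ksign v (insert y T) = ksign y T * (ksign y T * ksign v (insert y T) :: 'a)"
      by (simp only: ksign_square)
    also have "\<dots> = - (ksign y T * (ksign v T * ksign y (insert v T)))"
      using ksign_exchange[of T y v, where 'r='a] fin y T by simp
    finally have "ksign y S * ksign v (insert y T)
        = - (ksign y S * (ksign y S * (ksign v T * ksign y T)) :: 'a)"
      using T by (simp add: mult_ac)
    then have "ksign y S * ksign v (insert y T) = - (ksign v T * ksign y T :: 'a)"
      by (simp only: ksign_square)
    then have "(ksign y S * ksign v (insert y T)) * (x y * u (insert y T))
        = - (ksign v T * ksign y T) * (x y * u (insert y T))"
      by simp
    then show "ksign y S * x y * kcone v u (insert y S) = - ?f y"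
      using True eq by (simp add: kcone_def mult_ac)
  qed
  moreover have "kcone v (kdiff x Y u) S = ?f v + (\<Sum>y \<in> Y - S. ?f y)"
  proof -
    have "kcone v (kdiff x Y u) S = (\<Sum>y \<in> Y - T. ?f y)"
      using T by (simp add: kcone_def kdiff_def sum_distrib_left)
    moreover have "Y - T = insert v (Y - S)" "v \<notin> Y - S" using T assms(3) by auto
    ultimately show ?thesis using assms(1) by (metis (no_types, lifting) finite_Diff sum.insert)
  qed
  ultimately have "kdiff x Y (kcone v u) S + kcone v (kdiff x Y u) S = ?f v"
    by (simp add: sum_negf)
  also have "\<dots> = x v * (ksign v T * (ksign v T * u S))"
    using T by (simp add: mult_ac)
  finally show ?thesis by (simp only: ksign_square)
qed

section \<open>Exactness of simplicial chain complexes\<close>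

text \<open>The reduced simplicial homology of \<open>C\<close> over the field \<open>'k\<close> vanishes in dimension \<open>j - 1\<close>.
  Faces are counted by cardinality, since the empty set is a face and \<open>j\<close> is then also the
  homological degree in the Koszul complex.\<close>

definition kexact :: "'k::field itself \<Rightarrow> nat set \<Rightarrow> nat set set \<Rightarrow> nat \<Rightarrow> bool" where
  "kexact TYPE('k) Y C j \<longleftrightarrow>
    (\<forall>z :: nat set \<Rightarrow> 'k. (\<forall>S. z S \<noteq> 0 \<longrightarrow> S \<in> C \<and> card S = j) \<and> (\<forall>S. kdiff (\<lambda>_. 1) Y z S = 0) \<longrightarrow>
      (\<exists>w. (\<forall>S. w S \<noteq> 0 \<longrightarrow> S \<in> C \<and> card S = Suc j) \<and> (\<forall>S. kdiff (\<lambda>_. 1) Y w S = z S)))"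

lemma kexactI:
  assumes "\<And>z :: nat set \<Rightarrow> 'k. (\<And>S. z S \<noteq> 0 \<Longrightarrow> S \<in> C \<and> card S = j) \<Longrightarrow>
      (\<And>S. kdiff (\<lambda>_. 1) Y z S = 0) \<Longrightarrow>
      \<exists>w. (\<forall>S. w S \<noteq> 0 \<longrightarrow> S \<in> C \<and> card S = Suc j) \<and> (\<forall>S. kdiff (\<lambda>_. 1) Y w S = z S)"
  shows "kexact TYPE('k::field) Y C j"
  unfolding kexact_def using assms by blast

lemma kexactE:
  fixes z :: "nat set \<Rightarrow> 'k::field"
  assumes "kexact TYPE('k) Y C j" "\<And>S. z S \<noteq> 0 \<Longrightarrow> S \<in> C \<and> card S = j"
    "\<And>S. kdiff (\<lambda>_. 1) Y z S = 0"
  obtains w where "\<And>S. w S \<noteq> 0 \<Longrightarrow> S \<in> C \<and> card S = Suc j" "\<And>S. kdiff (\<lambda>_. 1) Y w S = z S"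
  using assms unfolding kexact_def by blast

lemma kexact_no_faces:
  assumes "\<And>S. S \<in> C \<Longrightarrow> card S \<noteq> j"
  shows "kexact TYPE('k::field) Y C j"
proof (rule kexactI)
  fix z :: "nat set \<Rightarrow> 'k"
  assume "\<And>S. z S \<noteq> 0 \<Longrightarrow> S \<in> C \<and> card S = j"
  then have "z S = 0" for S using assms by blast
  then show "\<exists>w. (\<forall>S. w S \<noteq> 0 \<longrightarrow> S \<in> C \<and> card S = Suc j) \<and>
      (\<forall>S. kdiff (\<lambda>_. 1) Y w S = z S)"
    by (intro exI[of _ "\<lambda>_. 0"]) (simp add: kdiff_def)
qed

lemma kexact_cone:
  assumes "finite Y" "C \<subseteq> Pow Y" "v \<in> Y"
    and ins: "\<And>S. S \<in> C \<Longrightarrow> v \<notin> S \<Longrightarrow> insert v S \<in> C"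
  shows "kexact TYPE('k::field) Y C j"
proof (rule kexactI)
  fix z :: "nat set \<Rightarrow> 'k"
  assume z: "\<And>S. z S \<noteq> 0 \<Longrightarrow> S \<in> C \<and> card S = j" and cyc: "\<And>S. kdiff (\<lambda>_. 1) Y z S = 0"
  have sub: "S \<subseteq> Y" if "z S \<noteq> 0" for S using z[OF that] assms by blast
  have w: "S \<in> C \<and> card S = Suc j" if "kcone v z S \<noteq> 0" for S
  proof -
    have "v \<in> S" "z (S - {v}) \<noteq> 0" using that by (auto simp: kcone_def split: if_splits)
    moreover from this have "finite S"
      using sub assms(1) finite_subset by (metis finite_Diff_insert finite.emptyI Diff_empty)
    ultimately show ?thesis
      using z[of "S - {v}"] ins[of "S - {v}"] card_Suc_Diff1[of S v] by (auto simp: insert_absorb)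
  qed
  moreover have "kdiff (\<lambda>_. 1) Y (kcone v z) S = z S" for S
  proof (cases "S \<subseteq> Y")
    case True
    then have "finite S" using assms finite_subset by blast
    from kdiff_kcone[OF assms(1) this assms(3), of "\<lambda>_. 1" z]
    show ?thesis by (simp add: kcone_def[of v "kdiff _ _ _"] cyc split: if_splits)
  next
    case False
    moreover have "kdiff (\<lambda>_. 1) Y (kcone v z) S = 0"
      by (rule kdiff_outside) (use False w assms in blast)+
    ultimately show ?thesis using sub by (metis)
  qed
  ultimately show "\<exists>w. (\<forall>S. w S \<noteq> 0 \<longrightarrow> S \<in> C \<and> card S = Suc j) \<and>
      (\<forall>S. kdiff (\<lambda>_. 1) Y w S = z S)"
    by blast
qed

text \<open>The long exact sequence of the deletion \<open>B\<close> and the link \<open>L\<close> of a vertex \<open>v\<close>: the part of a cycle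
  at the faces containing \<open>v\<close> is a cycle of the link, and filling it moves the cycle into the
  deletion.\<close>

lemma kexact_deletion_link:
  assumes "finite Y" "C \<subseteq> Pow Y" "v \<in> Y"
    and B: "B = {S \<in> C. v \<notin> S}" and L: "L = {S. v \<notin> S \<and> insert v S \<in> C}"
    and down: "L \<subseteq> B"
    and eB: "kexact TYPE('k::field) Y B (Suc j)" and eL: "kexact TYPE('k) Y L j"
  shows "kexact TYPE('k) Y C (Suc j)"
proof (rule kexactI)
  fix z :: "nat set \<Rightarrow> 'k"
  assume z: "\<And>S. z S \<noteq> 0 \<Longrightarrow> S \<in> C \<and> card S = Suc j" and cyc: "\<And>S. kdiff (\<lambda>_. 1) Y z S = 0"
  have sub: "S \<subseteq> Y" if "z S \<noteq> 0" for S using z[OF that] assms by blast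
  define z1 where "z1 S = (if v \<in> S then 0 else ksign v S * z (insert v S))" for S
  have z1: "S \<in> L \<and> card S = j" if "z1 S \<noteq> 0" for S
  proof -
    have vS: "v \<notin> S" "z (insert v S) \<noteq> 0" using that by (auto simp: z1_def split: if_splits)
    then have "finite S" using sub[OF vS(2)] assms(1) finite_subset by auto
    then show ?thesis using vS z[OF vS(2)] L by auto
  qed
  have "kdiff (\<lambda>_. 1) Y z1 S = 0" for S
  proof (cases "S \<subseteq> Y \<and> v \<notin> S")
    case True
    then have fin: "finite S" using assms finite_subset by blast
    have "kdiff (\<lambda>_. 1) Y z1 S = (\<Sum>y \<in> Y - insert v S. ksign y S * z1 (insert y S))"
      unfolding kdiff_def mult_1_right
      by (rule sum.mono_neutral_right) (use assms True in \<open>auto simp: z1_def\<close>)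
    also have "\<dots> = (\<Sum>y \<in> Y - insert v S. - ksign v S * (ksign y (insert v S) * z (insert y (insert v S))))"
    proof (intro sum.cong refl)
      fix y assume y: "y \<in> Y - insert v S"
      have "ksign y S * ksign v (insert y S) = - (ksign v S * ksign y (insert v S) :: 'k)"
        by (rule ksign_exchange) (use fin True y in auto)
      then have "(ksign y S * ksign v (insert y S)) * z (insert v (insert y S))
          = - (ksign v S * ksign y (insert v S)) * z (insert v (insert y S))"
        by simp
      then show "ksign y S * z1 (insert y S)
          = - ksign v S * (ksign y (insert v S) * z (insert y (insert v S)))"
        using y True by (simp add: z1_def insert_commute mult_ac)
    qed
    also have "\<dots> = - ksign v S * kdiff (\<lambda>_. 1) Y z (insert v S)"
      by (simp add: kdiff_def sum_distrib_left)
    finally show ?thesis by (simp add: cyc)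
  next
    case False
    then show ?thesis
      unfolding kdiff_def using sub by (intro sum.neutral) (auto simp: z1_def)
  qed
  from kexactE[OF eL z1 this] obtain w1 where
    w1: "\<And>S. w1 S \<noteq> 0 \<Longrightarrow> S \<in> L \<and> card S = Suc j" and dw1: "\<And>S. kdiff (\<lambda>_. 1) Y w1 S = z1 S"
    by blast
  have w1Y: "S \<subseteq> Y" "v \<notin> S" "finite S" if "w1 S \<noteq> 0" for S
  proof -
    have "S \<in> C" "v \<notin> S" using w1[OF that] down B by auto
    then show "S \<subseteq> Y" "v \<notin> S" using assms(2) by auto
    then show "finite S" using assms(1) finite_subset by auto
  qed
  \<comment> \<open>Adding the boundary of the cone over \<open>w1\<close> removes from \<open>z\<close> all faces that contain \<open>v\<close>.\<close>
  have coneY: "S \<in> C \<and> card S = Suc (Suc j)" if "kcone v w1 S \<noteq> 0" for S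
  proof -
    have vS: "v \<in> S" "w1 (S - {v}) \<noteq> 0" using that by (auto simp: kcone_def split: if_splits)
    then show ?thesis
      using w1[OF vS(2)] w1Y(3)[OF vS(2)] L card_Suc_Diff1[of S v] by (auto simp: insert_absorb)
  qed
  define z0 where "z0 S = z S + kdiff (\<lambda>_. 1) Y (kcone v w1) S" for S
  have z0_eq: "z0 S = (if v \<in> S then 0 else z S) + w1 S" for S
  proof (cases "S \<subseteq> Y")
    case True
    then have "finite S" using assms finite_subset by blast
    from kdiff_kcone[OF assms(1) this assms(3), of "\<lambda>_. 1" w1]
    have "kdiff (\<lambda>_. 1) Y (kcone v w1) S = w1 S - kcone v z1 S"
      by (simp add: kcone_def[of v "kdiff _ _ _"] kcone_def[of v z1] dw1 algebra_simps split: if_splits)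
    moreover have "kcone v z1 S = (if v \<in> S then z S else 0)"
      by (auto simp: kcone_def z1_def insert_absorb ksign_square)
    ultimately show ?thesis by (simp add: z0_def)
  next
    case False
    have "kdiff (\<lambda>_. 1) Y (kcone v w1) S = 0"
      by (rule kdiff_outside) (use coneY assms False in blast)+
    then show ?thesis using False sub w1Y(1) unfolding z0_def by (metis add.right_neutral)
  qed
  have z0: "S \<in> B \<and> card S = Suc j" if "z0 S \<noteq> 0" for S
  proof (cases "w1 S = 0")
    case True
    then show ?thesis using that z[of S] B by (auto simp: z0_eq split: if_splits)
  next
    case False
    then show ?thesis using w1 down by blast
  qed
  have "kdiff (\<lambda>_. 1) Y z0 S = 0" for S
  proof (cases "S \<subseteq> Y")
    case True
    then have "finite S" using assms finite_subset by blast
    then show ?thesis unfolding z0_def kdiff_add by (simp add: cyc kdiff_kdiff[OF assms(1)])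
  next
    case False
    show ?thesis by (rule kdiff_outside) (use z0 B assms False in blast)+
  qed
  from kexactE[OF eB z0 this] obtain w0 where
    w0: "\<And>S. w0 S \<noteq> 0 \<Longrightarrow> S \<in> B \<and> card S = Suc (Suc j)" and dw0: "\<And>S. kdiff (\<lambda>_. 1) Y w0 S = z0 S"
    by blast
  have "S \<in> C \<and> card S = Suc (Suc j)" if "w0 S - kcone v w1 S \<noteq> 0" for S
    using that w0[of S] coneY[of S] B by (cases "w0 S = 0") auto
  moreover have "kdiff (\<lambda>_. 1) Y (\<lambda>S. w0 S - kcone v w1 S) S = z S" for S
    unfolding kdiff_diff dw0 by (simp add: z0_def)
  ultimately show "\<exists>w. (\<forall>S. w S \<noteq> 0 \<longrightarrow> S \<in> C \<and> card S = Suc (Suc j)) \<and>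
      (\<forall>S. kdiff (\<lambda>_. 1) Y w S = z S)"
    by (intro exI[of _ "\<lambda>S. w0 S - kcone v w1 S"]) blast
qed

section \<open>Vanishing for edge ideals from a vertex elimination\<close>

definition has_edge :: "nat set set \<Rightarrow> nat set \<Rightarrow> bool" where
  "has_edge E W \<longleftrightarrow> (\<exists>e \<in> E. e \<subseteq> W)"

definition nbrs :: "nat set set \<Rightarrow> nat \<Rightarrow> nat set" where
  "nbrs E v = {u. {u, v} \<in> E}"

definition cofaces :: "nat set set \<Rightarrow> nat set \<Rightarrow> nat set set" where
  "cofaces E W = {S. S \<subseteq> W \<and> has_edge E (W - S)}"

text \<open>By the multigraded decomposition below this says that, over the polynomial ring in the variables
  of \<open>V\<close>, the Koszul homology of the edge ideal of the graph induced on \<open>V\<close> vanishes in degrees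
  \<open>j \<ge> card V - D\<close>; that is, the quotient by the edge ideal has depth at least \<open>D\<close>.\<close>

definition depth_ge :: "'k::field itself \<Rightarrow> nat set set \<Rightarrow> nat set \<Rightarrow> nat set \<Rightarrow> nat \<Rightarrow> bool" where
  "depth_ge K E Y V D \<longleftrightarrow> (\<forall>W \<subseteq> V. \<forall>j. card V \<le> j + D \<longrightarrow> kexact K Y (cofaces E W) j)"

lemma depth_ge_mono: "depth_ge K E Y V D \<Longrightarrow> D' \<le> D \<Longrightarrow> depth_ge K E Y V D'"
  unfolding depth_ge_def by (meson add_left_mono le_trans)

lemma has_edge_insert:
  assumes "\<And>e. e \<in> E \<Longrightarrow> card e = 2"
  shows "has_edge E (insert v W) \<longleftrightarrow> has_edge E W \<or> W \<inter> nbrs E v \<noteq> {}"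
proof
  assume "has_edge E (insert v W)"
  then obtain e where e: "e \<in> E" "e \<subseteq> insert v W" by (auto simp: has_edge_def)
  obtain a b where ab: "e = {a, b}" "a \<noteq> b" using assms[OF e(1)] by (auto simp: card_2_iff)
  show "has_edge E W \<or> W \<inter> nbrs E v \<noteq> {}"
  proof (cases "v \<in> e")
    case True
    then obtain u where "e = {u, v}" "u \<noteq> v" using ab by auto
    then have "u \<in> W \<inter> nbrs E v" using e by (auto simp: nbrs_def)
    then show ?thesis by blast
  next
    case False
    then show ?thesis using e by (auto simp: has_edge_def)
  qed
qed (auto simp: has_edge_def nbrs_def insert_commute)

lemma kexact_Pow_Suc:
  assumes "finite Y" "T \<subseteq> Y"
  shows "kexact TYPE('k::field) Y (Pow T) (Suc j)"
proof (cases "T = {}")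
  case True
  then show ?thesis by (intro kexact_no_faces) auto
next
  case False
  then obtain v where "v \<in> T" by blast
  then show ?thesis using assms by (intro kexact_cone[where v = v]) auto
qed

text \<open>Once a vertex is chosen into an independent set, its neighbours \<open>M\<close> can no longer be chosen. In
  the complex below the deletion of such a \<open>g\<close> is a full simplex, so each of them only shifts the
  cardinality by one.\<close>

lemma kexact_nonvertices:
  assumes "finite Y" "finite M" "W \<subseteq> Y" "M \<subseteq> W"
    and "kexact TYPE('k::field) Y (cofaces E (W - M)) i"
  shows "kexact TYPE('k) Y {S. S \<subseteq> W \<and> (has_edge E (W - S) \<or> (W - S) \<inter> M \<noteq> {})} (i + card M)"
  using assms(2-)
proof (induction M arbitrary: W)
  case empty
  then show ?case by (simp add: cofaces_def)
next
  case (insert g M)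
  have "W - {g} - M = W - insert g M" by blast
  then have IH: "kexact TYPE('k) Y
      {S. S \<subseteq> W - {g} \<and> (has_edge E (W - {g} - S) \<or> (W - {g} - S) \<inter> M \<noteq> {})} (i + card M)"
    using insert.prems insert.hyps by (intro insert.IH) auto
  have "kexact TYPE('k) Y {S. S \<subseteq> W \<and> (has_edge E (W - S) \<or> (W - S) \<inter> insert g M \<noteq> {})}
      (Suc (i + card M))"
  proof (rule kexact_deletion_link[OF assms(1) _ _ refl refl])
    show "{S. S \<subseteq> W \<and> (has_edge E (W - S) \<or> (W - S) \<inter> insert g M \<noteq> {})} \<subseteq> Pow Y" "g \<in> Y"
      using insert.prems by auto
    have del: "{S \<in> {S. S \<subseteq> W \<and> (has_edge E (W - S) \<or> (W - S) \<inter> insert g M \<noteq> {})}. g \<notin> S}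
        = Pow (W - {g})"
      using insert.prems by auto
    then show "kexact TYPE('k) Y
        {S \<in> {S. S \<subseteq> W \<and> (has_edge E (W - S) \<or> (W - S) \<inter> insert g M \<noteq> {})}. g \<notin> S} (Suc (i + card M))"
      using kexact_Pow_Suc[OF assms(1)] insert.prems by (metis Diff_subset subset_trans)
    have diff: "W - {g} - S = W - insert g S" for S by blast
    have link: "{S. g \<notin> S \<and> insert g S \<in> {S. S \<subseteq> W \<and> (has_edge E (W - S) \<or> (W - S) \<inter> insert g M \<noteq> {})}}
        = {S. S \<subseteq> W - {g} \<and> (has_edge E (W - {g} - S) \<or> (W - {g} - S) \<inter> M \<noteq> {})}"
      unfolding diff using insert.prems by auto
    show "kexact TYPE('k) Y
        {S. g \<notin> S \<and> insert g S \<in> {S. S \<subseteq> W \<and> (has_edge E (W - S) \<or> (W - S) \<inter> insert g M \<noteq> {})}}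
        (i + card M)"
      unfolding link by (rule IH)
    show "{S. g \<notin> S \<and> insert g S \<in> {S. S \<subseteq> W \<and> (has_edge E (W - S) \<or> (W - S) \<inter> insert g M \<noteq> {})}}
        \<subseteq> {S \<in> {S. S \<subseteq> W \<and> (has_edge E (W - S) \<or> (W - S) \<inter> insert g M \<noteq> {})}. g \<notin> S}"
      unfolding link del by auto
  qed
  then show ?case using insert.hyps by simp
qed

lemma cofaces_subset: "cofaces E W \<subseteq> Pow W"
  by (auto simp: cofaces_def)

text \<open>In the complexes that contain an isolated vertex, this vertex is the apex of a cone.\<close>

lemma depth_ge_isolated_vertex:
  assumes "finite Y" "V \<subseteq> Y" "v \<in> V" "\<And>e. e \<in> E \<Longrightarrow> card e = 2" "V \<inter> nbrs E v = {}"
    and "depth_ge TYPE('k::field) E Y (V - {v}) D"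
  shows "depth_ge TYPE('k) E Y V (Suc D)"
  unfolding depth_ge_def
proof (intro allI impI)
  fix W j assume W: "W \<subseteq> V" and j: "card V \<le> j + Suc D"
  show "kexact TYPE('k) Y (cofaces E W) j"
  proof (cases "v \<in> W")
    case True
    show ?thesis
    proof (rule kexact_cone[OF assms(1)])
      show "cofaces E W \<subseteq> Pow Y" using cofaces_subset[of E W] W assms(2) by blast
      show "v \<in> Y" using True W assms(2) by blast
      fix S assume S: "S \<in> cofaces E W" "v \<notin> S"
      have "W - S = insert v (W - insert v S)" using S True by auto
      then have "has_edge E (insert v (W - insert v S))" using S by (simp add: cofaces_def)
      moreover have "(W - insert v S) \<inter> nbrs E v = {}" using W assms(5) by blast
      ultimately have "has_edge E (W - insert v S)"
        by (simp only: has_edge_insert[OF assms(4)]) simp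
      then show "insert v S \<in> cofaces E W" using S True by (simp add: cofaces_def)
    qed
  next
    case False
    have "finite V" using assms finite_subset by blast
    then have "card (V - {v}) \<le> j + D" using j assms(3) by simp
    then show ?thesis using assms(6) W False unfolding depth_ge_def by blast
  qed
qed

text \<open>The exact sequence of the vertex \<open>v\<close>. Its link in \<open>cofaces E W\<close> belongs to the graph without
  \<open>v\<close>; its deletion belongs to the graph without the closed neighbourhood of \<open>v\<close>, up to the
  neighbours of \<open>v\<close> in \<open>W\<close>, which shift the cardinality. The bound \<open>D' \<le> card (V - {v} - nbrs E v)\<close>
  keeps that shift from running below cardinality \<open>0\<close>.\<close>

lemma depth_ge_vertex:
  assumes fin: "finite Y" "V \<subseteq> Y" and v: "v \<in> V" and E: "\<And>e. e \<in> E \<Longrightarrow> card e = 2"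
    and ne: "V \<inter> nbrs E v \<noteq> {}"
    and del: "depth_ge TYPE('k::field) E Y (V - {v}) D"
    and lnk: "depth_ge TYPE('k) E Y (V - {v} - nbrs E v) D'"
    and D: "D \<le> Suc D'" "D' \<le> card (V - {v} - nbrs E v)"
  shows "depth_ge TYPE('k) E Y V D"
  unfolding depth_ge_def
proof (intro allI impI)
  fix W j assume W: "W \<subseteq> V" and j: "card V \<le> j + D"
  have finV: "finite V" using fin finite_subset by blast
  have vn: "v \<notin> nbrs E v" using E[of "{v}"] by (auto simp: nbrs_def)
  have "card V = Suc (card (V - {v}))" using finV v by (metis card_Suc_Diff1)
  moreover have "V - {v} = (V - {v} - nbrs E v) \<union> (V \<inter> nbrs E v)" using vn by blast
  then have "card (V - {v}) = card (V - {v} - nbrs E v) + card (V \<inter> nbrs E v)"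
    using finV by (metis (no_types, lifting) Diff_disjoint Int_Diff card_Un_disjoint finite_Diff
        finite_Int inf.commute inf_bot_right)
  ultimately have cV: "card V = Suc (card (V - {v} - nbrs E v) + card (V \<inter> nbrs E v))" by simp
  show "kexact TYPE('k) Y (cofaces E W) j"
  proof (cases "v \<in> W")
    case False
    then have "W \<subseteq> V - {v}" using W by blast
    moreover have "card (V - {v}) \<le> j + D" using j cV by (metis card_Diff1_le le_trans)
    ultimately show ?thesis using del unfolding depth_ge_def by blast
  next
    case True
    have pos: "card (V \<inter> nbrs E v) > 0" using ne finV by (simp add: card_gt_0_iff)
    then obtain j' where j': "j = Suc j'" using j D cV by (cases j) auto
    let ?M = "(W - {v}) \<inter> nbrs E v"
    have M: "card ?M \<le> card (V \<inter> nbrs E v)"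
      using finV W by (intro card_mono) auto
    have dec: "W - S = insert v (W - {v} - S)" if "v \<notin> S" for S using True that by blast
    show ?thesis unfolding j'
    proof (rule kexact_deletion_link[OF fin(1) _ _ refl refl])
      show "cofaces E W \<subseteq> Pow Y" using cofaces_subset[of E W] W fin(2) by blast
      show "v \<in> Y" using v fin by blast
      have eq: "{S. v \<notin> S \<and> insert v S \<in> cofaces E W} = cofaces E (W - {v})"
      proof -
        have diff: "W - {v} - S = W - insert v S" for S by blast
        have sub: "v \<notin> S \<and> insert v S \<subseteq> W \<longleftrightarrow> S \<subseteq> W - {v}" for S using True by blast
        show ?thesis unfolding cofaces_def mem_Collect_eq diff using sub by blast
      qed
      have "kexact TYPE('k) Y (cofaces E (W - {v})) j'"
      proof -
        have "W - {v} \<subseteq> V - {v}" "card (V - {v}) \<le> j' + D"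
          using W j j' cV \<open>card V = Suc (card (V - {v}))\<close> by auto
        then show ?thesis using del unfolding depth_ge_def by blast
      qed
      then show "kexact TYPE('k) Y {S. v \<notin> S \<and> insert v S \<in> cofaces E W} j'" by (simp add: eq)
      show "{S. v \<notin> S \<and> insert v S \<in> cofaces E W} \<subseteq> {S \<in> cofaces E W. v \<notin> S}"
        unfolding cofaces_def has_edge_def by auto
      have eq2: "{S \<in> cofaces E W. v \<notin> S} =
          {S. S \<subseteq> W - {v} \<and> (has_edge E (W - {v} - S) \<or> (W - {v} - S) \<inter> ?M \<noteq> {})}"
      proof -
        have "has_edge E (W - S) \<longleftrightarrow> has_edge E (W - {v} - S) \<or> (W - {v} - S) \<inter> ?M \<noteq> {}"
          if "v \<notin> S" for S
        proof -
          have "has_edge E (W - S) \<longleftrightarrow> has_edge E (insert v (W - {v} - S))"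
            using dec[OF that] by (rule arg_cong)
          also have "\<dots> \<longleftrightarrow> has_edge E (W - {v} - S) \<or> (W - {v} - S) \<inter> nbrs E v \<noteq> {}"
            by (rule has_edge_insert[OF E])
          also have "(W - {v} - S) \<inter> nbrs E v = (W - {v} - S) \<inter> ?M" by blast
          finally show ?thesis .
        qed
        moreover have "S \<subseteq> W \<and> v \<notin> S \<longleftrightarrow> S \<subseteq> W - {v}" for S by blast
        ultimately show ?thesis unfolding cofaces_def by blast
      qed
      have "W - {v} - ?M \<subseteq> V - {v} - nbrs E v" using W by blast
      moreover have "card (V - {v} - nbrs E v) \<le> (Suc j' - card ?M) + D'"
        using j D cV M unfolding j' by linarith
      ultimately have "kexact TYPE('k) Y (cofaces E (W - {v} - ?M)) (Suc j' - card ?M)"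
        using lnk unfolding depth_ge_def by blast
      then have "kexact TYPE('k) Y
          {S. S \<subseteq> W - {v} \<and> (has_edge E (W - {v} - S) \<or> (W - {v} - S) \<inter> ?M \<noteq> {})}
          (Suc j' - card ?M + card ?M)"
        using fin finV W by (intro kexact_nonvertices) (auto intro: finite_subset)
      moreover have "Suc j' - card ?M + card ?M = Suc j'"
        using j D cV M unfolding j' by linarith
      ultimately show "kexact TYPE('k) Y {S \<in> cofaces E W. v \<notin> S} (Suc j')"
        unfolding eq2 by simp
    qed
  qed
qed

text \<open>The result of processing the vertices from the largest to the smallest, where \<open>I\<close> collects
  the vertices that are kept and keeping a vertex removes its neighbours. So a vertex outside of \<open>I\<close>
  either was removed by a larger kept neighbour, or was dropped at its turn. The latter is done only
  to vertices that are not isolated at that time, that is, that have a smaller neighbour \<open>u\<close> not yet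
  removed.\<close>

definition elimination_set :: "nat set set \<Rightarrow> nat set \<Rightarrow> nat set \<Rightarrow> bool" where
  "elimination_set E V I \<longleftrightarrow> I \<subseteq> V \<and> (\<forall>v \<in> V - I.
    (\<exists>w \<in> I. v < w \<and> {v, w} \<in> E) \<or>
    (\<exists>u \<in> V. u < v \<and> {u, v} \<in> E \<and> (\<forall>w \<in> I. v < w \<longrightarrow> {u, w} \<notin> E)))"

lemma elimination_setI:
  assumes "I \<subseteq> V"
    "\<And>v. v \<in> V \<Longrightarrow> v \<notin> I \<Longrightarrow> (\<exists>w \<in> I. v < w \<and> {v, w} \<in> E) \<or>
      (\<exists>u \<in> V. u < v \<and> {u, v} \<in> E \<and> (\<forall>w \<in> I. v < w \<longrightarrow> {u, w} \<notin> E))"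
  shows "elimination_set E V I"
  using assms unfolding elimination_set_def by blast

text \<open>The largest vertex is kept if it is isolated; otherwise it is kept or dropped, whichever gives
  the smaller set, in accordance with the minimum in the estimate of \<open>depth_ge_vertex\<close>.\<close>

lemma ex_elimination_set:
  assumes "finite Y" "\<And>e. e \<in> E \<Longrightarrow> card e = 2" "V \<subseteq> Y"
  shows "\<exists>I. elimination_set E V I \<and> depth_ge TYPE('k::field) E Y V (card I)"
  using assms(3)
proof (induction "card V" arbitrary: V rule: less_induct)
  case less
  have finV: "finite V" using less.prems assms(1) finite_subset by blast
  show ?case
  proof (cases "V = {}")
    case True
    have "\<not> has_edge E {}"
    proof
      assume "has_edge E {}"
      then have "{} \<in> E" by (auto simp: has_edge_def)
      from assms(2)[OF this] show False by simp
    qed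
    then have empty: "cofaces E {} = {}" by (simp add: cofaces_def)
    have "kexact TYPE('k) Y (cofaces E {}) j" for j
      unfolding empty by (rule kexact_no_faces) simp
    then have "depth_ge TYPE('k) E Y V (card ({} :: nat set))"
      using True by (simp add: depth_ge_def)
    moreover have "elimination_set E V {}"
      using True by (simp add: elimination_set_def)
    ultimately show ?thesis by blast
  next
    case False
    define v where "v = Max V"
    have v: "v \<in> V" "\<And>u. u \<in> V \<Longrightarrow> u \<noteq> v \<Longrightarrow> u < v"
      using False finV by (auto simp: v_def order.not_eq_order_implies_strict)
    have vn: "v \<notin> nbrs E v" using assms(2)[of "{v}"] by (auto simp: nbrs_def)
    have "card (V - {v}) < card V" using v finV by (simp add: card_gt_0_iff False)
    with less.hyps[of "V - {v}"] less.prems obtain I1 where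
      I1: "elimination_set E (V - {v}) I1" "depth_ge TYPE('k) E Y (V - {v}) (card I1)" by blast
    have "card (V - {v} - nbrs E v) < card V" using v finV
      by (intro psubset_card_mono) auto
    with less.hyps[of "V - {v} - nbrs E v"] less.prems obtain I2 where
      I2: "elimination_set E (V - {v} - nbrs E v) I2"
        "depth_ge TYPE('k) E Y (V - {v} - nbrs E v) (card I2)" by blast
    show ?thesis
    proof (cases "V \<inter> nbrs E v = {}")
      case True
      have "v \<notin> I1" "finite I1" using I1 finV finite_subset by (auto simp: elimination_set_def)
      then have "depth_ge TYPE('k) E Y V (card (insert v I1))"
        using depth_ge_isolated_vertex[OF assms(1) less.prems v(1) assms(2) True I1(2)] by simp
      moreover have "elimination_set E V (insert v I1)"
      proof (rule elimination_setI)
        show "insert v I1 \<subseteq> V" using I1 v by (auto simp: elimination_set_def)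
        fix x assume x: "x \<in> V" "x \<notin> insert v I1"
        have nv: "{u, v} \<notin> E" if "u \<in> V" for u using True that by (auto simp: nbrs_def)
        have "(\<exists>w \<in> I1. x < w \<and> {x, w} \<in> E) \<or>
          (\<exists>u \<in> V. u < x \<and> {u, x} \<in> E \<and> (\<forall>w \<in> I1. x < w \<longrightarrow> {u, w} \<notin> E))"
          using I1(1) x unfolding elimination_set_def by blast
        then show "(\<exists>w \<in> insert v I1. x < w \<and> {x, w} \<in> E) \<or>
          (\<exists>u \<in> V. u < x \<and> {u, x} \<in> E \<and> (\<forall>w \<in> insert v I1. x < w \<longrightarrow> {u, w} \<notin> E))"
          using nv by (elim disjE bexE) blast+
      qed
      ultimately show ?thesis by blast
    next
      case False
      have I2v: "v \<notin> I2" "finite I2" "card I2 \<le> card (V - {v} - nbrs E v)"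
      proof -
        have sub: "I2 \<subseteq> V - {v} - nbrs E v" using I2(1) by (simp add: elimination_set_def)
        have fin: "finite (V - {v} - nbrs E v)" using finV by simp
        show "v \<notin> I2" "finite I2" "card I2 \<le> card (V - {v} - nbrs E v)"
          using sub finite_subset[OF sub fin] card_mono[OF fin sub] by auto
      qed
      have e1: "elimination_set E V I1"
      proof (rule elimination_setI)
        show "I1 \<subseteq> V" using I1 by (auto simp: elimination_set_def)
        fix x assume x: "x \<in> V" "x \<notin> I1"
        show "(\<exists>w \<in> I1. x < w \<and> {x, w} \<in> E) \<or>
          (\<exists>u \<in> V. u < x \<and> {u, x} \<in> E \<and> (\<forall>w \<in> I1. x < w \<longrightarrow> {u, w} \<notin> E))"
        proof (cases "x = v")
          case True
          obtain u where u: "u \<in> V" "{u, v} \<in> E" using False by (auto simp: nbrs_def)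
          then have "u \<noteq> v" using vn by (auto simp: nbrs_def)
          then have "u < v" using u v by blast
          moreover have "\<not> v < w" if "w \<in> I1" for w
            using I1(1) that v(2) unfolding elimination_set_def by fastforce
          ultimately show ?thesis using u True by blast
        next
          case False
          then show ?thesis using I1(1) x unfolding elimination_set_def by blast
        qed
      qed
      have e2: "elimination_set E V (insert v I2)"
      proof (rule elimination_setI)
        show "insert v I2 \<subseteq> V" using I2 v by (auto simp: elimination_set_def)
        fix x assume x: "x \<in> V" "x \<notin> insert v I2"
        show "(\<exists>w \<in> insert v I2. x < w \<and> {x, w} \<in> E) \<or>
          (\<exists>u \<in> V. u < x \<and> {u, x} \<in> E \<and> (\<forall>w \<in> insert v I2. x < w \<longrightarrow> {u, w} \<notin> E))"
        proof (cases "x \<in> nbrs E v")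
          case True
          then show ?thesis using x v by (auto simp: nbrs_def)
        next
          case False
          then have "x \<in> V - {v} - nbrs E v - I2" using x by auto
          then have "(\<exists>w \<in> I2. x < w \<and> {x, w} \<in> E) \<or> (\<exists>u \<in> V - {v} - nbrs E v.
              u < x \<and> {u, x} \<in> E \<and> (\<forall>w \<in> I2. x < w \<longrightarrow> {u, w} \<notin> E))"
            using I2(1) unfolding elimination_set_def by blast
          moreover have "{u, v} \<notin> E" if "u \<in> V - {v} - nbrs E v" for u using that by (auto simp: nbrs_def)
          ultimately show ?thesis by (elim disjE bexE) blast+
        qed
      qed
      have base: "depth_ge TYPE('k) E Y V D" if "D \<le> card I1" "D \<le> Suc (card I2)" for D
        using depth_ge_vertex[OF assms(1) less.prems v(1) assms(2) False depth_ge_mono[OF I1(2) that(1)]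
            I2(2) that(2) I2v(3)] .
      show ?thesis
      proof (cases "card I1 \<le> Suc (card I2)")
        case True
        then show ?thesis using e1 base by blast
      next
        case False
        then have "depth_ge TYPE('k) E Y V (card (insert v I2))" using base I2v by simp
        then show ?thesis using e2 by blast
      qed
    qed
  qed
qed

section \<open>Elimination sets of \<open>GA(t,k)'\<close>\<close>

text \<open>The differences \<open>1 + j t\<close> with \<open>1 \<le> j \<le> k - 2\<close> are those congruent to \<open>1\<close> modulo \<open>t\<close> other than \<open>1\<close>
  and \<open>n - 1 = 1 + (k - 1) t\<close>, and \<open>n\<close> minus such a difference is again one.\<close>

lemma GA'_edge_iff:
  assumes "t \<ge> 1" "k \<ge> 3" "n = GA_order t k" "u < v" "v < n"
  shows "{u, v} \<in> GA'_edges t k \<longleftrightarrow> (\<exists>j \<ge> 1. v = u + 1 + j * t) \<and> v \<noteq> u + (n - 1)"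
proof -
  have n: "n = t * (k - 2) + t + 2"
  proof -
    have "k - 1 = Suc (k - 2)" using assms(2) by simp
    then show ?thesis unfolding assms(3) GA_order_def by simp
  qed
  have small: "1 + j * t < n" "j * t \<le> t * (k - 2)" if "j \<in> {1..k - 2}" for j
  proof -
    have "j * t \<le> t * (k - 2)" unfolding mult.commute[of t] using that by (intro mult_right_mono) auto
    then show "1 + j * t < n" "j * t \<le> t * (k - 2)" using n by linarith+
  qed
  have cong: "int b - int a = 1 + int j * int t \<or> int b - int a = 1 + int j * int t - int n"
    if "a < n" "b < n" "j \<in> {1..k - 2}" "[int b - int a = 1 + int j * int t] (mod int n)" for a b j
  proof -
    from that(4) obtain q where q: "int b - int a - (1 + int j * int t) = int n * q"
      by (auto simp: cong_iff_dvd_diff)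
    have c: "0 < 1 + int j * int t" "1 + int j * int t < int n"
      using small[OF that(3)] by (auto simp flip: of_nat_mult of_nat_Suc)
    have "int n * q < int n * 1" "int n * (- 2) < int n * q"
    proof -
      have "int a < int n" "int b < int n" "0 \<le> int a" "0 \<le> int b" using that by auto
      then show "int n * q < int n * 1" "int n * (- 2) < int n * q" using q c by linarith+
    qed
    moreover have "0 < int n" using assms(5) by simp
    ultimately have "q < 1" "- 2 < q" by (simp_all only: mult_less_cancel_left_pos)
    then have "q = 0 \<or> q = - 1" by auto
    then show ?thesis using q by auto
  qed
  have refl_t: "t * (k - 2) - j * t = (k - 2 - j) * t" for j
    by (simp add: algebra_simps)
  show ?thesis
  proof
    assume "{u, v} \<in> GA'_edges t k"
    then obtain a b j where ab: "{u, v} = {a, b}" "a < n" "b < n" "j \<in> {1..k - 2}"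
      "[int b - int a = 1 + int j * int t] (mod int n)"
      unfolding GA'_edges_def assms(3) by blast
    from cong[OF ab(2-5)] show "(\<exists>j \<ge> 1. v = u + 1 + j * t) \<and> v \<noteq> u + (n - 1)"
    proof
      assume "int b - int a = 1 + int j * int t"
      then have "b = a + 1 + j * t" by (simp flip: of_nat_mult of_nat_Suc of_nat_add)
      moreover from this have "u = a" "v = b" using ab(1) assms(4) by (auto simp: doubleton_eq_iff)
      moreover have "j * t < t * (k - 2) + t" using small(2)[OF ab(4)] assms(1) by linarith
      ultimately show ?thesis using ab(4) n by auto
    next
      assume "int b - int a = 1 + int j * int t - int n"
      then have eq: "a + 1 + j * t = b + n" by (simp flip: of_nat_mult of_nat_Suc of_nat_add)
      have "1 + j * t < n" by (rule small(1)[OF ab(4)])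
      then have "b < a" using eq by linarith
      then have uv: "u = b" "v = a" using ab(1) assms(4) by (auto simp: doubleton_eq_iff)
      have "a = b + 1 + (t * (k - 2) - j * t + t)" using eq small(2)[OF ab(4)] n by linarith
      then have "v = u + 1 + (k - 2 - j + 1) * t" using uv refl_t by simp
      moreover have "j * t \<ge> t" using ab(4) by simp
      then have "v \<noteq> u + (n - 1)" using eq uv assms(1) n by linarith
      ultimately show ?thesis by (metis le_add2)
    qed
  next
    assume R: "(\<exists>j \<ge> 1. v = u + 1 + j * t) \<and> v \<noteq> u + (n - 1)"
    then obtain j where j: "j \<ge> 1" "v = u + 1 + j * t" by blast
    have "\<not> j > k - 2"
    proof
      assume "j > k - 2"
      then have "j * t \<ge> (k - 2 + 1) * t" by (intro mult_right_mono) auto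
      then have "j * t \<ge> n - 2" using n by (simp add: algebra_simps)
      then show False using j R assms(5) n by simp
    qed
    then have "j \<in> {1..k - 2}" using j by simp
    moreover have "int v - int u = 1 + int j * int t" using j(2) by simp
    then have "[int v - int u = 1 + int j * int t] (mod int n)" by (simp only: cong_refl)
    ultimately show "{u, v} \<in> GA'_edges t k"
      unfolding GA'_edges_def assms(3)[symmetric] using assms(4,5) less_trans by blast
  qed
qed

lemma GA'_edges_card:
  assumes "t \<ge> 1" "k \<ge> 3" "e \<in> GA'_edges t k"
  shows "card e = 2 \<and> e \<subseteq> {..<GA_order t k}"
proof -
  obtain a b j where ab: "e = {a, b}" "a < GA_order t k" "b < GA_order t k" "j \<in> {1..k - 2}"
      "[int b - int a = 1 + int j * int t] (mod int (GA_order t k))"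
    using assms(3) unfolding GA'_edges_def by blast
  have "a \<noteq> b"
  proof
    assume "a = b"
    then have "int (GA_order t k) dvd 1 + int j * int t"
      using ab(5) dvd_minus_iff[of "int (GA_order t k)" "1 + int j * int t"]
      by (simp add: cong_iff_dvd_diff)
    then have "GA_order t k dvd 1 + j * t"
      by (metis int_dvd_int_iff of_nat_1 of_nat_add of_nat_mult)
    then have "GA_order t k \<le> 1 + j * t" by (rule dvd_imp_le) simp
    moreover have "j * t \<le> (k - 1) * t" using ab(4) by (intro mult_right_mono) auto
    moreover have "GA_order t k = (k - 1) * t + 2" by (simp add: GA_order_def)
    ultimately show False by linarith
  qed
  then show ?thesis using ab by simp
qed

lemma residue_unique:
  fixes t :: nat
  assumes "v + i * t = v' + i' * t" "v \<in> {1..t}" "v' \<in> {1..t}"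
  shows "v = v'"
proof -
  have "(v - 1 + i * t) mod t = (v' - 1 + i' * t) mod t"
    using assms by (metis Nat.add_diff_assoc2 atLeastAtMost_iff)
  moreover have "v - 1 < t" "v' - 1 < t" using assms by auto
  ultimately have "v - 1 = v' - 1" by simp
  moreover have "1 \<le> v" "1 \<le> v'" using assms by auto
  ultimately show ?thesis by linarith
qed

text \<open>No \<open>v \<le> t\<close> has a smaller neighbour, so every such \<open>v\<close> lies in an elimination set \<open>I\<close> or has a larger
  neighbour in it; call this member of \<open>I\<close> a server of \<open>v\<close>. A member of \<open>I\<close> serves only one
  such \<open>v\<close>, unless it serves both \<open>0\<close> and \<open>t\<close>; so if \<open>card I \<le> t\<close>, then each
  member serves exactly one \<open>v\<close> in \<open>{1..t}\<close>, and the server \<open>w\<close> of \<open>t\<close> serves \<open>0\<close> too. Applying the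
  elimination condition just below the server of \<open>v\<close> shows that the server of \<open>v - 1\<close> is smaller,
  and going down from \<open>t\<close> to \<open>0\<close> yields \<open>w < w\<close>. To make this work for a \<open>v\<close> that serves itself,
  the server of \<open>v\<close> is replaced by its maximum with \<open>v + t + 1\<close>.\<close>

lemma card_elimination_set_GA':
  assumes t: "t \<ge> 1" and k: "k \<ge> 3" and n: "n = GA_order t k"
    and I: "elimination_set (GA'_edges t k) {..<n} I"
  shows "t + 1 \<le> card I"
proof (rule ccontr)
  let ?E = "GA'_edges t k"
  assume "\<not> t + 1 \<le> card I"
  then have cI: "card I \<le> t" by simp
  have n': "n = t * (k - 2) + t + 2"
  proof -
    have "k - 1 = Suc (k - 2)" using k by simp
    then show ?thesis unfolding n GA_order_def by simp
  qed
  have "t * (k - 2) \<ge> t * 1" using k by (intro mult_left_mono) auto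
  then have n2: "2 * t + 2 \<le> n" using n' by simp
  have IV: "\<And>e. e \<in> I \<Longrightarrow> e < n" and finI: "finite I"
    using I finite_subset by (auto simp: elimination_set_def)
  note adj = GA'_edge_iff[OF t k n]
  define serves where "serves e v \<longleftrightarrow> e = v \<or> (v < e \<and> {v, e} \<in> ?E)" for e v
  have far: "\<exists>j \<ge> 1. e = v + 1 + j * t" if "e \<noteq> v" "serves e v" "e < n" for e v
    using that adj[of v e] by (auto simp: serves_def)
  have far': "t + 1 + v \<le> e" if "e \<noteq> v" "serves e v" "e < n" for e v
  proof -
    from far[OF that] obtain j where j: "j \<ge> 1" "e = v + 1 + j * t" by blast
    then have "1 * t \<le> j * t" by (intro mult_right_mono) auto
    then show ?thesis using j by simp
  qed
  have "\<exists>e. e \<in> I \<and> serves e v" if "v \<le> t" for v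
  proof (cases "v \<in> I")
    case True
    then show ?thesis by (auto simp: serves_def)
  next
    case False
    then have "v \<in> {..<n} - I" using that n2 by simp
    then have "(\<exists>w \<in> I. v < w \<and> {v, w} \<in> ?E) \<or> (\<exists>u. u < v \<and> {u, v} \<in> ?E)"
      using I unfolding elimination_set_def by blast
    then show ?thesis
    proof
      assume "\<exists>u. u < v \<and> {u, v} \<in> ?E"
      then obtain u where u: "u < v" "{u, v} \<in> ?E" by blast
      then have "t + 1 + u \<le> v" using that n2 by (intro far') (auto simp: serves_def)
      then show ?thesis using that by simp
    qed (auto simp: serves_def)
  qed
  then obtain \<phi> where \<phi>: "\<And>v. v \<le> t \<Longrightarrow> \<phi> v \<in> I \<and> serves (\<phi> v) v" by metis
  have serves_inj: "v = v'" if "serves e v" "serves e v'" "v \<in> {1..t}" "v' \<in> {1..t}" "e < n" for e v v'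
  proof -
    consider "e = v" | "e = v'" | "e \<noteq> v" "e \<noteq> v'" by blast
    then show ?thesis
    proof cases
      case 1
      then show ?thesis using far'[of e v'] that by auto
    next
      case 2
      then show ?thesis using far'[of e v] that by auto
    next
      case 3
      from far[OF 3(1) that(1) that(5)] obtain j where "e = v + 1 + j * t" by blast
      moreover from far[OF 3(2) that(2) that(5)] obtain j' where "e = v' + 1 + j' * t" by blast
      ultimately have "v + j * t = v' + j' * t" by simp
      then show ?thesis by (rule residue_unique) (fact that)+
    qed
  qed
  have "inj_on \<phi> {1..t}"
  proof (rule inj_onI)
    fix v v' assume v: "v \<in> {1..t}" "v' \<in> {1..t}" and eq: "\<phi> v = \<phi> v'"
    have "serves (\<phi> v) v" "serves (\<phi> v) v'" "\<phi> v < n"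
      using \<phi>[of v] \<phi>[of v'] v eq IV by auto
    then show "v = v'" by (rule serves_inj[OF _ _ v])
  qed
  then have "card (\<phi> ` {1..t}) = t" by (simp add: card_image)
  moreover have "\<phi> ` {1..t} \<subseteq> I" using \<phi> by auto
  ultimately have surj: "\<phi> ` {1..t} = I" using cI finI by (metis card_seteq)
  have uniq: "e = \<phi> v" if e: "e \<in> I" "serves e v" and v: "v \<in> {1..t}" for e v
  proof -
    from e surj obtain v' where v': "v' \<in> {1..t}" "e = \<phi> v'" by blast
    have "serves e v'" "e < n" using \<phi>[of v'] v' e IV by auto
    then have "v = v'" by (intro serves_inj[OF e(2) _ v v'(1)])
    then show ?thesis using v' by simp
  qed
  define w where "w = \<phi> t"
  have w: "w \<in> I" "w < n" "serves w t" using \<phi>[of t] IV by (auto simp: w_def)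
  have uniq0: "e = w \<and> e \<noteq> n - 1" if e: "e \<in> I" "serves e 0" for e
  proof -
    from e surj obtain v where v: "v \<in> {1..t}" "e = \<phi> v" by blast
    then have dv: "serves e v" using \<phi>[of v] by auto
    then have "e \<noteq> 0" using v by (auto simp: serves_def)
    then have "e < n" "{0, e} \<in> ?E" "0 < e" using e IV by (auto simp: serves_def)
    then obtain j where j: "j \<ge> 1" "e = 1 + j * t" "e \<noteq> n - 1" using adj[of 0 e] by auto
    have "1 * t \<le> j * t" using j(1) by (intro mult_right_mono) auto
    moreover have "v \<le> t" using v by simp
    ultimately have "e \<noteq> v" using j(2) by linarith
    from far[OF this dv \<open>e < n\<close>] obtain j' where "e = v + 1 + j' * t" by blast
    moreover have "j * t = (j - 1) * t + t" using j(1) by (cases j) auto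
    ultimately have "v + j' * t = t + (j - 1) * t" using j by simp
    then have "v = t" by (rule residue_unique) (use v t in auto)
    then show ?thesis using v j by (simp add: w_def)
  qed
  have w0: "serves w 0" "w \<noteq> n - 1"
    using \<phi>[of 0] uniq0[of "\<phi> 0"] by auto
  have last: "n - 1 \<notin> I"
  proof
    assume "n - 1 \<in> I"
    moreover have "{t, n - 1} \<in> ?E"
      using adj[of t "n - 1"] n' n2 k t by (auto intro: exI[of _ "k - 2"])
    moreover have "t < n - 1" using n2 t by linarith
    ultimately have "n - 1 \<in> I" "serves (n - 1) t" by (simp_all add: serves_def)
    then have "n - 1 = w" using uniq[of "n - 1" t] t by (simp add: w_def)
    then show False using w0 by simp
  qed
  have edge: "{u, e} \<in> ?E" if "e \<in> I" "e = u + 1 + j * t" "j \<ge> 1" for u e j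
  proof -
    have "e < n" "e \<noteq> n - 1" using that IV last by auto
    then have "e \<noteq> u + (n - 1)" by linarith
    then show ?thesis using that \<open>e < n\<close> adj[of u e] by auto
  qed
  define W where "W v = (if v = 0 then w else \<phi> v)" for v
  have W: "W v \<in> I" "serves (W v) v" "W v < n" if "v \<le> t" for v
    using \<phi>[OF that] w w0 IV by (auto simp: W_def)
  have Wu: "e = W v" if "e \<in> I" "serves e v" "v \<le> t" for e v
    using uniq[of e v] uniq0[of e] that by (cases "v = 0") (auto simp: W_def)
  define g where "g v = max (W v) (v + t + 1)" for v
  \<comment> \<open>The vertex \<open>x = g (Suc v) - 1\<close> is congruent to \<open>Suc v\<close> modulo \<open>t\<close>, so its larger neighbours in \<open>I\<close> serve
    \<open>Suc v\<close>, and a server of \<open>v\<close> above \<open>x\<close> is adjacent to every smaller neighbour of \<open>x\<close>.\<close>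
  have step: "g v < g (Suc v)" if v: "Suc v \<le> t" for v
  proof (rule ccontr)
    assume "\<not> g v < g (Suc v)"
    then have ge: "g (Suc v) \<le> W v" by (auto simp: g_def)
    define x where "x = g (Suc v) - 1"
    have gx: "g (Suc v) = Suc x" by (simp add: x_def g_def max_def)
    obtain i where i: "i \<ge> 1" "x = Suc v + i * t"
    proof (cases "W (Suc v) = Suc v")
      case True
      then have "x = Suc v + 1 * t" by (simp add: x_def g_def)
      then show thesis using that by blast
    next
      case False
      then obtain j where j: "j \<ge> 1" "W (Suc v) = Suc v + 1 + j * t"
        using far[of "W (Suc v)" "Suc v"] W[OF v] by blast
      have "Suc v + t + 1 \<le> W (Suc v)" using far'[OF False] W[OF v] by simp
      then have "g (Suc v) = W (Suc v)" by (simp add: g_def)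
      then have "x = Suc v + j * t" using j(2) by (simp add: x_def)
      then show thesis using that j by blast
    qed
    have xn: "x < n" using ge gx W(3)[of v] v by simp
    have "x \<notin> I"
    proof
      assume "x \<in> I"
      then have "serves x v" using edge[of x v i] i by (auto simp: serves_def)
      then have "x = W v" using Wu \<open>x \<in> I\<close> v by simp
      then show False using ge gx by simp
    qed
    then have "x \<in> {..<n} - I" using xn by simp
    then have "(\<exists>w \<in> I. x < w \<and> {x, w} \<in> ?E) \<or>
        (\<exists>u \<in> {..<n}. u < x \<and> {u, x} \<in> ?E \<and> (\<forall>w \<in> I. x < w \<longrightarrow> {u, w} \<notin> ?E))"
      using I unfolding elimination_set_def by blast
    then show False
    proof
      assume "\<exists>w \<in> I. x < w \<and> {x, w} \<in> ?E"
      then obtain e where e: "e \<in> I" "x < e" "{x, e} \<in> ?E" by blast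
      then obtain j where j: "j \<ge> 1" "e = x + 1 + j * t" using adj[of x e] IV by blast
      then have "e = Suc v + 1 + (i + j) * t" using i by (simp add: algebra_simps)
      then have "serves e (Suc v)" using edge[of e "Suc v" "i + j"] e i by (auto simp: serves_def)
      then have "e = W (Suc v)" using Wu e v by blast
      then have "e \<le> Suc x" using gx by (simp add: g_def max_def split: if_splits)
      moreover have "0 < j * t" using j t by simp
      ultimately show False using j by simp
    next
      assume "\<exists>u \<in> {..<n}. u < x \<and> {u, x} \<in> ?E \<and> (\<forall>w \<in> I. x < w \<longrightarrow> {u, w} \<notin> ?E)"
      then obtain u where u: "u < x" "{u, x} \<in> ?E" "\<And>w. w \<in> I \<Longrightarrow> x < w \<Longrightarrow> {u, w} \<notin> ?E" by blast
      then obtain i' where i': "i' \<ge> 1" "x = u + 1 + i' * t" using adj[of u x] xn by blast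
      have "W v \<noteq> v" using ge by (auto simp: g_def)
      then obtain j where j: "W v = v + 1 + j * t" using far[of "W v" v] W[of v] v by auto
      have "x < W v" using ge gx by simp
      then have "i * t < j * t" using i j by simp
      then obtain d where "j = i + d" by (metis less_imp_add_positive mult_less_cancel2)
      then have "W v = u + 1 + (i' + d) * t" using i i' j by (simp add: algebra_simps)
      then have "{u, W v} \<in> ?E" using edge[of "W v" u "i' + d"] W(1)[of v] v i' by simp
      then show False using u(3) W(1)[of v] v \<open>x < W v\<close> by simp
    qed
  qed
  have "g 0 + v \<le> g v" if "v \<le> t" for v
    using that
  proof (induction v)
    case (Suc v)
    then show ?case using step[of v] by simp
  qed simp
  from this[of t] have "g 0 + t \<le> g t" by simp
  moreover have "w \<noteq> t" using far'[of w 0] w0 w t by auto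
  then have "g t = w" using far'[of w t] w t by (simp add: g_def W_def w_def)
  ultimately show False using t by (simp add: g_def W_def)
qed

section \<open>Koszul homology of monomial modules\<close>

abbreviation lookup where "lookup \<equiv> Poly_Mapping.lookup"
abbreviation keys where "keys \<equiv> Poly_Mapping.keys"

definition set_monomial :: "nat set \<Rightarrow> nat \<Rightarrow>\<^sub>0 nat" where
  "set_monomial S = (\<Sum>i \<in> S. Poly_Mapping.single i 1)"

lemma lookup_set_monomial: "finite S \<Longrightarrow> lookup (set_monomial S) i = (if i \<in> S then 1 else 0)"
  by (simp add: set_monomial_def lookup_sum lookup_single when_def)

lemma keys_set_monomial: "finite S \<Longrightarrow> keys (set_monomial S) = S"
  by (auto simp: in_keys_iff lookup_set_monomial split: if_splits)

lemma set_monomial_le: "finite S \<Longrightarrow> S \<subseteq> keys a \<Longrightarrow> (a - set_monomial S) + set_monomial S = a"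
  by (intro poly_mapping_eqI) (auto simp: lookup_add lookup_minus lookup_set_monomial in_keys_iff subset_iff)

lemma mdeg_superset:
  "finite A \<Longrightarrow> keys m \<subseteq> A \<Longrightarrow> monomial_degree m = (\<Sum>i \<in> A. lookup m i)"
  unfolding monomial_degree_def by (rule sum.mono_neutral_left) (auto simp: in_keys_iff)

lemma mdeg_add: "monomial_degree (a + b) = monomial_degree a + monomial_degree b"
proof -
  let ?A = "keys a \<union> keys b"
  have "monomial_degree (a + b) = (\<Sum>i \<in> ?A. lookup (a + b) i)"
    using Poly_Mapping.keys_add[of a b] by (intro mdeg_superset) auto
  then show ?thesis
    using mdeg_superset[of ?A a] mdeg_superset[of ?A b] by (simp add: lookup_add sum.distrib)
qed

lemma mdeg_set_monomial: "finite S \<Longrightarrow> monomial_degree (set_monomial S) = card S"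
  by (simp add: monomial_degree_def keys_set_monomial lookup_set_monomial)

lemma mdeg_eq_0_iff: "monomial_degree m = 0 \<longleftrightarrow> m = 0"
  by (auto simp: monomial_degree_def in_keys_iff intro!: poly_mapping_eqI)

lemma keys_add_nat: "keys (a + b :: nat \<Rightarrow>\<^sub>0 nat) = keys a \<union> keys b"
  by (auto simp: in_keys_iff lookup_add)

lemma lookup_single_mult:
  "lookup (Poly_Mapping.single a c * p) k = (if \<exists>m. k = a + m then c * lookup p (k - a) else 0)"
  for a :: "nat \<Rightarrow>\<^sub>0 nat" and p :: "'a::comm_ring_1 mpoly"
proof -
  have "lookup (Poly_Mapping.single a c * p) k = (\<Sum>l. (c when a = l) * (\<Sum>q. lookup p q when k = l + q))"
    by (simp add: lookup_mult lookup_single)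
  also have "\<dots> = c * (\<Sum>q. lookup p q when k = a + q)"
    by (simp add: when_mult)
  also have "\<dots> = (if \<exists>m. k = a + m then c * lookup p (k - a) else 0)"
    by auto
  finally show ?thesis .
qed

lemma lookup_var_mult:
  "lookup (var y * p) m = (if y \<in> keys m then lookup p (m - Poly_Mapping.single y 1) else 0)"
proof -
  have "(\<exists>m'. m = Poly_Mapping.single y 1 + m') \<longleftrightarrow> y \<in> keys m"
  proof
    assume "y \<in> keys m"
    then have "m = Poly_Mapping.single y 1 + (m - Poly_Mapping.single y 1)"
      by (intro poly_mapping_eqI) (auto simp: lookup_add lookup_minus lookup_single when_def in_keys_iff)
    then show "\<exists>m'. m = Poly_Mapping.single y 1 + m'" by blast
  qed (auto simp: in_keys_iff lookup_add)
  then show ?thesis by (simp add: var_def lookup_single_mult)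
qed

lemma lookup_ksign_mult: "lookup (ksign y S * p) m = ksign y S * lookup p m"
  for p :: "'a::comm_ring_1 mpoly"
proof -
  have "lookup ((- 1) ^ c * p) m = (- 1) ^ c * lookup p m" for c :: nat
    by (induction c) (simp_all add: mult.assoc)
  then show ?thesis by (simp add: ksign_def)
qed

text \<open>In multidegree \<open>a\<close> a Koszul chain is a function from sets to the field, because the monomial
  \<open>x\<^sup>m\<close> in the coefficient of the basis vector of \<open>S\<close> has multidegree \<open>m + set_monomial S\<close>.\<close>

definition multi_part :: "(nat set \<Rightarrow> 'a::field mpoly) \<Rightarrow> (nat \<Rightarrow>\<^sub>0 nat) \<Rightarrow> nat set \<Rightarrow> 'a" where
  "multi_part u a S = (if finite S \<and> S \<subseteq> keys a then lookup (u S) (a - set_monomial S) else 0)"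

lemma multi_part_kdiff:
  assumes "finite Y"
  shows "multi_part (kdiff var Y u) a S = kdiff (\<lambda>_. 1) Y (multi_part u a) S"
proof (cases "finite S \<and> S \<subseteq> keys a")
  case False
  then have "multi_part u a (insert y S) = 0" for y by (auto simp: multi_part_def)
  then show ?thesis using False by (auto simp: multi_part_def kdiff_def)
next
  case True
  have "lookup (ksign y S * var y * u (insert y S)) (a - set_monomial S) = ksign y S * multi_part u a (insert y S)"
    if y: "y \<in> Y - S" for y
  proof -
    have "y \<in> keys (a - set_monomial S) \<longleftrightarrow> y \<in> keys a"
      using True y by (simp add: in_keys_iff lookup_minus lookup_set_monomial)
    moreover have "a - set_monomial S - Poly_Mapping.single y 1 = a - set_monomial (insert y S)"
      using True y by (intro poly_mapping_eqI) (auto simp: lookup_minus lookup_set_monomial lookup_single when_def)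
    ultimately show ?thesis
      using True by (simp add: mult.assoc lookup_ksign_mult lookup_var_mult multi_part_def)
  qed
  then show ?thesis
    using True by (simp add: multi_part_def[of "kdiff var Y u"] kdiff_def lookup_sum)
qed

lemma multi_part_add_set_monomial: "finite S \<Longrightarrow> multi_part u (m + set_monomial S) S = lookup (u S) m"
  by (simp add: multi_part_def keys_add_nat keys_set_monomial)

text \<open>The sets \<open>S\<close> whose basis vector has in multidegree \<open>a\<close> a coefficient in the ideal spanned
  by \<open>L\<close>.\<close>

definition upper_koszul :: "(nat \<Rightarrow>\<^sub>0 nat) set \<Rightarrow> nat set \<Rightarrow> (nat \<Rightarrow>\<^sub>0 nat) \<Rightarrow> nat set set" where
  "upper_koszul L Y a = {S. S \<subseteq> Y \<inter> keys a \<and> a - set_monomial S \<in> L}"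

text \<open>A Koszul cycle with coefficients in a monomial ideal splits into its multidegree parts, which
  are simplicial cycles over the field; the boundaries found for them one by one are put together
  again.\<close>

lemma koszul_cycle_is_boundary:
  fixes u :: "nat set \<Rightarrow> 'a::field mpoly"
  assumes Y: "finite Y" and supp: "\<And>S. u S \<noteq> 0 \<Longrightarrow> S \<subseteq> Y \<and> card S = j"
    and L: "\<And>S. keys (u S) \<subseteq> L" and cyc: "\<And>S. kdiff var Y u S = 0"
    and ex: "\<And>a. (\<exists>S. multi_part u a S \<noteq> 0) \<Longrightarrow> kexact TYPE('a) Y (upper_koszul L Y a) j"
  shows "\<exists>w. (\<forall>S. w S \<noteq> 0 \<longrightarrow> S \<subseteq> Y \<and> card S = Suc j) \<and> (\<forall>S. keys (w S) \<subseteq> L) \<and>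
    (\<forall>S. kdiff var Y w S = u S) \<and>
    (\<forall>S m. m \<in> keys (w S) \<longrightarrow> (\<exists>S' m'. m' \<in> keys (u S') \<and> m' + set_monomial S' = m + set_monomial S))"
proof -
  let ?C = "upper_koszul L Y"
  have fin: "finite S" if "S \<subseteq> Y" for S using that Y finite_subset by blast
  have u_part: "S \<in> ?C a \<and> card S = j" if "multi_part u a S \<noteq> 0" for a S
  proof -
    have S: "S \<subseteq> keys a" "lookup (u S) (a - set_monomial S) \<noteq> 0"
      using that by (auto simp: multi_part_def split: if_splits)
    then have "u S \<noteq> 0" "a - set_monomial S \<in> keys (u S)" by (auto simp: in_keys_iff)
    then have "u S \<noteq> 0" "a - set_monomial S \<in> L" using L by auto
    then show ?thesis using S supp unfolding upper_koszul_def by auto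
  qed
  have "\<exists>w. ((\<forall>S. multi_part u a S = 0) \<longrightarrow> w = (\<lambda>_. 0)) \<and>
      (\<forall>S. w S \<noteq> 0 \<longrightarrow> S \<in> ?C a \<and> card S = Suc j) \<and> (\<forall>S. kdiff (\<lambda>_. 1) Y w S = multi_part u a S)" for a
  proof (cases "\<exists>S. multi_part u a S \<noteq> 0")
    case False
    then show ?thesis by (intro exI[of _ "\<lambda>_. 0"]) (simp add: kdiff_def)
  next
    case True
    have "kdiff (\<lambda>_. 1) Y (multi_part u a) S = 0" for S
      unfolding multi_part_kdiff[OF Y, symmetric] by (simp add: multi_part_def cyc)
    from kexactE[OF ex[OF True] u_part this] obtain w where
      "\<And>S. w S \<noteq> 0 \<Longrightarrow> S \<in> ?C a \<and> card S = Suc j" "\<And>S. kdiff (\<lambda>_. 1) Y w S = multi_part u a S"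
      by blast
    then show ?thesis using True by blast
  qed
  then obtain W where W0: "\<And>a. (\<And>S. multi_part u a S = 0) \<Longrightarrow> W a = (\<lambda>_. 0)"
    and W: "\<And>a S. W a S \<noteq> 0 \<Longrightarrow> S \<in> ?C a \<and> card S = Suc j"
    and dW: "\<And>a S. kdiff (\<lambda>_. 1) Y (W a) S = multi_part u a S"
    by metis
  \<comment> \<open>Only the multidegrees in \<open>A\<close> occur in \<open>u\<close>; they are finitely many, so that the coefficients of
    \<open>w\<close> below are polynomials.\<close>
  define A where "A = (\<Union>S \<in> Pow Y. (\<lambda>m. m + set_monomial S) ` keys (u S))"
  have A: "a \<in> A" if "W a S \<noteq> 0" for a S
  proof -
    have "\<exists>S. multi_part u a S \<noteq> 0" using W0[of a] that by (metis)
    then obtain S' where S': "multi_part u a S' \<noteq> 0" by blast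
    then have "a - set_monomial S' \<in> keys (u S')" "S' \<subseteq> keys a" "finite S'"
      by (auto simp: multi_part_def in_keys_iff split: if_splits)
    moreover have "S' \<subseteq> Y" using u_part[OF S'] by (simp add: upper_koszul_def)
    ultimately show ?thesis
      unfolding A_def using set_monomial_le[of S' a]
      by (intro UN_I[of S'] image_eqI[of _ _ "a - set_monomial S'"]) auto
  qed
  define w where "w S = Abs_poly_mapping (\<lambda>m. W (m + set_monomial S) S)" for S
  have finA: "finite A" unfolding A_def using Y by (intro finite_UN_I) auto
  have lw: "lookup (w S) m = W (m + set_monomial S) S" for S m
  proof -
    have "{m. W (m + set_monomial S) S \<noteq> 0} \<subseteq> (\<lambda>a. a - set_monomial S) ` A"
      using A by (force intro: image_eqI[where x = "m + set_monomial S" for m])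
    then have "finite {m. W (m + set_monomial S) S \<noteq> 0}" using finA finite_surj by blast
    then show ?thesis unfolding w_def by (simp add: lookup_Abs_poly_mapping)
  qed
  have wS: "S \<subseteq> Y \<and> card S = Suc j \<and> m \<in> L \<and> (\<exists>S' m'. m' \<in> keys (u S') \<and> m' + set_monomial S' = m + set_monomial S)"
    if "m \<in> keys (w S)" for S m
  proof -
    have nz: "W (m + set_monomial S) S \<noteq> 0" using that by (simp add: in_keys_iff lw)
    have "m + set_monomial S - set_monomial S = m" by simp
    then have "S \<subseteq> Y \<and> card S = Suc j \<and> m \<in> L" using W[OF nz] by (simp add: upper_koszul_def)
    moreover obtain S' m' where "m' \<in> keys (u S')" "m + set_monomial S = m' + set_monomial S'"
      using A[OF nz] unfolding A_def by blast
    ultimately show ?thesis by metis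
  qed
  have part_w: "multi_part w a = W a" for a
  proof
    fix S
    show "multi_part w a S = W a S"
    proof (cases "finite S \<and> S \<subseteq> keys a")
      case True
      then show ?thesis by (simp add: multi_part_def lw set_monomial_le)
    next
      case False
      then have "W a S = 0" using W[of a S] fin by (auto simp: upper_koszul_def)
      then show ?thesis using False by (auto simp: multi_part_def)
    qed
  qed
  have supp_w: "S \<subseteq> Y \<and> card S = Suc j" if "w S \<noteq> 0" for S
  proof -
    from that obtain m where "m \<in> keys (w S)" by (metis keys_eq_empty all_not_in_conv)
    then show ?thesis using wS by blast
  qed
  have "kdiff var Y w S = u S" for S
  proof (cases "S \<subseteq> Y")
    case True
    show ?thesis
    proof (rule poly_mapping_eqI)
      fix m
      have "lookup (kdiff var Y w S) m = multi_part (kdiff var Y w) (m + set_monomial S) S"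
        by (simp add: multi_part_add_set_monomial fin[OF True])
      also have "\<dots> = multi_part u (m + set_monomial S) S"
        by (simp add: multi_part_kdiff[OF Y] part_w dW)
      finally show "lookup (kdiff var Y w S) m = lookup (u S) m"
        by (simp add: multi_part_add_set_monomial fin[OF True])
    qed
  next
    case False
    then have "u S = 0" using supp by blast
    moreover have "kdiff var Y w S = 0" by (rule kdiff_outside) (use supp_w False in auto)
    ultimately show ?thesis by simp
  qed
  then show ?thesis using supp_w wS by (intro exI[of _ w]) blast
qed

section \<open>Koszul homology of graded submodules of free modules\<close>

text \<open>Elements of a free module of rank \<open>b\<close> are functions that vanish from \<open>b\<close> on. The monomial
  submodule \<open>monomial_module L b\<close> is the whole free module over \<open>K[x\<^sub>0, \<dots>, x\<^bsub>n-1\<^esub>]\<close> for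
  \<open>L = monomials n\<close>, and for \<open>b = 1\<close> it is the ideal spanned by \<open>L\<close>.\<close>

definition monomials :: "nat \<Rightarrow> (nat \<Rightarrow>\<^sub>0 nat) set" where
  "monomials n = {m. keys m \<subseteq> {..<n}}"

definition monomial_module :: "(nat \<Rightarrow>\<^sub>0 nat) set \<Rightarrow> nat \<Rightarrow> (nat \<Rightarrow> 'a::field mpoly) set" where
  "monomial_module L b = {f. (\<forall>r<b. keys (f r) \<subseteq> L) \<and> (\<forall>r\<ge>b. f r = 0)}"

definition homv :: "(nat \<Rightarrow> int) \<Rightarrow> int \<Rightarrow> (nat \<Rightarrow> 'a::field mpoly) \<Rightarrow> bool" where
  "homv d e f \<longleftrightarrow> (\<forall>r. homogeneous (e - d r) (f r))"

definition bd :: "nat set \<Rightarrow> (nat set \<Rightarrow> nat \<Rightarrow> 'a::field mpoly) \<Rightarrow> nat set \<Rightarrow> nat \<Rightarrow> 'a mpoly" where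
  "bd Y u S r = kdiff var Y (\<lambda>S. u S r) S"

text \<open>The basis vector of \<open>S\<close> has degree \<open>card S\<close>, so that the differential preserves the total
  degree \<open>e\<close>.\<close>

definition koszul_chain :: "nat set \<Rightarrow> (nat \<Rightarrow> 'a::field mpoly) set \<Rightarrow> (nat \<Rightarrow> int) \<Rightarrow> nat \<Rightarrow> int \<Rightarrow>
    (nat set \<Rightarrow> nat \<Rightarrow> 'a mpoly) \<Rightarrow> bool" where
  "koszul_chain Y N d j e u \<longleftrightarrow> (\<forall>S. if S \<subseteq> Y \<and> card S = j
     then u S \<in> N \<and> homv d (e - int j) (u S) else u S = (\<lambda>_. 0))"

definition koszul_exact :: "nat set \<Rightarrow> (nat \<Rightarrow> 'a::field mpoly) set \<Rightarrow> (nat \<Rightarrow> int) \<Rightarrow> nat \<Rightarrow> int \<Rightarrow> bool" where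
  "koszul_exact Y N d j e \<longleftrightarrow> (\<forall>u. koszul_chain Y N d j e u \<and> bd Y u = (\<lambda>_ _. 0) \<longrightarrow>
     (\<exists>w. koszul_chain Y N d (Suc j) e w \<and> bd Y w = u))"

lemma monomial_cycle_is_boundary:
  fixes u :: "nat set \<Rightarrow> nat \<Rightarrow> 'a::field mpoly"
  assumes Y: "finite Y" and u: "koszul_chain Y (monomial_module L b) d j e u"
    and cyc: "bd Y u = (\<lambda>_ _. 0)"
    and ex: "\<And>r a S. r < b \<Longrightarrow> S \<subseteq> Y \<Longrightarrow> card S = j \<Longrightarrow> multi_part (\<lambda>S. u S r) a S \<noteq> 0 \<Longrightarrow>
      int (monomial_degree a) = e - d r \<Longrightarrow> kexact TYPE('a) Y (upper_koszul L Y a) j"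
  shows "\<exists>w. koszul_chain Y (monomial_module L b) d (Suc j) e w \<and> bd Y w = u"
proof -
  have uS: "S \<subseteq> Y \<and> card S = j \<and> u S \<in> monomial_module L b \<and> homv d (e - int j) (u S)"
    if "u S \<noteq> (\<lambda>_. 0)" for S
    using u that unfolding koszul_chain_def by meson
  have keysu: "S \<subseteq> Y \<and> card S = j \<and> r < b \<and> m \<in> L \<and> int (monomial_degree m) = e - int j - d r"
    if "m \<in> keys (u S r)" for m S r
  proof -
    have nz: "u S \<noteq> (\<lambda>_. 0)" "u S r \<noteq> 0" using that by auto
    from uS[OF nz(1)] have "r < b" using nz(2) by (auto simp: monomial_module_def not_less[symmetric])
    then show ?thesis using uS[OF nz(1)] that
      by (auto simp: monomial_module_def homv_def homogeneous_def algebra_simps)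
  qed
  have fin: "finite S" if "S \<subseteq> Y" for S using that Y finite_subset by blast
  have "\<exists>w. (\<forall>S. w S \<noteq> 0 \<longrightarrow> S \<subseteq> Y \<and> card S = Suc j) \<and> (\<forall>S. keys (w S) \<subseteq> L) \<and>
    (\<forall>S. kdiff var Y w S = u S r) \<and>
    (\<forall>S m. m \<in> keys (w S) \<longrightarrow> (\<exists>S' m'. m' \<in> keys (u S' r) \<and> m' + set_monomial S' = m + set_monomial S))" for r
  proof (rule koszul_cycle_is_boundary[OF Y])
    show "S \<subseteq> Y \<and> card S = j" if "u S r \<noteq> 0" for S
    proof -
      have "u S \<noteq> (\<lambda>_. 0)" using that by auto
      from uS[OF this] show ?thesis by blast
    qed
    show "keys (u S r) \<subseteq> L" for S using keysu by blast
    show "kdiff var Y (\<lambda>S. u S r) S = 0" for S using cyc unfolding bd_def by meson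
    fix a assume "\<exists>S. multi_part (\<lambda>S. u S r) a S \<noteq> 0"
    then obtain S where S: "multi_part (\<lambda>S. u S r) a S \<noteq> 0" by blast
    then have S': "S \<subseteq> keys a" "finite S" "a - set_monomial S \<in> keys (u S r)"
      by (auto simp: multi_part_def in_keys_iff split: if_splits)
    have "monomial_degree a = monomial_degree (a - set_monomial S) + card S"
      using mdeg_add[of "a - set_monomial S" "set_monomial S"] S' by (simp add: set_monomial_le mdeg_set_monomial)
    then show "kexact TYPE('a) Y (upper_koszul L Y a) j"
      using keysu[OF S'(3)] S by (intro ex[of r S]) auto
  qed
  then obtain w where w: "\<And>r S. w r S \<noteq> 0 \<Longrightarrow> S \<subseteq> Y \<and> card S = Suc j" "\<And>r S. keys (w r S) \<subseteq> L"
    "\<And>r S. kdiff var Y (w r) S = u S r"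
    "\<And>r S m. m \<in> keys (w r S) \<Longrightarrow> \<exists>S' m'. m' \<in> keys (u S' r) \<and> m' + set_monomial S' = m + set_monomial S"
    by metis
  have mw: "r < b \<and> int (monomial_degree m) = e - int (Suc j) - d r" if "m \<in> keys (w r S)" for r S m
  proof -
    from w(4)[OF that] obtain S' m' where S': "m' \<in> keys (u S' r)" "m' + set_monomial S' = m + set_monomial S" by blast
    have "w r S \<noteq> 0" using that by auto
    from w(1)[OF this] have "monomial_degree m + Suc j = monomial_degree m' + j"
      using mdeg_add[of m "set_monomial S"] mdeg_add[of m' "set_monomial S'"] keysu[OF S'(1)] S'(2) fin
      by (simp add: mdeg_set_monomial)
    then show ?thesis using keysu[OF S'(1)] by auto
  qed
  have "koszul_chain Y (monomial_module L b) d (Suc j) e (\<lambda>S r. w r S)"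
  proof -
    have "(\<lambda>r. w r S) \<in> monomial_module L b" for S
    proof -
      have "w r S = 0" if "\<not> r < b" for r using that mw[of _ r S] by (metis keys_eq_empty equals0I)
      then show ?thesis using w(2) by (auto simp: monomial_module_def)
    qed
    moreover have "homv d (e - int (Suc j)) (\<lambda>r. w r S)" for S
      using mw by (simp add: homv_def homogeneous_def)
    moreover have "(\<lambda>r. w r S) = (\<lambda>_. 0)" if "\<not> (S \<subseteq> Y \<and> card S = Suc j)" for S
      using w(1) that by blast
    ultimately show ?thesis unfolding koszul_chain_def by simp
  qed
  moreover have "bd Y (\<lambda>S r. w r S) = u"
    using w(3) by (intro ext) (simp add: bd_def)
  ultimately show ?thesis by blast
qed

lemma koszul_exact_monomial_module:
  assumes "finite Y" "\<And>r a. r < b \<Longrightarrow> int (monomial_degree a) = e - d r \<Longrightarrow>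
    kexact TYPE('a::field) Y (upper_koszul L Y a) j"
  shows "koszul_exact Y (monomial_module L b :: (nat \<Rightarrow> 'a mpoly) set) d j e"
  unfolding koszul_exact_def using monomial_cycle_is_boundary[OF assms(1)] assms(2) by blast

text \<open>The upper Koszul complex of the whole ring is a full simplex.\<close>

lemma koszul_exact_free:
  assumes "Y \<subseteq> {..<n}" "j \<ge> 1"
  shows "koszul_exact Y (monomial_module (monomials n) b :: (nat \<Rightarrow> 'a::field mpoly) set) d j e"
proof (rule koszul_exact_monomial_module)
  show Y: "finite Y" using assms finite_subset by blast
  fix a :: "nat \<Rightarrow>\<^sub>0 nat"
  show "kexact TYPE('a) Y (upper_koszul (monomials n) Y a) j"
  proof (cases "a \<in> monomials n")
    case True
    have "keys (a - set_monomial S) \<subseteq> keys a" for S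
      by (auto simp: in_keys_iff lookup_minus)
    then have "upper_koszul (monomials n) Y a = Pow (Y \<inter> keys a)"
      using True unfolding upper_koszul_def monomials_def by blast
    moreover obtain j' where "j = Suc j'" using assms by (cases j) auto
    ultimately show ?thesis using kexact_Pow_Suc[where 'k='a, OF Y, of "Y \<inter> keys a"] by (simp only: Int_lower1)
  next
    case False
    have "a \<in> monomials n" if "S \<subseteq> Y \<inter> keys a" "a - set_monomial S \<in> monomials n" for S
    proof -
      have "finite S" using that Y finite_subset by auto
      then have "keys a = keys (a - set_monomial S) \<union> S"
        using set_monomial_le[of S a] that keys_add_nat[of "a - set_monomial S" "set_monomial S"] by (simp add: keys_set_monomial)
      then show ?thesis using that assms(1) by (auto simp: monomials_def)
    qed
    then have "upper_koszul (monomials n) Y a = {}" using False by (auto simp: upper_koszul_def)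
    moreover have "kexact TYPE('a) Y {} j" by (rule kexact_no_faces) simp
    ultimately show ?thesis by simp
  qed
qed

text \<open>A polynomial without constant term is a combination of the variables; stated for chains, it is the
  counterpart of \<open>koszul_exact_free\<close> for \<open>j = 0\<close>.\<close>

lemma koszul_0_chain_is_boundary:
  fixes u :: "nat set \<Rightarrow> nat \<Rightarrow> 'a::field mpoly"
  assumes u: "koszul_chain {..<n} (monomial_module (monomials n) b) d 0 e u"
    and const: "\<And>r. lookup (u {} r) 0 = 0"
  shows "\<exists>w. koszul_chain {..<n} (monomial_module (monomials n) b) d (Suc 0) e w \<and> bd {..<n} w = u"
proof (rule monomial_cycle_is_boundary[OF _ u])
  have u0: "u S = (\<lambda>_. 0)" if "S \<noteq> {}" for S
  proof -
    have "\<not> (S \<subseteq> {..<n} \<and> card S = 0)" using that finite_subset[of S "{..<n}"] by auto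
    then show ?thesis using u by (simp add: koszul_chain_def)
  qed
  then show "bd {..<n} u = (\<lambda>_ _. 0)" by (intro ext) (simp add: bd_def kdiff_def)
  fix r a S assume S: "S \<subseteq> {..<n}" "card S = 0" "multi_part (\<lambda>S. u S r) a S \<noteq> 0" and r: "r < b"
  then have "S = {}" using finite_subset[OF S(1)] by simp
  then have l: "lookup (u {} r) a \<noteq> 0" using S(3) by (simp add: multi_part_def set_monomial_def)
  then have "a \<noteq> 0" using const[of r] by metis
  have "u {} \<in> monomial_module (monomials n) b" using u by (simp add: koszul_chain_def)
  then have "keys (u {} r) \<subseteq> monomials n" using r by (simp add: monomial_module_def)
  moreover have "a \<in> keys (u {} r)" using l by (simp add: in_keys_iff)
  ultimately have "a \<in> monomials n" by blast
  then have an: "keys a \<subseteq> {..<n}" by (simp add: monomials_def)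
  obtain v where v: "v \<in> keys a" using \<open>a \<noteq> 0\<close> by (metis keys_eq_empty all_not_in_conv)
  have "keys (a - set_monomial S) \<subseteq> keys a" for S
    by (auto simp: in_keys_iff lookup_minus)
  then have "upper_koszul (monomials n) {..<n} a = Pow (keys a)"
    using an unfolding upper_koszul_def monomials_def by blast
  then show "kexact TYPE('a) {..<n} (upper_koszul (monomials n) {..<n} a) 0"
    using an v by (intro kexact_cone[of _ _ v]) auto
qed simp

section \<open>Polynomials, homogeneous parts and linear maps\<close>

definition polys :: "nat \<Rightarrow> 'a::field mpoly set" where
  "polys n = {p. keys p \<subseteq> monomials n}"

lemma monomials_add: "a + b \<in> monomials n \<longleftrightarrow> a \<in> monomials n \<and> b \<in> monomials n"
  by (auto simp: monomials_def keys_add_nat)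

lemma polys_0: "0 \<in> polys n"
  and polys_1: "1 \<in> polys n"
  by (auto simp: polys_def monomials_def)

lemma polys_const: "Poly_Mapping.single 0 c \<in> polys n"
  by (auto simp: polys_def monomials_def)

lemma polys_var: "y < n \<Longrightarrow> var y \<in> polys n"
  by (auto simp: polys_def monomials_def var_def)

lemma polys_add: "p \<in> polys n \<Longrightarrow> q \<in> polys n \<Longrightarrow> p + q \<in> polys n"
  using Poly_Mapping.keys_add[of p q] by (auto simp: polys_def)

lemma polys_uminus: "p \<in> polys n \<Longrightarrow> - p \<in> polys n"
  by (simp add: polys_def)

lemma polys_mult: "p \<in> polys n \<Longrightarrow> q \<in> polys n \<Longrightarrow> p * q \<in> polys n"
  using Poly_Mapping.keys_mult[of p q] by (fastforce simp: polys_def monomials_add)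

lemma polys_sum: "(\<And>i. i \<in> I \<Longrightarrow> f i \<in> polys n) \<Longrightarrow> sum f I \<in> polys n"
  by (induction I rule: infinite_finite_induct) (auto simp: polys_0 polys_add)

lemma polys_ksign: "ksign y S \<in> polys n"
proof -
  have "(- 1) ^ c \<in> polys n" for c :: nat
    by (induction c) (auto simp: polys_1 polys_uminus)
  then show ?thesis by (simp add: ksign_def)
qed

lemma homogeneous_0: "homogeneous e 0"
  by (simp add: homogeneous_def)

lemma homogeneous_add: "homogeneous e p \<Longrightarrow> homogeneous e q \<Longrightarrow> homogeneous e (p + q)"
  using Poly_Mapping.keys_add[of p q] by (auto simp: homogeneous_def)

lemma homogeneous_uminus: "homogeneous e p \<Longrightarrow> homogeneous e (- p)"
  by (simp add: homogeneous_def)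

lemma homogeneous_diff: "homogeneous e p \<Longrightarrow> homogeneous e q \<Longrightarrow> homogeneous e (p - q)"
  using homogeneous_add[of e p "- q"] homogeneous_uminus[of e q] by simp

lemma homogeneous_mult: "homogeneous e p \<Longrightarrow> homogeneous e' q \<Longrightarrow> homogeneous (e + e') (p * q)"
  using Poly_Mapping.keys_mult[of p q] by (fastforce simp: homogeneous_def mdeg_add)

lemma homogeneous_sum: "(\<And>i. i \<in> I \<Longrightarrow> homogeneous e (f i)) \<Longrightarrow> homogeneous e (sum f I)"
  by (induction I rule: infinite_finite_induct) (auto simp: homogeneous_0 homogeneous_add)

lemma homogeneous_const: "homogeneous 0 (Poly_Mapping.single 0 c)"
  by (auto simp: homogeneous_def monomial_degree_def)

lemma homogeneous_ksign: "homogeneous 0 (ksign y S)"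
proof -
  have "homogeneous 0 ((- 1) ^ c)" for c :: nat
    by (induction c) (auto simp: homogeneous_uminus homogeneous_def monomial_degree_def)
  then show ?thesis by (simp add: ksign_def)
qed

lemma homogeneous_var: "homogeneous 1 (var y)"
  by (auto simp: homogeneous_def monomial_degree_def var_def)

lemma homogeneous_negative: "homogeneous e p \<Longrightarrow> e < 0 \<Longrightarrow> p = 0"
  by (metis all_not_in_conv homogeneous_def keys_eq_empty not_less of_nat_0_le_iff)

definition hpart :: "int \<Rightarrow> 'a::field mpoly \<Rightarrow> 'a mpoly" where
  "hpart e p = Poly_Mapping.mapp (\<lambda>m c. if int (monomial_degree m) = e then c else 0) p"

lemma lookup_hpart: "lookup (hpart e p) m = (if int (monomial_degree m) = e then lookup p m else 0)"
  by (simp add: hpart_def lookup_mapp in_keys_iff when_def)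

lemma hpart_homogeneous: "homogeneous e (hpart e p)"
  by (auto simp: homogeneous_def in_keys_iff lookup_hpart split: if_splits)

lemma hpart_polys: "p \<in> polys n \<Longrightarrow> hpart e p \<in> polys n"
  by (auto simp: polys_def in_keys_iff lookup_hpart split: if_splits)

lemma hpart_0: "hpart e 0 = 0"
  by (rule poly_mapping_eqI) (simp add: lookup_hpart)

lemma hpart_add: "hpart e (p + q) = hpart e p + hpart e q"
  by (rule poly_mapping_eqI) (simp add: lookup_hpart lookup_add)

lemma hpart_sum: "hpart e (sum f I) = (\<Sum>i \<in> I. hpart e (f i))"
  by (induction I rule: infinite_finite_induct) (auto simp: hpart_0 hpart_add)

lemma hpart_same: "homogeneous e p \<Longrightarrow> hpart e p = p"
  by (rule poly_mapping_eqI) (auto simp: lookup_hpart homogeneous_def in_keys_iff)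

lemma hpart_mult:
  assumes "homogeneous e p"
  shows "hpart (e + e') (p * q) = p * hpart e' q"
proof -
  have "hpart (e + e') (p * (q - hpart e' q)) = 0"
  proof (rule poly_mapping_eqI)
    fix m
    have "int (monomial_degree m) \<noteq> e + e'" if m: "m \<in> keys (p * (q - hpart e' q))"
    proof -
      obtain a c where "m = a + c" "a \<in> keys p" "c \<in> keys (q - hpart e' q)"
        using m Poly_Mapping.keys_mult[of p "q - hpart e' q"] by blast
      moreover from this have "int (monomial_degree a) = e" using assms by (simp add: homogeneous_def)
      moreover have "int (monomial_degree c) \<noteq> e'"
        using \<open>c \<in> _\<close> by (auto simp: in_keys_iff lookup_minus lookup_hpart split: if_splits)
      ultimately show ?thesis by (simp add: mdeg_add)
    qed
    then show "lookup (hpart (e + e') (p * (q - hpart e' q))) m = lookup 0 m"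
      by (auto simp: lookup_hpart in_keys_iff)
  qed
  then have "hpart (e + e') (p * q) = hpart (e + e') (p * hpart e' q)"
    using hpart_add[of "e + e'" "p * hpart e' q" "p * (q - hpart e' q)"]
    by (simp add: algebra_simps)
  also have "\<dots> = p * hpart e' q"
    by (intro hpart_same homogeneous_mult assms hpart_homogeneous)
  finally show ?thesis .
qed

abbreviation free :: "nat \<Rightarrow> nat \<Rightarrow> (nat \<Rightarrow> 'a::field mpoly) set" where
  "free n b \<equiv> monomial_module (monomials n) b"

lemma free_iff: "f \<in> free n b \<longleftrightarrow> (\<forall>r. f r \<in> polys n) \<and> (\<forall>r\<ge>b. f r = 0)"
proof -
  have "keys (f r) \<subseteq> monomials n" if "\<forall>r\<ge>b. f r = 0" "\<forall>r<b. keys (f r) \<subseteq> monomials n" for r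
    using that by (cases "r < b") auto
  then show ?thesis unfolding monomial_module_def polys_def by blast
qed

definition vpart :: "(nat \<Rightarrow> int) \<Rightarrow> int \<Rightarrow> (nat \<Rightarrow> 'a::field mpoly) \<Rightarrow> nat \<Rightarrow> 'a mpoly" where
  "vpart d e f r = hpart (e - d r) (f r)"

lemma vpart_homv: "homv d e (vpart d e f)"
  by (simp add: homv_def vpart_def hpart_homogeneous)

lemma vpart_free: "f \<in> free n b \<Longrightarrow> vpart d e f \<in> free n b"
  by (simp add: free_iff vpart_def hpart_polys hpart_0)

lemma vpart_same: "homv d e f \<Longrightarrow> vpart d e f = f"
  by (intro ext) (simp add: homv_def vpart_def hpart_same)

lemma sum_vpart:
  assumes "f \<in> free n b"
  shows "\<exists>E. finite E \<and> f = (\<lambda>r. \<Sum>e \<in> E. vpart d e f r)"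
proof -
  define E where "E = (\<Union>r<b. (\<lambda>m. int (monomial_degree m) + d r) ` keys (f r))"
  have "finite E" by (simp add: E_def)
  moreover have "f r = (\<Sum>e \<in> E. vpart d e f r)" for r
  proof (rule poly_mapping_eqI)
    fix m
    let ?e = "int (monomial_degree m) + d r"
    have "lookup (\<Sum>e \<in> E. vpart d e f r) m = (\<Sum>e \<in> E. if e = ?e then lookup (f r) m else 0)"
      unfolding lookup_sum by (intro sum.cong refl) (auto simp: vpart_def lookup_hpart)
    also have "\<dots> = (if ?e \<in> E then lookup (f r) m else 0)"
      using \<open>finite E\<close> by simp
    also have "\<dots> = lookup (f r) m"
    proof (cases "m \<in> keys (f r)")
      case True
      then have "r < b" using assms by (metis free_iff keys_zero empty_iff not_less)
      then have "?e \<in> E" using True by (auto simp: E_def)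
      then show ?thesis by simp
    qed (simp add: in_keys_iff)
    finally show "lookup (f r) m = lookup (\<Sum>e \<in> E. vpart d e f r) m" by simp
  qed
  ultimately show ?thesis by blast
qed

definition submodule_of :: "nat \<Rightarrow> (nat \<Rightarrow> 'a::field mpoly) set \<Rightarrow> bool" where
  "submodule_of n N \<longleftrightarrow> (\<lambda>_. 0) \<in> N \<and> (\<forall>f \<in> N. \<forall>g \<in> N. (\<lambda>r. f r + g r) \<in> N) \<and>
    (\<forall>p \<in> polys n. \<forall>f \<in> N. (\<lambda>r. p * f r) \<in> N)"

lemma submodule_0: "submodule_of n N \<Longrightarrow> (\<lambda>_. 0) \<in> N"
  and submodule_add: "submodule_of n N \<Longrightarrow> f \<in> N \<Longrightarrow> g \<in> N \<Longrightarrow> (\<lambda>r. f r + g r) \<in> N"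
  and submodule_smult: "submodule_of n N \<Longrightarrow> p \<in> polys n \<Longrightarrow> f \<in> N \<Longrightarrow> (\<lambda>r. p * f r) \<in> N"
  by (simp_all add: submodule_of_def)

lemma submodule_sum:
  assumes "submodule_of n N" "\<And>i. i \<in> I \<Longrightarrow> p i \<in> polys n" "\<And>i. i \<in> I \<Longrightarrow> f i \<in> N"
  shows "(\<lambda>r. \<Sum>i \<in> I. p i * f i r) \<in> N"
  using assms(2,3)
proof (induction I rule: infinite_finite_induct)
  case (insert i I)
  then have "(\<lambda>r. \<Sum>i \<in> I. p i * f i r) \<in> N" "(\<lambda>r. p i * f i r) \<in> N"
    using assms(1) by (auto simp: submodule_of_def)
  then show ?case using assms(1) insert.hyps by (simp add: submodule_of_def)
qed (use assms(1) in \<open>auto simp: submodule_of_def\<close>)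

lemma submodule_sum':
  assumes "submodule_of n N" "\<And>i. i \<in> I \<Longrightarrow> f i \<in> N"
  shows "(\<lambda>r. \<Sum>i \<in> I. f i r) \<in> N"
  using submodule_sum[OF assms(1), of I "\<lambda>_. 1" f] assms(2) by (simp add: polys_1)

lemma submodule_diff:
  assumes "submodule_of n N" "f \<in> N" "g \<in> N"
  shows "(\<lambda>r. f r - g r) \<in> N"
proof -
  have "(\<lambda>r. - 1 * g r) \<in> N"
    by (rule submodule_smult[OF assms(1) polys_uminus[OF polys_1] assms(3)])
  from submodule_add[OF assms(1,2) this] show ?thesis by simp
qed

lemma submodule_free: "submodule_of n (free n b)"
  by (auto simp: submodule_of_def free_iff polys_0 polys_add polys_mult)

definition graded_submodule :: "nat \<Rightarrow> nat \<Rightarrow> (nat \<Rightarrow> int) \<Rightarrow> (nat \<Rightarrow> 'a::field mpoly) set \<Rightarrow> bool" where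
  "graded_submodule n b d N \<longleftrightarrow> submodule_of n N \<and> N \<subseteq> free n b \<and> (\<forall>f \<in> N. \<forall>e. vpart d e f \<in> N)"

text \<open>As for the dimensions of a matrix, the target \<open>(b, d)\<close> comes before the source \<open>(b', d')\<close>.\<close>

definition graded_matrix :: "nat \<Rightarrow> nat \<Rightarrow> (nat \<Rightarrow> int) \<Rightarrow> nat \<Rightarrow> (nat \<Rightarrow> int) \<Rightarrow>
    (nat \<Rightarrow> nat \<Rightarrow> 'a::field mpoly) \<Rightarrow> bool" where
  "graded_matrix n b d b' d' A \<longleftrightarrow> (\<forall>r c. A r c \<in> polys n \<and> homogeneous (d' c - d r) (A r c) \<and>
    (b \<le> r \<or> b' \<le> c \<longrightarrow> A r c = 0))"

definition mat_apply :: "nat \<Rightarrow> (nat \<Rightarrow> nat \<Rightarrow> 'a::field mpoly) \<Rightarrow> (nat \<Rightarrow> 'a mpoly) \<Rightarrow> nat \<Rightarrow> 'a mpoly" where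
  "mat_apply b' A v r = (\<Sum>c<b'. A r c * v c)"

definition image_of :: "nat \<Rightarrow> nat \<Rightarrow> (nat \<Rightarrow> nat \<Rightarrow> 'a::field mpoly) \<Rightarrow> (nat \<Rightarrow> 'a mpoly) set" where
  "image_of n b' A = mat_apply b' A ` free n b'"

definition kernel_of :: "nat \<Rightarrow> nat \<Rightarrow> (nat \<Rightarrow> nat \<Rightarrow> 'a::field mpoly) \<Rightarrow> (nat \<Rightarrow> 'a mpoly) set" where
  "kernel_of n b' A = {v \<in> free n b'. mat_apply b' A v = (\<lambda>_. 0)}"

lemma mat_apply_0: "mat_apply b' A (\<lambda>_. 0) = (\<lambda>_. 0)"
  by (intro ext) (simp add: mat_apply_def)

lemma mat_apply_add: "mat_apply b' A (\<lambda>r. v r + w r) = (\<lambda>r. mat_apply b' A v r + mat_apply b' A w r)"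
  by (intro ext) (simp add: mat_apply_def distrib_left sum.distrib)

lemma mat_apply_diff: "mat_apply b' A (\<lambda>r. v r - w r) = (\<lambda>r. mat_apply b' A v r - mat_apply b' A w r)"
  by (intro ext) (simp add: mat_apply_def right_diff_distrib sum_subtractf)

lemma mat_apply_smult: "mat_apply b' A (\<lambda>r. p * v r) = (\<lambda>r. p * mat_apply b' A v r)"
  by (intro ext) (simp add: mat_apply_def sum_distrib_left mult_ac)

lemma mat_apply_free: "graded_matrix n b d b' d' A \<Longrightarrow> v \<in> free n b' \<Longrightarrow> mat_apply b' A v \<in> free n b"
  by (auto simp: graded_matrix_def free_iff mat_apply_def intro!: polys_sum polys_mult sum.neutral)

lemma mat_apply_homv:
  assumes "graded_matrix n b d b' d' A" "homv d' e v"
  shows "homv d e (mat_apply b' A v)"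
  unfolding homv_def mat_apply_def
proof (intro allI homogeneous_sum)
  fix r c
  show "homogeneous (e - d r) (A r c * v c)"
    using homogeneous_mult[of "d' c - d r" "A r c" "e - d' c" "v c"] assms
    by (simp add: graded_matrix_def homv_def)
qed

lemma mat_apply_vpart:
  assumes "graded_matrix n b d b' d' A"
  shows "mat_apply b' A (vpart d' e v) = vpart d e (mat_apply b' A v)"
proof
  fix r
  have "hpart (e - d r) (A r c * v c) = A r c * hpart (e - d' c) (v c)" for c
    using hpart_mult[of "d' c - d r" "A r c" "e - d' c" "v c"] assms by (simp add: graded_matrix_def)
  then show "mat_apply b' A (vpart d' e v) r = vpart d e (mat_apply b' A v) r"
    by (simp add: mat_apply_def vpart_def hpart_sum)
qed

lemma mat_apply_bd: "bd Y (\<lambda>S. mat_apply b' A (u S)) S = mat_apply b' A (bd Y u S)"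
proof
  fix r
  have "bd Y (\<lambda>S. mat_apply b' A (u S)) S r
      = (\<Sum>y \<in> Y - S. \<Sum>c<b'. A r c * (ksign y S * var y * u (insert y S) c))"
    unfolding bd_def kdiff_def mat_apply_def sum_distrib_left by (intro sum.cong refl) (simp add: mult_ac)
  also have "\<dots> = (\<Sum>c<b'. \<Sum>y \<in> Y - S. A r c * (ksign y S * var y * u (insert y S) c))"
    by (rule sum.swap)
  also have "\<dots> = mat_apply b' A (bd Y u S) r"
    by (simp add: bd_def kdiff_def mat_apply_def sum_distrib_left)
  finally show "bd Y (\<lambda>S. mat_apply b' A (u S)) S r = mat_apply b' A (bd Y u S) r" .
qed

lemma graded_submodule_image:
  assumes A: "graded_matrix n b d b' d' A"
  shows "graded_submodule n b d (image_of n b' A)"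
proof -
  have sm: "submodule_of n (free n b' :: (nat \<Rightarrow> 'a mpoly) set)" by (rule submodule_free)
  show ?thesis
    unfolding graded_submodule_def submodule_of_def image_of_def
  proof (intro conjI ballI allI)
    show "(\<lambda>_. 0) \<in> mat_apply b' A ` free n b'"
      using submodule_0[OF sm] by (intro image_eqI[of _ _ "\<lambda>_. 0"]) (simp_all add: mat_apply_0)
    show "mat_apply b' A ` free n b' \<subseteq> free n b" using mat_apply_free[OF A] by blast
    fix f assume "f \<in> mat_apply b' A ` free n b'"
    then obtain v where v: "v \<in> free n b'" "f = mat_apply b' A v" by blast
    show "vpart d e f \<in> mat_apply b' A ` free n b'" for e
      unfolding v(2) mat_apply_vpart[OF A, symmetric] by (rule imageI[OF vpart_free[OF v(1)]])
    show "(\<lambda>r. p * f r) \<in> mat_apply b' A ` free n b'" if "p \<in> polys n" for p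
      unfolding v(2) mat_apply_smult[symmetric] by (rule imageI[OF submodule_smult[OF sm that v(1)]])
    fix g assume "g \<in> mat_apply b' A ` free n b'"
    then obtain w where w: "w \<in> free n b'" "g = mat_apply b' A w" by blast
    show "(\<lambda>r. f r + g r) \<in> mat_apply b' A ` free n b'"
      unfolding v(2) w(2) mat_apply_add[symmetric] by (rule imageI[OF submodule_add[OF sm v(1) w(1)]])
  qed
qed

lemma graded_submodule_kernel:
  assumes A: "graded_matrix n b d b' d' A"
  shows "graded_submodule n b' d' (kernel_of n b' A)"
proof -
  have sm: "submodule_of n (free n b' :: (nat \<Rightarrow> 'a mpoly) set)" by (rule submodule_free)
  show ?thesis
    unfolding graded_submodule_def
  proof (intro conjI ballI allI)
    show "submodule_of n (kernel_of n b' A)"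
      using sm unfolding submodule_of_def kernel_of_def by (simp add: mat_apply_0 mat_apply_add mat_apply_smult)
    show "kernel_of n b' A \<subseteq> free n b'" by (auto simp: kernel_of_def)
    show "vpart d' e f \<in> kernel_of n b' A" if "f \<in> kernel_of n b' A" for f e
    proof -
      have "mat_apply b' A (vpart d' e f) = vpart d e (\<lambda>_. 0)"
        using that unfolding mat_apply_vpart[OF A] by (simp add: kernel_of_def)
      also have "\<dots> = (\<lambda>_. 0)" by (intro ext) (simp add: vpart_def hpart_0)
      finally show ?thesis using that vpart_free[of f n b'] by (simp add: kernel_of_def)
    qed
  qed
qed

section \<open>Dimension shifting\<close>

lemma koszul_chain_mono:
  "koszul_chain Y N d j e u \<Longrightarrow> N \<subseteq> M \<Longrightarrow> koszul_chain Y M d j e u"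
  unfolding koszul_chain_def by (meson subsetD)

lemma koszul_chain_outside:
  "koszul_chain Y N d j e u \<Longrightarrow> \<not> (S \<subseteq> Y \<and> card S = j) \<Longrightarrow> u S = (\<lambda>_. 0)"
  unfolding koszul_chain_def by meson

lemma koszul_chain_in:
  "koszul_chain Y N d j e u \<Longrightarrow> S \<subseteq> Y \<Longrightarrow> card S = j \<Longrightarrow> u S \<in> N \<and> homv d (e - int j) (u S)"
  unfolding koszul_chain_def by (drule spec[of _ S]) simp

lemma koszul_chainI:
  assumes "\<And>S. S \<subseteq> Y \<Longrightarrow> card S = j \<Longrightarrow> u S \<in> N \<and> homv d (e - int j) (u S)"
    "\<And>S. \<not> (S \<subseteq> Y \<and> card S = j) \<Longrightarrow> u S = (\<lambda>_. 0)"
  shows "koszul_chain Y N d j e u"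
  unfolding koszul_chain_def using assms by simp

lemma koszul_exactE:
  assumes "koszul_exact Y N d j e" "koszul_chain Y N d j e u" "bd Y u = (\<lambda>_ _. 0)"
  obtains w where "koszul_chain Y N d (Suc j) e w" "bd Y w = u"
  using assms unfolding koszul_exact_def by blast

lemma bd_diff: "bd Y (\<lambda>S r. u S r - w S r) = (\<lambda>S r. bd Y u S r - bd Y w S r)"
  by (intro ext) (simp add: bd_def kdiff_diff)

lemma homv_diff: "homv d e f \<Longrightarrow> homv d e g \<Longrightarrow> homv d e (\<lambda>r. f r - g r)"
  by (simp add: homv_def homogeneous_diff)

lemma homv_0: "homv d e (\<lambda>_. 0)"
  by (simp add: homv_def homogeneous_0)

lemma koszul_chain_diff:
  assumes "submodule_of n N" "koszul_chain Y N d j e u" "koszul_chain Y N d j e w"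
  shows "koszul_chain Y N d j e (\<lambda>S r. u S r - w S r)"
proof (rule koszul_chainI)
  fix S
  show "(\<lambda>r. u S r - w S r) \<in> N \<and> homv d (e - int j) (\<lambda>r. u S r - w S r)"
    if "S \<subseteq> Y" "card S = j"
    using koszul_chain_in[OF assms(2) that] koszul_chain_in[OF assms(3) that]
    by (intro conjI submodule_diff[OF assms(1)] homv_diff) auto
  show "(\<lambda>r. u S r - w S r) = (\<lambda>_. 0)" if "\<not> (S \<subseteq> Y \<and> card S = j)"
    using koszul_chain_outside[OF assms(2) that] koszul_chain_outside[OF assms(3) that] by simp
qed

lemma bd_outside:
  assumes "koszul_chain Y N d j e u" "\<not> S \<subseteq> Y"
  shows "bd Y u S = (\<lambda>_. 0)"
proof
  fix r
  show "bd Y u S r = 0"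
    unfolding bd_def
    by (rule kdiff_outside) (use koszul_chain_outside[OF assms(1)] assms(2) in \<open>auto, metis subsetD\<close>)
qed

lemma bd_bd:
  assumes "finite Y" "koszul_chain Y N d j e u"
  shows "bd Y (bd Y u) = (\<lambda>_ _. 0)"
proof (intro ext)
  fix S r
  show "bd Y (bd Y u) S r = 0"
  proof (cases "S \<subseteq> Y")
    case True
    then have "finite S" using assms finite_subset by blast
    then show ?thesis using kdiff_kdiff[OF assms(1), of S var "\<lambda>S. u S r"] by (simp add: bd_def)
  next
    case False
    have "bd Y u (insert y S) = (\<lambda>_. 0)" for y
      using False by (intro bd_outside[OF assms(2)]) auto
    then show ?thesis by (simp add: bd_def[of Y "bd Y u"] kdiff_def)
  qed
qed

lemma koszul_chain_bd:
  assumes "submodule_of n N" "Y \<subseteq> {..<n}" "koszul_chain Y N d (Suc j) e u"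
  shows "koszul_chain Y N d j e (bd Y u)"
proof (rule koszul_chainI)
  have finY: "finite Y" using assms finite_subset by blast
  fix S
  {
    assume S: "S \<subseteq> Y" "card S = j"
    have fin: "finite S" using S finY finite_subset by blast
    have in_N: "u (insert y S) \<in> N \<and> homv d (e - int (Suc j)) (u (insert y S))" if "y \<in> Y - S" for y
      using that S fin by (intro koszul_chain_in[OF assms(3)]) auto
    have eq: "bd Y u S = (\<lambda>r. \<Sum>y \<in> Y - S. (ksign y S * var y) * u (insert y S) r)"
      by (intro ext) (simp add: bd_def kdiff_def)
    have "bd Y u S \<in> N"
      unfolding eq by (rule submodule_sum[OF assms(1)])
        (use in_N assms(2) in \<open>auto intro!: polys_mult polys_ksign polys_var\<close>)
    moreover have "homv d (e - int j) (bd Y u S)"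
      unfolding homv_def eq
    proof (intro allI homogeneous_sum)
      fix r y assume "y \<in> Y - S"
      then have "homogeneous (e - int (Suc j) - d r) (u (insert y S) r)"
        using in_N unfolding homv_def by blast
      from homogeneous_mult[OF homogeneous_mult[OF homogeneous_ksign[of y S] homogeneous_var[of y]] this]
      show "homogeneous (e - int j - d r) (ksign y S * var y * u (insert y S) r)"
        by (simp add: algebra_simps)
    qed
    ultimately show "bd Y u S \<in> N \<and> homv d (e - int j) (bd Y u S)" by blast
  next
    assume out: "\<not> (S \<subseteq> Y \<and> card S = j)"
    show "bd Y u S = (\<lambda>_. 0)"
    proof (cases "S \<subseteq> Y")
      case True
      then have "finite S" using finY finite_subset by blast
      then have "u (insert y S) = (\<lambda>_. 0)" if "y \<in> Y - S" for y
        using that out True by (intro koszul_chain_outside[OF assms(3)]) auto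
      then show ?thesis by (intro ext) (simp add: bd_def kdiff_def)
    qed (rule bd_outside[OF assms(3)])
  }
qed

lemma koszul_chain_mat_apply:
  assumes "graded_matrix n b d b' d' A" "koszul_chain Y (free n b') d' j e u"
  shows "koszul_chain Y (image_of n b' A) d j e (\<lambda>S. mat_apply b' A (u S))"
  by (rule koszul_chainI)
    (use koszul_chain_in[OF assms(2)] koszul_chain_outside[OF assms(2)] mat_apply_homv[OF assms(1)]
      in \<open>auto simp: image_of_def mat_apply_0\<close>)

text \<open>Homogeneous elements of the image have homogeneous preimages.\<close>

lemma koszul_chain_lift:
  assumes A: "graded_matrix n b d b' d' A" and u: "koszul_chain Y (image_of n b' A) d j e u"
  obtains v where "koszul_chain Y (free n b') d' j e v" "(\<lambda>S. mat_apply b' A (v S)) = u"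
proof -
  have "\<exists>v. if S \<subseteq> Y \<and> card S = j then v \<in> free n b' \<and> homv d' (e - int j) v \<and> mat_apply b' A v = u S
      else v = (\<lambda>_. 0)" for S
  proof (cases "S \<subseteq> Y \<and> card S = j")
    case True
    then have S: "u S \<in> image_of n b' A" "homv d (e - int j) (u S)"
      using koszul_chain_in[OF u] by auto
    then obtain v where v: "v \<in> free n b'" "u S = mat_apply b' A v" by (auto simp: image_of_def)
    have "mat_apply b' A (vpart d' (e - int j) v) = u S"
      unfolding mat_apply_vpart[OF A] v(2)[symmetric] by (rule vpart_same[OF S(2)])
    then show ?thesis
      using True vpart_free[OF v(1)] vpart_homv by (intro exI[of _ "vpart d' (e - int j) v"]) simp
  qed auto
  then obtain v where v: "\<And>S. if S \<subseteq> Y \<and> card S = j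
      then v S \<in> free n b' \<and> homv d' (e - int j) (v S) \<and> mat_apply b' A (v S) = u S else v S = (\<lambda>_. 0)"
    by metis
  have "koszul_chain Y (free n b') d' j e v"
    unfolding koszul_chain_def using v by meson
  moreover have "mat_apply b' A (v S) = u S" for S
    using v[of S] koszul_chain_outside[OF u, of S] by (auto simp: mat_apply_0 split: if_splits)
  ultimately show thesis using that by blast
qed

lemma koszul_chain_kernel:
  assumes "koszul_chain Y (free n b') d' j e q" "\<And>S. mat_apply b' A (q S) = (\<lambda>_. 0)"
  shows "koszul_chain Y (kernel_of n b' A) d' j e q"
  using assms unfolding koszul_chain_def kernel_of_def by simp

text \<open>For the exact sequence of the kernel, the free module and the image of a graded map, the
  Koszul homology of the free module vanishes in positive homological degree, so the connecting map is
  onto there. In degree \<open>0\<close> this uses that the kernel lies in the irrelevant ideal times the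
  free module.\<close>

lemma koszul_exact_kernel:
  fixes A :: "nat \<Rightarrow> nat \<Rightarrow> 'a::field mpoly"
  assumes A: "graded_matrix n b d b' d' A"
    and ex: "koszul_exact {..<n} (image_of n b' A) d (Suc j) e"
    and min: "\<And>v r. v \<in> kernel_of n b' A \<Longrightarrow> lookup (v r) 0 = 0"
  shows "koszul_exact {..<n} (kernel_of n b' A) d' j e"
  unfolding koszul_exact_def
proof (intro allI impI, elim conjE)
  let ?Y = "{..<n}"
  fix z :: "nat set \<Rightarrow> nat \<Rightarrow> 'a mpoly"
  assume z: "koszul_chain ?Y (kernel_of n b' A) d' j e z" and cyc: "bd ?Y z = (\<lambda>_ _. 0)"
  have z_free: "koszul_chain ?Y (free n b') d' j e z"
    by (rule koszul_chain_mono[OF z]) (auto simp: kernel_of_def)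
  have Az: "mat_apply b' A (z S) = (\<lambda>_. 0)" for S
    using koszul_chain_in[OF z, of S] koszul_chain_outside[OF z, of S] mat_apply_0[of b' A]
    by (cases "S \<subseteq> ?Y \<and> card S = j") (auto simp: kernel_of_def)
  obtain v where v: "koszul_chain ?Y (free n b') d' (Suc j) e v" "bd ?Y v = z"
  proof (cases "j = 0")
    case True
    have "lookup (z {} r) 0 = 0" for r
      using koszul_chain_in[OF z, of "{}"] min True by simp
    with koszul_0_chain_is_boundary[of n b' d' e z] z_free True that show thesis by auto
  next
    case False
    then show thesis
      using koszul_exactE[OF koszul_exact_free z_free cyc] that by auto
  qed
  have "bd ?Y (\<lambda>S. mat_apply b' A (v S)) = (\<lambda>_ _. 0)"
    by (intro ext) (simp add: mat_apply_bd v Az)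
  from koszul_exactE[OF ex koszul_chain_mat_apply[OF A v(1)] this] obtain w where
    w: "koszul_chain ?Y (image_of n b' A) d (Suc (Suc j)) e w" "bd ?Y w = (\<lambda>S. mat_apply b' A (v S))"
    by blast
  from koszul_chain_lift[OF A w(1)] obtain w' where
    w': "koszul_chain ?Y (free n b') d' (Suc (Suc j)) e w'" "(\<lambda>S. mat_apply b' A (w' S)) = w" by blast
  let ?q = "\<lambda>S r. v S r - bd ?Y w' S r"
  have q: "koszul_chain ?Y (free n b') d' (Suc j) e ?q"
    by (intro koszul_chain_diff[OF submodule_free] v koszul_chain_bd[OF submodule_free _ w'(1)]) simp
  have "mat_apply b' A (?q S) = (\<lambda>_. 0)" for S
    using fun_cong[OF w(2), of S] unfolding mat_apply_diff mat_apply_bd[symmetric] w'(2) by simp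
  then have "koszul_chain ?Y (kernel_of n b' A) d' (Suc j) e ?q"
    using q by (intro koszul_chain_kernel)
  moreover have "bd ?Y ?q = z"
    unfolding bd_diff v(2) using bd_bd[OF _ w'(1)] by simp
  ultimately show "\<exists>w. koszul_chain ?Y (kernel_of n b' A) d' (Suc j) e w \<and> bd ?Y w = z" by blast
qed

text \<open>The converse direction of the shift, where injectivity of the connecting map suffices.\<close>

lemma koszul_exact_image:
  fixes A :: "nat \<Rightarrow> nat \<Rightarrow> 'a::field mpoly"
  assumes A: "graded_matrix n b d b' d' A" and Y: "Y \<subseteq> {..<n}"
    and ex: "koszul_exact Y (kernel_of n b' A) d' j e"
  shows "koszul_exact Y (image_of n b' A) d (Suc j) e"
  unfolding koszul_exact_def
proof (intro allI impI, elim conjE)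
  have finY: "finite Y" using Y finite_subset by blast
  fix z :: "nat set \<Rightarrow> nat \<Rightarrow> 'a mpoly"
  assume z: "koszul_chain Y (image_of n b' A) d (Suc j) e z" and cyc: "bd Y z = (\<lambda>_ _. 0)"
  from koszul_chain_lift[OF A z] obtain v where
    v: "koszul_chain Y (free n b') d' (Suc j) e v" "(\<lambda>S. mat_apply b' A (v S)) = z" by blast
  have "mat_apply b' A (bd Y v S) = (\<lambda>_. 0)" for S
    unfolding mat_apply_bd[symmetric] v(2) using cyc by simp
  then have "koszul_chain Y (kernel_of n b' A) d' j e (bd Y v)"
    by (intro koszul_chain_kernel koszul_chain_bd[OF submodule_free Y v(1)])
  from koszul_exactE[OF ex this bd_bd[OF finY v(1)]] obtain w where
    w: "koszul_chain Y (kernel_of n b' A) d' (Suc j) e w" "bd Y w = bd Y v" by blast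
  let ?q = "\<lambda>S r. v S r - w S r"
  have w_free: "koszul_chain Y (free n b') d' (Suc j) e w"
    by (rule koszul_chain_mono[OF w(1)]) (auto simp: kernel_of_def)
  have Aw: "mat_apply b' A (w S) = (\<lambda>_. 0)" for S
    using koszul_chain_in[OF w(1), of S] koszul_chain_outside[OF w(1), of S] mat_apply_0[of b' A]
    by (cases "S \<subseteq> Y \<and> card S = Suc j") (auto simp: kernel_of_def)
  have q: "koszul_chain Y (free n b') d' (Suc j) e ?q"
    by (intro koszul_chain_diff[OF submodule_free] v w_free)
  have "bd Y ?q = (\<lambda>_ _. 0)" unfolding bd_diff w(2) by simp
  from koszul_exactE[OF koszul_exact_free[OF Y] q this] obtain x where
    x: "koszul_chain Y (free n b') d' (Suc (Suc j)) e x" "bd Y x = ?q" by auto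
  have "bd Y (\<lambda>S. mat_apply b' A (x S)) = z"
  proof
    fix S
    have "bd Y (\<lambda>S. mat_apply b' A (x S)) S = mat_apply b' A (?q S)" by (simp add: mat_apply_bd x(2))
    also have "\<dots> = z S" unfolding mat_apply_diff using fun_cong[OF v(2), of S] by (simp add: Aw)
    finally show "bd Y (\<lambda>S. mat_apply b' A (x S)) S = z S" .
  qed
  then show "\<exists>w. koszul_chain Y (image_of n b' A) d (Suc (Suc j)) e w \<and> bd Y w = z"
    using koszul_chain_mat_apply[OF A x(1)] by blast
qed

section \<open>Generators of graded modules\<close>

lemma in_submodule_if_parts:
  assumes "submodule_of n M" "f \<in> free n b" "\<And>e. vpart d e f \<in> M"
  shows "f \<in> M"
proof -
  obtain E where "f = (\<lambda>r. \<Sum>e \<in> E. vpart d e f r)" using sum_vpart[OF assms(2)] by blast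
  moreover have "(\<lambda>r. \<Sum>e \<in> E. vpart d e f r) \<in> M"
    using assms(1,3) by (rule submodule_sum')
  ultimately show ?thesis by metis
qed

text \<open>Vanishing of the Koszul homology in homological degree \<open>0\<close> says that every element is a
  combination of elements of smaller degree with the variables as coefficients.\<close>

lemma generated_in_low_degrees:
  fixes N :: "(nat \<Rightarrow> 'a::field mpoly) set"
  assumes N: "graded_submodule n b d N"
    and ex: "\<And>e. B < e \<Longrightarrow> koszul_exact {..<n} N d 0 e"
    and M: "submodule_of n M" and low: "\<And>f e. f \<in> N \<Longrightarrow> homv d e f \<Longrightarrow> e \<le> B \<Longrightarrow> f \<in> M"
  shows "N \<subseteq> M"
proof -
  have hom: "f \<in> M" if "f \<in> N" "homv d e f" for f e
    using that
  proof (induction "nat (e - B)" arbitrary: f e rule: less_induct)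
    case less
    show ?case
    proof (cases "e \<le> B")
      case True
      then show ?thesis using low less.prems by blast
    next
      case False
      define u where "u S = (if S = {} then f else (\<lambda>_. 0))" for S :: "nat set"
      have "S = {} \<longleftrightarrow> S \<subseteq> {..<n} \<and> card S = 0" for S :: "nat set"
        using finite_subset[of S "{..<n}"] by auto
      then have u: "koszul_chain {..<n} N d 0 e u"
        using less.prems by (simp add: koszul_chain_def u_def)
      have "bd {..<n} u = (\<lambda>_ _. 0)"
        by (intro ext) (simp add: bd_def kdiff_def u_def)
      from koszul_exactE[OF ex u this] False obtain w where
        w: "koszul_chain {..<n} N d (Suc 0) e w" "bd {..<n} w = u" by auto
      have "f = (\<lambda>r. \<Sum>y<n. (ksign y {} * var y) * w {y} r)"
        using fun_cong[OF w(2), of "{}"] by (simp add: u_def bd_def kdiff_def fun_eq_iff)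
      moreover have "w {y} \<in> M" if "y < n" for y
      proof -
        have wy: "w {y} \<in> N" "homv d (e - 1) (w {y})"
          using koszul_chain_in[OF w(1), of "{y}"] that by auto
        show ?thesis by (rule less.hyps[OF _ wy]) (use False in auto)
      qed
      then have "(\<lambda>r. \<Sum>y<n. (ksign y {} * var y) * w {y} r) \<in> M"
        by (intro submodule_sum[OF M] polys_mult polys_ksign polys_var) auto
      ultimately show ?thesis by simp
    qed
  qed
  show ?thesis
  proof
    fix f assume f: "f \<in> N"
    show "f \<in> M"
    proof (rule in_submodule_if_parts[OF M])
      show "f \<in> free n b" using f N by (auto simp: graded_submodule_def)
      show "vpart d e f \<in> M" for e
        by (rule hom[OF _ vpart_homv]) (use N f in \<open>auto simp: graded_submodule_def\<close>)
    qed
  qed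
qed

lemma homv_low_degree:
  assumes "f \<in> free n b" "homv d e f" "\<And>r. r < b \<Longrightarrow> e < d r"
  shows "f = (\<lambda>_. 0)"
proof
  fix r
  show "f r = 0"
    using assms homogeneous_negative[of "e - d r" "f r"]
    by (cases "r < b") (auto simp: free_iff homv_def)
qed

lemma degree_lower_bound: "\<exists>l :: int. \<forall>r<b. l < d r" for b :: nat
proof (induction b)
  case (Suc b)
  then obtain l where "\<forall>r<b. l < d r" by blast
  then show ?case by (intro exI[of _ "min l (d b - 1)"]) (auto simp: less_Suc_eq)
qed simp

lemma graded_Nakayama:
  assumes N: "graded_submodule n b d N" and ex: "\<And>e. koszul_exact {..<n} N d 0 e"
  shows "N = {\<lambda>_. 0}"
proof -
  obtain l where l: "\<forall>r<b. l < d r" using degree_lower_bound by blast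
  have "N \<subseteq> {\<lambda>_. 0}"
  proof (rule generated_in_low_degrees[OF N, of l])
    show "submodule_of n {\<lambda>_. 0 :: 'a mpoly}" by (simp add: submodule_of_def)
    fix f e assume "f \<in> N" "homv d e f" "e \<le> l"
    then show "f \<in> {\<lambda>_. 0}"
      using homv_low_degree[of f n b d e] N l by (force simp: graded_submodule_def)
  qed (rule ex)
  then show ?thesis using N by (auto simp: graded_submodule_def submodule_of_def)
qed

text \<open>Spanning sets are described by the subspaces that contain them, which avoids
  linear combinations.\<close>

definition K_subspace :: "(nat \<Rightarrow> 'a::field mpoly) set \<Rightarrow> bool" where
  "K_subspace M \<longleftrightarrow> (\<lambda>_. 0) \<in> M \<and> (\<forall>f \<in> M. \<forall>g \<in> M. (\<lambda>r. f r + g r) \<in> M) \<and>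
    (\<forall>c. \<forall>f \<in> M. (\<lambda>r. Poly_Mapping.single 0 c * f r) \<in> M)"

lemma K_subspace_add: "K_subspace M \<Longrightarrow> f \<in> M \<Longrightarrow> g \<in> M \<Longrightarrow> (\<lambda>r. f r + g r) \<in> M"
  by (simp add: K_subspace_def)

lemma lookup_const_mult: "lookup (Poly_Mapping.single 0 c * p) m = c * lookup p m"
  for p :: "'a::comm_ring_1 mpoly"
  by (simp add: lookup_single_mult)

text \<open>Gaussian elimination, one coefficient at a time.\<close>

lemma K_subspace_finitely_spanned:
  assumes "finite T" "K_subspace N"
    "\<And>f. f \<in> N \<Longrightarrow> (\<And>r m. (r, m) \<in> T \<Longrightarrow> lookup (f r) m = 0) \<Longrightarrow> f = (\<lambda>_. 0)"
  shows "\<exists>G. finite G \<and> G \<subseteq> N \<and> (\<forall>M. K_subspace M \<and> G \<subseteq> M \<longrightarrow> N \<subseteq> M)"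
  using assms
proof (induction T arbitrary: N rule: finite_induct)
  case empty
  then show ?case by (intro exI[of _ "{}"]) (auto simp: K_subspace_def)
next
  case (insert t T)
  obtain r0 m0 where t: "t = (r0, m0)" by (cases t)
  define N' where "N' = {f \<in> N. lookup (f r0) m0 = 0}"
  have "K_subspace N'"
    using insert.prems(1) by (auto simp: N'_def K_subspace_def lookup_add lookup_const_mult)
  moreover have "f = (\<lambda>_. 0)" if "f \<in> N'" "\<And>r m. (r, m) \<in> T \<Longrightarrow> lookup (f r) m = 0" for f
    using that insert.prems(2)[of f] by (auto simp: N'_def t)
  ultimately have "\<exists>G. finite G \<and> G \<subseteq> N' \<and> (\<forall>M. K_subspace M \<and> G \<subseteq> M \<longrightarrow> N' \<subseteq> M)"
    by (rule insert.IH)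
  then obtain G where G_all: "finite G \<and> G \<subseteq> N' \<and> (\<forall>M. K_subspace M \<and> G \<subseteq> M \<longrightarrow> N' \<subseteq> M)"
    by (rule exE)
  then have G: "finite G" "G \<subseteq> N'" by simp_all
  have G_span: "N' \<subseteq> M" if "K_subspace M" "G \<subseteq> M" for M using G_all that by simp
  show ?case
  proof (cases "N' = N")
    case True
    then show ?thesis using G_all by (intro exI[of _ G]) simp
  next
    case False
    then obtain g where g: "g \<in> N" "lookup (g r0) m0 \<noteq> 0" by (auto simp: N'_def)
    have "N \<subseteq> M" if M: "K_subspace M" "insert g G \<subseteq> M" for M
    proof
      fix f assume f: "f \<in> N"
      define c where "c = lookup (f r0) m0 / lookup (g r0) m0"
      let ?c = "Poly_Mapping.single 0 c :: 'a mpoly"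
      let ?c' = "Poly_Mapping.single 0 (- c) :: 'a mpoly"
      have "(\<lambda>r. ?c' * g r) \<in> N" using insert.prems(1) g(1) by (simp add: K_subspace_def)
      then have "(\<lambda>r. f r + ?c' * g r) \<in> N" using insert.prems(1) f by (simp add: K_subspace_def)
      moreover have "lookup (f r0 + ?c' * g r0) m0 = 0"
        using g(2) by (simp add: lookup_add lookup_const_mult c_def)
      ultimately have "(\<lambda>r. f r + ?c' * g r) \<in> M"
        using G_span[OF M(1)] M(2) by (auto simp: N'_def)
      moreover have "(\<lambda>r. ?c * g r) \<in> M" using M by (simp add: K_subspace_def)
      ultimately have "(\<lambda>r. (f r + ?c' * g r) + ?c * g r) \<in> M"
        by (rule K_subspace_add[OF M(1)])
      moreover have "(f r + ?c' * g r) + ?c * g r = f r" for r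
        by (rule poly_mapping_eqI) (simp add: lookup_add lookup_const_mult)
      ultimately show "f \<in> M" by simp
    qed
    then show ?thesis using G g by (intro exI[of _ "insert g G"]) (auto simp: N'_def)
  qed
qed

lemma finite_monomials_of_degree: "finite {m \<in> monomials n. monomial_degree m = D}"
proof -
  let ?M = "{m \<in> monomials n. monomial_degree m = D}"
  have le: "lookup m i \<le> D" if "m \<in> ?M" for m i
  proof (cases "i \<in> keys m")
    case True
    then have "lookup m i \<le> (\<Sum>i \<in> keys m. lookup m i)" by (intro member_le_sum) auto
    then show ?thesis using that by (simp add: monomial_degree_def)
  qed (simp add: in_keys_iff)
  have "inj_on (\<lambda>m. restrict (lookup m) {..<n}) ?M"
  proof (rule inj_onI, rule poly_mapping_eqI)
    fix m m' i
    assume m: "m \<in> ?M" "m' \<in> ?M" and eq: "restrict (lookup m) {..<n} = restrict (lookup m') {..<n}"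
    show "lookup m i = lookup m' i"
    proof (cases "i < n")
      case True
      then show ?thesis using fun_cong[OF eq, of i] by simp
    next
      case False
      then have "i \<notin> keys m" "i \<notin> keys m'" using m by (auto simp: monomials_def)
      then show ?thesis by (simp add: in_keys_iff)
    qed
  qed
  moreover have "finite ((\<lambda>m. restrict (lookup m) {..<n}) ` ?M)"
  proof (rule finite_subset)
    show "(\<lambda>m. restrict (lookup m) {..<n}) ` ?M \<subseteq> PiE {..<n} (\<lambda>_. {..D})"
      using le by (intro image_subsetI) (simp add: restrict_PiE_iff)
    show "finite (PiE {..<n} (\<lambda>_. {..D}))" by (intro finite_PiE) auto
  qed
  ultimately show ?thesis by (rule finite_imageD[rotated])
qed

lemma submodule_K_subspace: "submodule_of n M \<Longrightarrow> K_subspace M"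
  by (auto simp: submodule_of_def K_subspace_def polys_const)

lemma mat_apply_unit_vector: "c < b' \<Longrightarrow> mat_apply b' A (\<lambda>i. if i = c then 1 else 0) = (\<lambda>r. A r c)"
  by (intro ext) (simp add: mat_apply_def if_distrib cong: if_cong)

lemma unit_vector_free: "c < b' \<Longrightarrow> (\<lambda>i. if i = c then 1 else 0) \<in> free n b'"
  by (auto simp: free_iff polys_0 polys_1)

lemma image_of_subset:
  assumes "submodule_of n N" "\<And>c. c < b' \<Longrightarrow> (\<lambda>r. A r c) \<in> N"
  shows "image_of n b' A \<subseteq> N"
proof
  fix f assume "f \<in> image_of n b' A"
  then obtain v where v: "v \<in> free n b'" "f = mat_apply b' A v" by (auto simp: image_of_def)
  have "f = (\<lambda>r. \<Sum>c<b'. v c * A r c)" unfolding v(2) by (intro ext) (simp add: mat_apply_def mult.commute)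
  also have "\<dots> \<in> N"
    using v(1) assms(2) by (intro submodule_sum[OF assms(1)]) (auto simp: free_iff)
  finally show "f \<in> N" .
qed

text \<open>Generators are needed only in the degrees between the smallest degree of a basis vector and
  \<open>B\<close>, and in each degree a free module has finite dimension over the field.\<close>

lemma finitely_generated:
  fixes N :: "(nat \<Rightarrow> 'a::field mpoly) set"
  assumes N: "graded_submodule n b d N"
    and ex: "\<And>e. B < e \<Longrightarrow> koszul_exact {..<n} N d 0 e"
  shows "\<exists>b' d' A. graded_matrix n b d b' d' A \<and> image_of n b' A = N"
proof -
  have Ns: "submodule_of n N" and Nf: "N \<subseteq> free n b" using N by (auto simp: graded_submodule_def)
  obtain l where l: "\<forall>r<b. l < d r" using degree_lower_bound by blast
  have "\<exists>G. finite G \<and> G \<subseteq> {f \<in> N. homv d e f} \<and>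
      (\<forall>M. K_subspace M \<and> G \<subseteq> M \<longrightarrow> {f \<in> N. homv d e f} \<subseteq> M)" for e
  proof (rule K_subspace_finitely_spanned)
    let ?T = "Sigma {..<b} (\<lambda>r. {m \<in> monomials n. monomial_degree m = nat (e - d r)})"
    show "finite ?T" using finite_monomials_of_degree by (intro finite_SigmaI) auto
    show "K_subspace {f \<in> N. homv d e f}"
    proof -
      have "homogeneous i (Poly_Mapping.single 0 c * p)" if "homogeneous i p" for i c and p :: "'a mpoly"
        using homogeneous_mult[OF homogeneous_const that, of c] by simp
      then show ?thesis
        using submodule_K_subspace[OF Ns]
        by (auto simp: K_subspace_def homv_def homogeneous_0 homogeneous_add)
    qed
    fix f assume f: "f \<in> {f \<in> N. homv d e f}" and z: "\<And>r m. (r, m) \<in> ?T \<Longrightarrow> lookup (f r) m = 0"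
    show "f = (\<lambda>_. 0)"
    proof (intro ext poly_mapping_eqI)
      fix r m
      have "m \<notin> keys (f r)"
      proof
        assume m: "m \<in> keys (f r)"
        have fr: "f r \<in> polys n" "b \<le> r \<longrightarrow> f r = 0" using f Nf by (auto simp: free_iff)
        have "homogeneous (e - d r) (f r)" using f by (auto simp: homv_def)
        then have "int (monomial_degree m) = e - d r" using m by (auto simp: homogeneous_def)
        then have "monomial_degree m = nat (e - d r)" by linarith
        moreover have "r < b" using m fr by (metis keys_zero empty_iff not_less)
        ultimately have "(r, m) \<in> ?T" using m fr by (auto simp: polys_def)
        then show False using z[of r m] m by (simp add: in_keys_iff)
      qed
      then show "lookup (f r) m = lookup 0 m" by (simp add: in_keys_iff)
    qed
  qed
  then have "\<exists>G. \<forall>e. finite (G e) \<and> G e \<subseteq> {f \<in> N. homv d e f} \<and>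
      (\<forall>M. K_subspace M \<and> G e \<subseteq> M \<longrightarrow> {f \<in> N. homv d e f} \<subseteq> M)"
    by (intro choice allI)
  then obtain G where G_all: "\<forall>e. finite (G e) \<and> G e \<subseteq> {f \<in> N. homv d e f} \<and>
      (\<forall>M. K_subspace M \<and> G e \<subseteq> M \<longrightarrow> {f \<in> N. homv d e f} \<subseteq> M)"
    by (rule exE)
  have G: "finite (G e)" "G e \<subseteq> {f \<in> N. homv d e f}"
    "K_subspace M \<Longrightarrow> G e \<subseteq> M \<Longrightarrow> {f \<in> N. homv d e f} \<subseteq> M" for e M
    using G_all[THEN spec, of e] by simp_all
  define H where "H = (\<Union>e \<in> {l..B}. G e)"
  have "finite H" using G(1) by (simp add: H_def)
  then obtain h where h: "bij_betw h {..<card H} H"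
    using ex_bij_betw_nat_finite by (metis atLeast0LessThan)
  have "\<exists>e. homv d e (h c)" "h c \<in> N" if "c < card H" for c
  proof -
    have "h c \<in> H" using h that by (auto simp: bij_betw_def)
    then show "\<exists>e. homv d e (h c)" "h c \<in> N" using G(2) unfolding H_def by blast+
  qed
  then obtain d' where d': "\<And>c. c < card H \<Longrightarrow> homv d (d' c) (h c) \<and> h c \<in> N" by metis
  define A where "A r c = (if c < card H then h c r else 0)" for r c
  have A: "graded_matrix n b d (card H) d' A"
    unfolding graded_matrix_def
  proof (intro allI conjI impI)
    fix r c
    have "h c \<in> free n b" if "c < card H" using d'[OF that] Nf by blast
    then show "A r c \<in> polys n" by (auto simp: A_def free_iff polys_0)
    show "homogeneous (d' c - d r) (A r c)"
      using d'[of c] by (auto simp: A_def homv_def homogeneous_0)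
    show "A r c = 0" if "b \<le> r \<or> card H \<le> c"
      using that \<open>c < card H \<Longrightarrow> h c \<in> free n b\<close> by (auto simp: A_def free_iff)
  qed
  have col: "(\<lambda>r. A r c) = h c" if "c < card H" for c using that by (simp add: A_def)
  have im_sub: "submodule_of n (image_of n (card H) A)"
    using graded_submodule_image[OF A] by (simp add: graded_submodule_def)
  have H_im: "H \<subseteq> image_of n (card H) A"
  proof
    fix f assume "f \<in> H"
    then obtain c where c: "c < card H" "f = h c" using h by (auto simp: bij_betw_def)
    then have "f = mat_apply (card H) A (\<lambda>i. if i = c then 1 else 0)"
      using mat_apply_unit_vector[OF c(1), of A] col by simp
    then show "f \<in> image_of n (card H) A"
      unfolding image_of_def using unit_vector_free[OF c(1)] by blast
  qed
  have "N \<subseteq> image_of n (card H) A"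
  proof (rule generated_in_low_degrees[OF N ex im_sub])
    fix f e assume f: "f \<in> N" "homv d e f" "e \<le> B"
    show "f \<in> image_of n (card H) A"
    proof (cases "l \<le> e")
      case True
      then have "e \<in> {l..B}" using f(3) by simp
      then have "G e \<subseteq> H" unfolding H_def by blast
      then have "G e \<subseteq> image_of n (card H) A" using H_im by (rule subset_trans)
      from G(3)[OF submodule_K_subspace[OF im_sub] this] f show ?thesis by blast
    next
      case False
      then have "f = (\<lambda>_. 0)" using homv_low_degree[of f n b d e] f Nf l by force
      then show ?thesis using submodule_0[OF im_sub] by simp
    qed
  qed
  moreover have "image_of n (card H) A \<subseteq> N"
    by (rule image_of_subset[OF Ns]) (use col d' in simp)
  ultimately show ?thesis using A by blast
qed

text \<open>A system of homogeneous generators of the least possible size is minimal: a relation with a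
  nonzero constant coefficient would express one generator by the others.\<close>

lemma minimal_generators:
  fixes N :: "(nat \<Rightarrow> 'a::field mpoly) set"
  assumes N: "graded_submodule n b d N"
    and ex: "\<And>e. B < e \<Longrightarrow> koszul_exact {..<n} N d 0 e"
  shows "\<exists>b' d' A. graded_matrix n b d b' d' A \<and> image_of n b' A = N \<and>
    (\<forall>v \<in> kernel_of n b' A. \<forall>r. lookup (v r) 0 = 0)"
proof -
  have Ns: "submodule_of n N" using N by (auto simp: graded_submodule_def)
  define P where "P b' \<longleftrightarrow> (\<exists>d' A. graded_matrix n b d b' d' A \<and> image_of n b' A = N)" for b'
  define b' where "b' = (LEAST b'. P b')"
  have "\<exists>b'. P b'" using finitely_generated[OF N ex] unfolding P_def by blast
  then have "P b'" unfolding b'_def by (rule LeastI_ex)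
  then obtain d' A where A: "graded_matrix n b d b' d' A" "image_of n b' A = N"
    unfolding P_def by blast
  have "lookup (v c0) 0 = 0" if v: "v \<in> kernel_of n b' A" for v c0
  proof (rule ccontr)
    assume nz: "lookup (v c0) 0 \<noteq> 0"
    define \<kappa> where "\<kappa> = lookup (v c0) 0"
    have "graded_submodule n b' d' (kernel_of n b' A)" by (rule graded_submodule_kernel[OF A(1)])
    then have v': "vpart d' (d' c0) v \<in> kernel_of n b' A" using v by (auto simp: graded_submodule_def)
    have c0: "c0 < b'"
      using v nz by (auto simp: kernel_of_def free_iff not_less[symmetric])
    have v'c0: "vpart d' (d' c0) v c0 = Poly_Mapping.single 0 \<kappa>"
      by (rule poly_mapping_eqI)
        (auto simp: vpart_def lookup_hpart \<kappa>_def lookup_single when_def mdeg_eq_0_iff)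
    define \<sigma> where "\<sigma> c = (if c = c0 then b' - 1 else c)" for c
    have \<sigma>: "bij_betw \<sigma> {..<b' - 1} ({..<b'} - {c0})"
      by (rule bij_betw_byWitness[where f' = "\<lambda>c. if c = b' - 1 then c0 else c"])
        (use c0 in \<open>auto simp: \<sigma>_def\<close>)
    define A' where "A' r c = (if c < b' - 1 then A r (\<sigma> c) else 0)" for r c
    have A': "graded_matrix n b d (b' - 1) (\<lambda>c. d' (\<sigma> c)) A'"
      using A(1) by (auto simp: graded_matrix_def A'_def polys_0 homogeneous_0)
    have "N \<subseteq> image_of n (b' - 1) A'"
    proof
      fix f assume "f \<in> N"
      then obtain w where w: "w \<in> free n b'" "f = mat_apply b' A w" using A(2) by (auto simp: image_of_def)
      define p where "p = w c0 * Poly_Mapping.single 0 (inverse \<kappa>)"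
      have p: "p \<in> polys n" using w unfolding p_def by (intro polys_mult polys_const) (simp add: free_iff)
      define u where "u r = w r - p * vpart d' (d' c0) v r" for r
      have "(\<lambda>r. p * vpart d' (d' c0) v r) \<in> free n b'"
        using v' p by (intro submodule_smult[OF submodule_free]) (auto simp: kernel_of_def)
      then have u: "u \<in> free n b'"
        unfolding u_def[abs_def] by (rule submodule_diff[OF submodule_free w(1)])
      have "mat_apply b' A u = f"
        unfolding u_def[abs_def] mat_apply_diff mat_apply_smult w(2)
        using v' by (intro ext) (simp add: kernel_of_def)
      have "u c0 = 0"
      proof -
        have "Poly_Mapping.single 0 (inverse \<kappa>) * Poly_Mapping.single 0 \<kappa> = (1 :: 'a mpoly)"
          using nz by (simp add: mult_single \<kappa>_def)
        then show ?thesis by (simp add: u_def v'c0 p_def mult.assoc)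
      qed
      have "mat_apply (b' - 1) A' (\<lambda>c. if c < b' - 1 then u (\<sigma> c) else 0) = f"
      proof
        fix r
        have "mat_apply (b' - 1) A' (\<lambda>c. if c < b' - 1 then u (\<sigma> c) else 0) r
            = (\<Sum>c<b' - 1. A r (\<sigma> c) * u (\<sigma> c))"
          unfolding mat_apply_def by (intro sum.cong) (auto simp: A'_def)
        also have "\<dots> = (\<Sum>c \<in> {..<b'} - {c0}. A r c * u c)"
          by (rule sum.reindex_bij_betw[OF \<sigma>])
        also have "\<dots> = (\<Sum>c<b'. A r c * u c)"
          using \<open>u c0 = 0\<close> by (intro sum.mono_neutral_left) auto
        also have "\<dots> = f r" using \<open>mat_apply b' A u = f\<close> by (auto simp: mat_apply_def)
        finally show "mat_apply (b' - 1) A' (\<lambda>c. if c < b' - 1 then u (\<sigma> c) else 0) r = f r" .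
      qed
      moreover have "(\<lambda>c. if c < b' - 1 then u (\<sigma> c) else 0) \<in> free n (b' - 1)"
        using u by (auto simp: free_iff polys_0)
      ultimately show "f \<in> image_of n (b' - 1) A'" unfolding image_of_def by blast
    qed
    moreover have "image_of n (b' - 1) A' \<subseteq> N"
    proof (rule image_of_subset[OF Ns])
      fix c assume c: "c < b' - 1"
      then have "\<sigma> c < b'" by (auto simp: \<sigma>_def)
      then have "(\<lambda>r. A r (\<sigma> c)) \<in> N"
        unfolding A(2)[symmetric] image_of_def
        using mat_apply_unit_vector[of "\<sigma> c" b' A] unit_vector_free by (metis imageI)
      then show "(\<lambda>r. A' r c) \<in> N" using c by (simp add: A'_def)
    qed
    ultimately have "P (b' - 1)" using A' unfolding P_def by blast
    then have "b' \<le> b' - 1" unfolding b'_def by (rule Least_le)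
    then show False using c0 by simp
  qed
  then show ?thesis using A by blast
qed

section \<open>Existence and length of minimal resolutions\<close>

definition minimal_resolution :: "nat \<Rightarrow> nat \<Rightarrow> (nat \<Rightarrow> int) \<Rightarrow> (nat \<Rightarrow> 'a::field mpoly) set \<Rightarrow> nat \<Rightarrow>
    (nat \<Rightarrow> nat) \<Rightarrow> (nat \<Rightarrow> nat \<Rightarrow> int) \<Rightarrow> (nat \<Rightarrow> nat \<Rightarrow> nat \<Rightarrow> 'a mpoly) \<Rightarrow> bool" where
  "minimal_resolution n b0 d0 N p b d A \<longleftrightarrow>
    graded_matrix n b0 d0 (b 0) (d 0) (A 0) \<and>
    (\<forall>i<p. graded_matrix n (b i) (d i) (b (Suc i)) (d (Suc i)) (A (Suc i))) \<and>
    image_of n (b 0) (A 0) = N \<and>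
    (\<forall>i<p. image_of n (b (Suc i)) (A (Suc i)) = kernel_of n (b i) (A i)) \<and>
    kernel_of n (b p) (A p) = {\<lambda>_. 0} \<and> b p \<noteq> 0 \<and>
    (\<forall>i<p. \<forall>v \<in> kernel_of n (b i) (A i). \<forall>r. lookup (v r) 0 = 0)"

lemma minimal_resolution_Suc:
  "minimal_resolution n b0 d0 N (Suc p) b d A \<longleftrightarrow>
    graded_matrix n b0 d0 (b 0) (d 0) (A 0) \<and> image_of n (b 0) (A 0) = N \<and>
    (\<forall>v \<in> kernel_of n (b 0) (A 0). \<forall>r. lookup (v r) 0 = 0) \<and>
    minimal_resolution n (b 0) (d 0) (kernel_of n (b 0) (A 0)) p
      (\<lambda>i. b (Suc i)) (\<lambda>i. d (Suc i)) (\<lambda>i. A (Suc i))"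
  unfolding minimal_resolution_def All_less_Suc2 by blast

text \<open>Each syzygy module inherits the bound \<open>B\<close>, and \<open>q\<close> drops by one; at \<open>q = 0\<close> Nakayama's lemma
  applies.\<close>

lemma ex_minimal_resolution:
  fixes N :: "(nat \<Rightarrow> 'a::field mpoly) set"
  assumes "graded_submodule n b0 d0 N" "N \<noteq> {\<lambda>_. 0}"
    "\<And>j e. B < e \<Longrightarrow> koszul_exact {..<n} N d0 j e" "\<And>j e. q \<le> j \<Longrightarrow> koszul_exact {..<n} N d0 j e"
  shows "\<exists>p b d A. minimal_resolution n b0 d0 N p b d A"
  using assms
proof (induction q arbitrary: b0 d0 N)
  case 0
  then show ?case using graded_Nakayama[OF 0(1)] by blast
next
  case (Suc q)
  obtain b' d' A where A: "graded_matrix n b0 d0 b' d' A" "image_of n b' A = N"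
    and min: "\<And>v r. v \<in> kernel_of n b' A \<Longrightarrow> lookup (v r) 0 = 0"
    using minimal_generators[OF Suc.prems(1,3)] by metis
  show ?case
  proof (cases "kernel_of n b' A = {\<lambda>_. 0}")
    case True
    have "b' \<noteq> 0"
    proof
      assume "b' = 0"
      then have "mat_apply b' A v = (\<lambda>_. 0)" for v by (intro ext) (simp add: mat_apply_def)
      then have "N \<subseteq> {\<lambda>_. 0}" using A(2) by (auto simp: image_of_def)
      then show False using Suc.prems(1,2) by (auto simp: graded_submodule_def submodule_of_def)
    qed
    then have "minimal_resolution n b0 d0 N 0 (\<lambda>_. b') (\<lambda>_. d') (\<lambda>_. A)"
      using A True by (simp add: minimal_resolution_def)
    then show ?thesis by blast
  next
    case False
    have ker: "koszul_exact {..<n} (kernel_of n b' A) d' j e"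
      if "koszul_exact {..<n} N d0 (Suc j) e" for j e
      by (rule koszul_exact_kernel[OF A(1)]) (use that min A(2) in auto)
    have "\<exists>p b d A'. minimal_resolution n b' d' (kernel_of n b' A) p b d A'"
      by (rule Suc.IH[OF graded_submodule_kernel[OF A(1)] False])
        (use Suc.prems(3,4) ker in auto)
    then obtain p b d A' where "minimal_resolution n b' d' (kernel_of n b' A) p b d A'" by blast
    then have "minimal_resolution n b0 d0 N (Suc p) (case_nat b' b) (case_nat d' d) (case_nat A A')"
      unfolding minimal_resolution_Suc using A min by simp
    then show ?thesis by blast
  qed
qed

lemma koszul_exact_0: "koszul_exact Y {\<lambda>_. 0} d j e"
  unfolding koszul_exact_def
proof (intro allI impI, elim conjE)
  fix u :: "nat set \<Rightarrow> nat \<Rightarrow> 'a mpoly"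
  assume "koszul_chain Y {\<lambda>_. 0} d j e u"
  then have "u S = (\<lambda>_. 0)" for S
    using koszul_chain_in[of Y "{\<lambda>_. 0}" d j e u S] koszul_chain_outside[of Y "{\<lambda>_. 0}" d j e u S]
    by blast
  then have "bd Y (\<lambda>_ _. 0) = u" by (intro ext) (simp add: bd_def kdiff_def)
  moreover have "koszul_chain Y {\<lambda>_. 0} d (Suc j) e (\<lambda>_ _. 0)"
    by (simp add: koszul_chain_def homv_0)
  ultimately show "\<exists>w. koszul_chain Y {\<lambda>_. 0} d (Suc j) e w \<and> bd Y w = u" by blast
qed

lemma koszul_exact_above_length:
  assumes "minimal_resolution n b0 d0 N p b d A" "Y \<subseteq> {..<n}" "p < j"
  shows "koszul_exact Y N d0 j e"
  using assms
proof (induction p arbitrary: b0 d0 N b d A j)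
  case 0
  then obtain j' where "j = Suc j'" by (cases j) auto
  moreover have "koszul_exact Y (image_of n (b 0) (A 0)) d0 (Suc j') e"
    by (rule koszul_exact_image[where d' = "d 0"])
      (use 0 koszul_exact_0 in \<open>auto simp: minimal_resolution_def\<close>)
  ultimately show ?case using 0 by (simp add: minimal_resolution_def)
next
  case (Suc p)
  then obtain j' where j': "j = Suc j'" by (cases j) auto
  note res = Suc.prems(1)[unfolded minimal_resolution_Suc]
  have "koszul_exact Y (kernel_of n (b 0) (A 0)) (d 0) j' e"
    by (rule Suc.IH) (use res Suc.prems j' in auto)
  then have "koszul_exact Y (image_of n (b 0) (A 0)) d0 (Suc j') e"
    by (intro koszul_exact_image[where d' = "d 0"]) (use res Suc.prems in auto)
  then show ?case using res j' by simp
qed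

text \<open>Shifting up to the last module \<open>F\<^sub>p\<close> would make its image, and hence \<open>F\<^sub>p\<close> itself, zero by
  Nakayama's lemma.\<close>

lemma length_less:
  assumes "minimal_resolution n b0 d0 N p b d A"
    "\<And>j e. q \<le> j \<Longrightarrow> koszul_exact {..<n} N d0 j e"
  shows "p < q"
  using assms
proof (induction p arbitrary: b0 d0 N b d A q)
  case 0
  note res = 0(1)[unfolded minimal_resolution_def]
  show ?case
  proof (rule ccontr)
    assume "\<not> 0 < q"
    then have "N = {\<lambda>_. 0}"
      using res 0(2) by (intro graded_Nakayama[of n b0 d0] ) (auto intro: graded_submodule_image)
    then have "mat_apply (b 0) (A 0) (\<lambda>i. if i = 0 then 1 else 0) = (\<lambda>_. 0)"
      using res unit_vector_free[of 0 "b 0" n] by (auto simp: image_of_def)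
    then have "(\<lambda>i. if i = 0 then 1 else 0) \<in> kernel_of n (b 0) (A 0)"
      using res unit_vector_free[of 0 "b 0" n] by (auto simp: kernel_of_def)
    then have "(\<lambda>i :: nat. if i = 0 then 1 else 0) = (\<lambda>_. 0 :: 'a mpoly)" using res by auto
    from fun_cong[OF this, of 0] show False by simp
  qed
next
  case (Suc p)
  note res = Suc.prems(1)[unfolded minimal_resolution_Suc]
  have "p < q - 1"
  proof (rule Suc.IH)
    show "minimal_resolution n (b 0) (d 0) (kernel_of n (b 0) (A 0)) p
      (\<lambda>i. b (Suc i)) (\<lambda>i. d (Suc i)) (\<lambda>i. A (Suc i))" using res by blast
    fix j e assume "q - 1 \<le> j"
    then show "koszul_exact {..<n} (kernel_of n (b 0) (A 0)) (d 0) j e"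
      using res Suc.prems(2)[of "Suc j"] by (intro koszul_exact_kernel[of n b0 d0]) auto
  qed
  then show ?case by simp
qed

section \<open>Monomial ideals\<close>

lemma poly_ring_carrier: "carrier (poly_ring n) = polys n"
  by (auto simp: poly_ring_def polys_def monomials_def)

lemma sum_of_monomials: "(\<Sum>m \<in> keys p. Poly_Mapping.single m (lookup p m)) = p"
  by (rule poly_mapping_eqI) (simp add: lookup_sum lookup_single when_def in_keys_iff)

lemma genideal_monomials:
  assumes T: "T \<subseteq> monomials n"
  shows "genideal (poly_ring n) ((\<lambda>m. Poly_Mapping.single m 1) ` T) =
    {f \<in> polys n. \<forall>m \<in> keys f. \<exists>g \<in> T. \<exists>h. m = g + h}" (is "?J = ?I")
proof
  let ?R = "poly_ring n :: 'a::field mpoly ring"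
  interpret R: cring ?R by (rule cring_poly_ring)
  have R: "carrier ?R = polys n" "f \<otimes>\<^bsub>?R\<^esub> g = f * g" "\<zero>\<^bsub>?R\<^esub> = 0" "f \<oplus>\<^bsub>?R\<^esub> g = f + g" for f g
    by (simp_all add: poly_ring_carrier) (simp_all add: poly_ring_def)
  have gens: "(\<lambda>m. Poly_Mapping.single m 1) ` T \<subseteq> carrier ?R"
    using T by (auto simp: R polys_def)
  have smul: "p * f \<in> ?I" if "f \<in> ?I" "p \<in> polys n" for f p
  proof -
    have "\<exists>g \<in> T. \<exists>h. m = g + h" if m: "m \<in> keys (p * f)" for m
    proof -
      obtain a c where ac: "m = a + c" "c \<in> keys f" using m Poly_Mapping.keys_mult[of p f] by blast
      then obtain g h where "g \<in> T" "c = g + h" using \<open>f \<in> ?I\<close> by blast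
      then have "m = g + (a + h)" using ac by (simp add: ac_simps)
      then show ?thesis using \<open>g \<in> T\<close> by blast
    qed
    then show ?thesis using that by (simp add: polys_mult)
  qed
  have uminus: "\<ominus>\<^bsub>?R\<^esub> f = - f" if "f \<in> polys n" for f
    using R.minus_equality[of "- f" f] that by (simp add: R polys_uminus)
  have "ideal ?I ?R"
  proof (rule idealI)
    show "subgroup ?I (add_monoid ?R)"
    proof (rule subgroup.intro)
      show "?I \<subseteq> carrier (add_monoid ?R)" by (auto simp: R)
      show "\<one>\<^bsub>add_monoid ?R\<^esub> \<in> ?I" by (simp add: R polys_0)
      show "f \<otimes>\<^bsub>add_monoid ?R\<^esub> g \<in> ?I" if "f \<in> ?I" "g \<in> ?I" for f g
        using that Poly_Mapping.keys_add[of f g] by (auto simp: R polys_add)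
      show "inv\<^bsub>add_monoid ?R\<^esub> f \<in> ?I" if "f \<in> ?I" for f
      proof -
        have inv: "inv\<^bsub>add_monoid ?R\<^esub> f = - f" using uminus[of f] that by (simp add: a_inv_def)
        show ?thesis unfolding inv using that by (simp add: polys_uminus)
      qed
    qed
    show "p \<otimes>\<^bsub>?R\<^esub> f \<in> ?I" "f \<otimes>\<^bsub>?R\<^esub> p \<in> ?I" if "f \<in> ?I" "p \<in> carrier ?R" for f p
      using smul[OF that(1), of p] that by (simp_all add: R mult.commute)
  qed (rule R.ring_axioms)
  moreover have "(\<lambda>m. Poly_Mapping.single m 1) ` T \<subseteq> ?I"
  proof (rule image_subsetI)
    fix m assume m: "m \<in> T"
    then have "\<exists>g \<in> T. \<exists>h. m = g + h" by (intro bexI[of _ m] exI[of _ 0]) simp_all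
    then show "Poly_Mapping.single m 1 \<in> ?I" using T m by (auto simp: polys_def)
  qed
  ultimately show "?J \<subseteq> ?I" by (rule R.genideal_minimal)
  interpret J: ideal ?J ?R by (rule R.genideal_ideal[OF gens])
  show "?I \<subseteq> ?J"
  proof
    fix f assume f: "f \<in> ?I"
    have single: "Poly_Mapping.single m (lookup f m) \<in> ?J" if m: "m \<in> keys f" for m
    proof -
      obtain g h where gh: "g \<in> T" "m = g + h" using f m by blast
      have "m \<in> monomials n" using f m by (auto simp: polys_def)
      then have "Poly_Mapping.single h (lookup f m) \<in> polys n"
        using gh by (simp add: polys_def monomials_add)
      moreover have "Poly_Mapping.single g 1 \<in> ?J" using R.genideal_self[OF gens] gh(1) by blast
      ultimately have "Poly_Mapping.single g 1 * Poly_Mapping.single h (lookup f m) \<in> ?J"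
        using J.I_r_closed by (simp add: R)
      then show ?thesis using gh by (simp add: mult_single)
    qed
    have "(\<Sum>m \<in> M. Poly_Mapping.single m (lookup f m)) \<in> ?J" if "finite M" "M \<subseteq> keys f" for M
      using that
    proof (induction M rule: finite_induct)
      case empty
      then show ?case using J.zero_closed by (simp add: R)
    next
      case (insert m M)
      then show ?case using J.a_closed single by (simp add: R)
    qed
    from this[OF finite_keys subset_refl] show "f \<in> ?J" by (simp add: sum_of_monomials)
  qed
qed

lemma irrelevant_ideal_eq:
  "irrelevant_ideal n = {f :: 'a::field mpoly. f \<in> polys n \<and> lookup f 0 = 0}"
proof -
  let ?T = "(\<lambda>i. Poly_Mapping.single i 1) ` {..<n} :: (nat \<Rightarrow>\<^sub>0 nat) set"
  have "(var :: nat \<Rightarrow> 'a mpoly) ` {..<n} = (\<lambda>m. Poly_Mapping.single m 1) ` ?T"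
    by (auto simp: var_def image_image)
  moreover have "?T \<subseteq> monomials n" by (auto simp: monomials_def)
  ultimately have "irrelevant_ideal n =
      {f :: 'a mpoly. f \<in> polys n \<and> (\<forall>m \<in> keys f. \<exists>g \<in> ?T. \<exists>h. m = g + h)}"
    unfolding irrelevant_ideal_def by (simp only: genideal_monomials)
  moreover have "(\<exists>g \<in> ?T. \<exists>h. m = g + h) \<longleftrightarrow> m \<noteq> 0" if m: "m \<in> monomials n" for m
  proof
    assume "\<exists>g \<in> ?T. \<exists>h. m = g + h"
    then obtain i h where "m = Poly_Mapping.single i 1 + h" by blast
    then have "lookup m i \<noteq> 0" by (simp add: lookup_add)
    then show "m \<noteq> 0" by auto
  next
    assume "m \<noteq> 0"
    then obtain i where i: "i \<in> keys m" by (metis keys_eq_empty all_not_in_conv)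
    then have "m = Poly_Mapping.single i 1 + (m - Poly_Mapping.single i 1)"
      by (intro poly_mapping_eqI) (auto simp: lookup_add lookup_minus lookup_single when_def in_keys_iff)
    moreover have "i < n" using i m by (auto simp: monomials_def)
    ultimately show "\<exists>g \<in> ?T. \<exists>h. m = g + h" by blast
  qed
  then have "(\<forall>m \<in> keys f. \<exists>g \<in> ?T. \<exists>h. m = g + h) \<longleftrightarrow> 0 \<notin> keys f" if "f \<in> polys n" for f :: "'a mpoly"
    using that unfolding polys_def by (metis (no_types, lifting) mem_Collect_eq subsetD)
  then have "f \<in> polys n \<and> (\<forall>m \<in> keys f. \<exists>g \<in> ?T. \<exists>h. m = g + h) \<longleftrightarrow> f \<in> polys n \<and> lookup f 0 = 0"
    for f :: "'a mpoly" by (auto simp only: in_keys_iff)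
  ultimately show ?thesis by (simp only:)
qed

definition edge_monomials :: "nat \<Rightarrow> nat set set \<Rightarrow> (nat \<Rightarrow>\<^sub>0 nat) set" where
  "edge_monomials n E = {m \<in> monomials n. has_edge E (keys m)}"

lemma edge_ideal_eq:
  assumes E: "\<And>e. e \<in> E \<Longrightarrow> card e = 2 \<and> e \<subseteq> {..<n}"
  shows "edge_ideal n E = {f :: 'a::field mpoly. keys f \<subseteq> edge_monomials n E}"
proof -
  let ?T = "set_monomial ` E"
  have ind2: "set_monomial {i, j} = Poly_Mapping.single i 1 + Poly_Mapping.single j 1" if "{i, j} \<in> E" for i j
  proof -
    have "i \<noteq> j" using E[OF that] by auto
    then show ?thesis by (simp add: set_monomial_def)
  qed
  have "{var i * var j :: 'a mpoly | i j. {i, j} \<in> E} = (\<lambda>m. Poly_Mapping.single m 1) ` ?T"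
    (is "?L = ?R")
  proof
    show "?L \<subseteq> ?R"
    proof
      fix p assume "p \<in> ?L"
      then obtain i j where ij: "{i, j} \<in> E" "p = var i * var j" by blast
      then have "p = Poly_Mapping.single (set_monomial {i, j}) 1" by (simp add: var_def mult_single ind2)
      then show "p \<in> ?R" using ij(1) by blast
    qed
    show "?R \<subseteq> ?L"
    proof
      fix p assume "p \<in> ?R"
      then obtain e where e: "e \<in> E" "p = Poly_Mapping.single (set_monomial e) 1" by blast
      then obtain i j where "e = {i, j}" using E by (metis card_2_iff)
      then show "p \<in> ?L" using e ind2[of i j] by (auto simp: var_def mult_single)
    qed
  qed
  moreover have "finite e" if "e \<in> E" for e using E[OF that] finite_subset by blast
  then have T: "?T \<subseteq> monomials n" using E by (intro image_subsetI) (simp add: monomials_def keys_set_monomial)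
  ultimately have "edge_ideal n E =
      {f :: 'a mpoly. f \<in> polys n \<and> (\<forall>m \<in> keys f. \<exists>g \<in> ?T. \<exists>h. m = g + h)}"
    unfolding edge_ideal_def by (simp only: genideal_monomials[OF T])
  moreover have "(\<exists>g \<in> ?T. \<exists>h. m = g + h) \<longleftrightarrow> has_edge E (keys m)" for m
  proof
    assume "\<exists>g \<in> ?T. \<exists>h. m = g + h"
    then obtain e h where e: "e \<in> E" "m = set_monomial e + h" by blast
    then have "e \<subseteq> keys m" using \<open>\<And>e. e \<in> E \<Longrightarrow> finite e\<close> by (simp add: keys_add_nat keys_set_monomial)
    then show "has_edge E (keys m)" using e(1) by (auto simp: has_edge_def)
  next
    assume "has_edge E (keys m)"
    then obtain e where e: "e \<in> E" "e \<subseteq> keys m" by (auto simp: has_edge_def)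
    then have "m = set_monomial e + (m - set_monomial e)"
      using set_monomial_le[of e m] \<open>\<And>e. e \<in> E \<Longrightarrow> finite e\<close> by (simp add: add.commute)
    then show "\<exists>g \<in> ?T. \<exists>h. m = g + h" using e(1) by blast
  qed
  ultimately show ?thesis by (auto simp: polys_def edge_monomials_def)
qed

abbreviation edge_module :: "nat \<Rightarrow> nat set set \<Rightarrow> (nat \<Rightarrow> 'a::field mpoly) set" where
  "edge_module n E \<equiv> monomial_module (edge_monomials n E) 1"

lemma has_edge_mono: "has_edge E V \<Longrightarrow> V \<subseteq> W \<Longrightarrow> has_edge E W"
  by (auto simp: has_edge_def)

lemma graded_submodule_edge_module: "graded_submodule n 1 d (edge_module n E)"
proof -
  have mult: "keys (p * f) \<subseteq> edge_monomials n E"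
    if "p \<in> polys n" "keys f \<subseteq> edge_monomials n E" for p f :: "'a mpoly"
  proof
    fix m assume "m \<in> keys (p * f)"
    then obtain a c where ac: "m = a + c" "a \<in> keys p" "c \<in> keys f"
      using Poly_Mapping.keys_mult[of p f] by blast
    then have "a \<in> monomials n" "c \<in> edge_monomials n E" using that by (auto simp: polys_def)
    then show "m \<in> edge_monomials n E"
      unfolding edge_monomials_def ac(1)
      by (auto simp: monomials_add keys_add_nat intro: has_edge_mono)
  qed
  have add: "keys (f + g) \<subseteq> edge_monomials n E"
    if "keys f \<subseteq> edge_monomials n E" "keys g \<subseteq> edge_monomials n E" for f g :: "'a mpoly"
    using that Poly_Mapping.keys_add[of f g] by blast
  have hp: "keys (hpart e f) \<subseteq> keys f" for e and f :: "'a mpoly"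
    by (auto simp: in_keys_iff lookup_hpart split: if_splits)
  have "edge_monomials n E \<subseteq> monomials n" by (auto simp: edge_monomials_def)
  then show ?thesis
    unfolding graded_submodule_def submodule_of_def monomial_module_def
    using mult add hp by (auto simp: vpart_def hpart_0 polys_def) blast
qed

section \<open>Koszul homology of edge ideals\<close>

lemma upper_koszul_edge_monomialsD:
  assumes "S \<in> upper_koszul (edge_monomials n E) {..<n} a"
  shows "keys a \<subseteq> {..<n}" "finite S" "S \<subseteq> keys a" "has_edge E (keys (a - set_monomial S))"
proof -
  have S: "S \<subseteq> {..<n}" "S \<subseteq> keys a" "a - set_monomial S \<in> edge_monomials n E"
    using assms by (auto simp: upper_koszul_def)
  then show fin: "finite S" "S \<subseteq> keys a" "has_edge E (keys (a - set_monomial S))"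
    using finite_subset by (auto simp: edge_monomials_def)
  have "keys a = keys (a - set_monomial S) \<union> S"
    using set_monomial_le[OF fin(1,2)] keys_add_nat[of "a - set_monomial S" "set_monomial S"] by (simp add: keys_set_monomial fin)
  then show "keys a \<subseteq> {..<n}" using S by (auto simp: edge_monomials_def monomials_def)
qed

text \<open>If \<open>x\<^sub>i\<^sup>2\<close> divides the multidegree, then dividing by \<open>x\<^sub>i\<close> once does not change the support, so that
  \<open>i\<close> is the apex of a cone.\<close>

lemma kexact_upper_koszul_nonsquarefree:
  assumes "lookup a i \<ge> 2"
  shows "kexact TYPE('k::field) {..<n} (upper_koszul (edge_monomials n E) {..<n} a) j"
proof (cases "keys a \<subseteq> {..<n}")
  case False
  then have empty: "upper_koszul (edge_monomials n E) {..<n} a = {}"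
    using upper_koszul_edge_monomialsD(1) by blast
  show ?thesis unfolding empty by (rule kexact_no_faces) simp
next
  case True
  have i: "i \<in> keys a" using assms by (auto simp: in_keys_iff)
  show ?thesis
  proof (rule kexact_cone)
    show "i \<in> {..<n}" using i True by blast
    show "upper_koszul (edge_monomials n E) {..<n} a \<subseteq> Pow {..<n}" by (auto simp: upper_koszul_def)
    fix S assume S: "S \<in> upper_koszul (edge_monomials n E) {..<n} a" "i \<notin> S"
    have fin: "finite S" by (rule upper_koszul_edge_monomialsD(2)[OF S(1)])
    have "keys (a - set_monomial (insert i S)) = keys (a - set_monomial S)"
      using assms S(2) fin by (auto simp: in_keys_iff lookup_minus lookup_set_monomial split: if_splits)
    then show "insert i S \<in> upper_koszul (edge_monomials n E) {..<n} a"
      using S(1) i True by (auto simp: upper_koszul_def edge_monomials_def monomials_def)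
  qed simp
qed

lemma upper_koszul_squarefree:
  assumes "keys a \<subseteq> {..<n}" "\<And>i. lookup a i < 2"
  shows "upper_koszul (edge_monomials n E) {..<n} a = cofaces E (keys a)"
proof -
  have "keys (a - set_monomial S) = keys a - S" if "S \<subseteq> keys a" for S
  proof -
    have fin: "finite S" by (rule finite_subset[OF that finite_keys])
    have nz: "lookup a i - (if i \<in> S then 1 else 0) \<noteq> 0 \<longleftrightarrow> lookup a i \<noteq> 0 \<and> i \<notin> S" for i
      using assms(2)[of i] by auto
    show ?thesis
      by (rule Set.set_eqI) (simp only: in_keys_iff lookup_minus lookup_set_monomial[OF fin] Diff_iff nz)
  qed
  then have "a - set_monomial S \<in> edge_monomials n E \<longleftrightarrow> has_edge E (keys a - S)" if "S \<subseteq> keys a" for S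
    using that assms(1) unfolding edge_monomials_def monomials_def by (simp add: subset_iff)
  moreover have "{..<n} \<inter> keys a = keys a" using assms(1) by blast
  ultimately show ?thesis
    unfolding upper_koszul_def cofaces_def by (simp cong: conj_cong)
qed

text \<open>A squarefree multidegree in \<open>n\<close> variables has degree at most \<open>n\<close>.\<close>

lemma koszul_exact_edge_module_degree:
  assumes "int n < e"
  shows "koszul_exact {..<n} (edge_module n E :: (nat \<Rightarrow> 'a::field mpoly) set) (\<lambda>_. 0) j e"
proof (rule koszul_exact_monomial_module)
  fix a :: "nat \<Rightarrow>\<^sub>0 nat" assume "int (monomial_degree a) = e - 0"
  then have deg: "n < monomial_degree a" using assms by simp
  show "kexact TYPE('a) {..<n} (upper_koszul (edge_monomials n E) {..<n} a) j"
  proof (cases "keys a \<subseteq> {..<n}")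
    case True
    have "\<exists>i. lookup a i \<ge> 2"
    proof (rule ccontr)
      assume "\<not> (\<exists>i. lookup a i \<ge> 2)"
      then have "lookup a i \<le> 1" for i by (metis Suc_1 not_less_eq_eq One_nat_def)
      then have "(\<Sum>i<n. lookup a i) \<le> (\<Sum>i<n. 1)" by (intro sum_mono)
      then show False using deg mdeg_superset[OF _ True] by simp
    qed
    then show ?thesis using kexact_upper_koszul_nonsquarefree by blast
  next
    case False
    then have empty: "upper_koszul (edge_monomials n E) {..<n} a = {}"
      using upper_koszul_edge_monomialsD(1) by blast
    show ?thesis unfolding empty by (rule kexact_no_faces) simp
  qed
qed simp

lemma koszul_exact_edge_module_depth:
  assumes "depth_ge TYPE('a::field) E {..<n} {..<n} D" "n \<le> j + D"
  shows "koszul_exact {..<n} (edge_module n E :: (nat \<Rightarrow> 'a mpoly) set) (\<lambda>_. 0) j e"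
proof (rule koszul_exact_monomial_module)
  fix a :: "nat \<Rightarrow>\<^sub>0 nat"
  show "kexact TYPE('a) {..<n} (upper_koszul (edge_monomials n E) {..<n} a) j"
  proof (cases "keys a \<subseteq> {..<n}")
    case True
    show ?thesis
    proof (cases "\<exists>i. lookup a i \<ge> 2")
      case False
      then have "upper_koszul (edge_monomials n E) {..<n} a = cofaces E (keys a)"
        using True by (intro upper_koszul_squarefree) (auto simp: not_le)
      then show ?thesis using assms True by (simp add: depth_ge_def)
    qed (use kexact_upper_koszul_nonsquarefree in blast)
  next
    case False
    then have empty: "upper_koszul (edge_monomials n E) {..<n} a = {}"
      using upper_koszul_edge_monomialsD(1) by blast
    show ?thesis unfolding empty by (rule kexact_no_faces) simp
  qed
qed simp

text \<open>For a maximal independent set \<open>F\<close>, the product of its variables is annihilated modulo the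
  edge ideal by every other variable, without lying in the ideal. It thus gives a nonzero class in
  the top Koszul homology of the quotient with respect to the other variables; the image of that class
  under the connecting map is a class of the edge ideal one degree lower.\<close>

lemma maximal_independent_set_not_koszul_exact:
  assumes F: "F \<subseteq> {..<n}" "\<not> has_edge E F"
    and max: "\<And>y. y \<in> {..<n} - F \<Longrightarrow> has_edge E (insert y F)"
    and c: "card ({..<n} - F) = Suc j"
  shows "\<not> koszul_exact ({..<n} - F) (edge_module n E :: (nat \<Rightarrow> 'a::field mpoly) set) (\<lambda>_. 0) j (int n)"
proof
  let ?Y = "{..<n} - F"
  let ?d = "\<lambda>_ :: nat. 0 :: int"
  assume ex: "koszul_exact ?Y (edge_module n E :: (nat \<Rightarrow> 'a mpoly) set) ?d j (int n)"
  have finF: "finite F" using F(1) finite_subset by blast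
  have keysF: "keys (set_monomial F) = F" by (rule keys_set_monomial[OF finF])
  define f :: "'a mpoly" where "f = Poly_Mapping.single (set_monomial F) 1"
  define u0 where "u0 S r = (if S = ?Y \<and> r = 0 then f else 0)" for S and r :: nat
  have cF: "card ?Y + card F = n"
    using card_Diff_subset[OF finF F(1)] card_mono[OF finite_lessThan F(1)] by simp
  have u0: "koszul_chain ?Y (free n 1) ?d (Suc j) (int n) u0"
  proof (rule koszul_chainI)
    fix S
    show "u0 S \<in> free n 1 \<and> homv ?d (int n - int (Suc j)) (u0 S)" if "S \<subseteq> ?Y" "card S = Suc j"
    proof
      have "f \<in> polys n" using F keysF by (simp add: f_def polys_def monomials_def)
      then show "u0 S \<in> free n 1" by (auto simp: free_iff u0_def polys_0)
      have "homogeneous (int n - int (Suc j)) f"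
        using cF c by (simp add: f_def homogeneous_def mdeg_set_monomial[OF finF])
      then show "homv ?d (int n - int (Suc j)) (u0 S)" by (simp add: homv_def u0_def homogeneous_0)
    qed
    show "u0 S = (\<lambda>_. 0)" if "\<not> (S \<subseteq> ?Y \<and> card S = Suc j)"
      using that c by (auto simp: u0_def)
  qed
  have u: "koszul_chain ?Y (free n 1) ?d j (int n) (bd ?Y u0)"
    by (rule koszul_chain_bd[OF submodule_free _ u0]) blast
  have "koszul_chain ?Y (edge_module n E) ?d j (int n) (bd ?Y u0)"
  proof (rule koszul_chainI)
    fix S
    show "bd ?Y u0 S = (\<lambda>_. 0)" if "\<not> (S \<subseteq> ?Y \<and> card S = j)" by (rule koszul_chain_outside[OF u that])
    assume S: "S \<subseteq> ?Y" "card S = j"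
    note uS = koszul_chain_in[OF u S]
    have "m \<in> edge_monomials n E" if m: "m \<in> keys (bd ?Y u0 S 0)" for m
    proof -
      have "lookup (bd ?Y u0 S 0) m \<noteq> 0" using m by (simp add: in_keys_iff)
      then have "\<exists>y \<in> ?Y - S. lookup (ksign y S * var y * u0 (insert y S) 0) m \<noteq> 0"
        unfolding bd_def kdiff_def lookup_sum by (rule contrapos_np) (simp add: sum.neutral)
      then obtain y where y: "y \<in> ?Y" "lookup (ksign y S * (var y * u0 (insert y S) 0)) m \<noteq> 0"
        by (auto simp: mult.assoc)
      then have my: "y \<in> keys m" "lookup (u0 (insert y S) 0) (m - Poly_Mapping.single y 1) \<noteq> 0"
        unfolding lookup_ksign_mult lookup_var_mult by (auto split: if_splits)
      then have "m - Poly_Mapping.single y 1 = set_monomial F"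
        by (auto simp: u0_def f_def lookup_single when_def split: if_splits)
      moreover have "m - Poly_Mapping.single y 1 + Poly_Mapping.single y 1 = m"
        using set_monomial_le[of "{y}" m] my by (simp add: set_monomial_def)
      ultimately have "m = set_monomial F + Poly_Mapping.single y 1" by simp
      then have "keys m = insert y F" by (simp add: keys_add_nat keysF)
      then show ?thesis using max[OF y(1)] y(1) F(1) by (auto simp: edge_monomials_def monomials_def)
    qed
    then show "bd ?Y u0 S \<in> edge_module n E \<and> homv ?d (int n - int j) (bd ?Y u0 S)"
      using uS by (auto simp: monomial_module_def)
  qed
  from koszul_exactE[OF ex this bd_bd[OF _ u0]] obtain w where
    w: "koszul_chain ?Y (edge_module n E) ?d (Suc j) (int n) w" "bd ?Y w = bd ?Y u0" by auto
  \<comment> \<open>In the top degree the differential is injective, so \<open>w\<close> would have the value \<open>f\<close> at \<open>?Y\<close>.\<close>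
  obtain y where y: "y \<in> ?Y" using c by (metis card.empty all_not_in_conv nat.distinct(1))
  have "bd ?Y (\<lambda>S r. u0 S r - w S r) (?Y - {y}) 0 = 0"
    unfolding bd_diff w(2) by simp
  moreover have "?Y - (?Y - {y}) = {y}" "insert y (?Y - {y}) = ?Y" using y by auto
  ultimately have "ksign y (?Y - {y}) * (var y * (u0 ?Y 0 - w ?Y 0)) = 0"
    by (simp add: bd_def kdiff_def mult.assoc)
  then have "ksign y (?Y - {y}) * (ksign y (?Y - {y}) * (var y * (u0 ?Y 0 - w ?Y 0))) = 0"
    by simp
  then have z: "var y * (f - w ?Y 0) = 0"
    unfolding ksign_square by (simp add: u0_def)
  have "f - w ?Y 0 = 0"
  proof (rule poly_mapping_eqI)
    fix m
    have "lookup (var y * (f - w ?Y 0)) (m + Poly_Mapping.single y 1) = lookup (f - w ?Y 0) m"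
      by (simp add: lookup_var_mult keys_add_nat)
    then show "lookup (f - w ?Y 0) m = lookup 0 m" using z by simp
  qed
  then have "w ?Y 0 = f" by simp
  then have "set_monomial F \<in> keys (w ?Y 0)" by (simp add: f_def)
  moreover have "w ?Y \<in> edge_module n E" using koszul_chain_in[OF w(1) _ c] by simp
  then have "keys (w ?Y 0) \<subseteq> edge_monomials n E" by (simp add: monomial_module_def)
  ultimately have "has_edge E F" using keysF by (auto simp: edge_monomials_def)
  then show False using F(2) by simp
qed

section \<open>Resolutions by matrices\<close>

definition of_mat :: "'a::field mpoly mat \<Rightarrow> nat \<Rightarrow> nat \<Rightarrow> 'a mpoly" where
  "of_mat M r c = (if r < dim_row M \<and> c < dim_col M then M $$ (r, c) else 0)"

lemma graded_maps_iff:
  "M \<in> graded_maps n b d b' d' \<longleftrightarrow> M \<in> carrier_mat b b' \<and> graded_matrix n b d b' d' (of_mat M)"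
  unfolding graded_maps_def graded_matrix_def of_mat_def poly_ring_carrier
  by (auto simp: polys_0 homogeneous_0 split: if_splits)

lemma of_mat_mat:
  assumes "graded_matrix n b d b' d' A"
  shows "of_mat (mat b b' (\<lambda>(r, c). A r c)) = A"
  using assms by (intro ext) (auto simp: of_mat_def graded_matrix_def not_less[symmetric])

lemma free_module_eq: "free_module n b = vec b ` (free n b :: (nat \<Rightarrow> 'a::field mpoly) set)"
  (is "?L = ?R")
proof
  show "?R \<subseteq> ?L"
    by (auto simp: free_module_def free_iff poly_ring_carrier)
  show "?L \<subseteq> ?R"
  proof
    fix v :: "'a mpoly vec" assume v: "v \<in> ?L"
    have "v = vec b (\<lambda>i. if i < b then v $ i else 0)"
      using v by (intro eq_vecI) (auto simp: free_module_def)
    moreover have "(\<lambda>i. if i < b then v $ i else 0) \<in> free n b"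
      using v by (auto simp: free_iff free_module_def poly_ring_carrier polys_0)
    ultimately show "v \<in> vec b ` free n b" by blast
  qed
qed

lemma inj_on_vec: "inj_on (vec b) (free n b :: (nat \<Rightarrow> 'a::field mpoly) set)"
proof (rule inj_onI, rule ext)
  fix f g :: "nat \<Rightarrow> 'a mpoly" and r
  assume fg: "f \<in> free n b" "g \<in> free n b" "vec b f = vec b g"
  show "f r = g r"
  proof (cases "r < b")
    case True
    then show ?thesis using arg_cong[OF fg(3), of "\<lambda>v. v $ r"] by simp
  next
    case False
    then show ?thesis using fg by (simp add: free_iff)
  qed
qed

lemma mult_mat_vec_vec:
  assumes "M \<in> carrier_mat b b'"
  shows "M *\<^sub>v vec b' f = vec b (mat_apply b' (of_mat M) f)"
proof (rule eq_vecI)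
  show "dim_vec (M *\<^sub>v vec b' f) = dim_vec (vec b (mat_apply b' (of_mat M) f))" using assms by simp
  fix r assume "r < dim_vec (vec b (mat_apply b' (of_mat M) f))"
  then have "r < b" by simp
  then show "(M *\<^sub>v vec b' f) $ r = vec b (mat_apply b' (of_mat M) f) $ r"
    using assms by (auto simp: mat_apply_def of_mat_def scalar_prod_def atLeast0LessThan intro!: sum.cong)
qed

lemma map_image_eq:
  assumes "M \<in> carrier_mat b b'"
  shows "map_image n M = vec b ` image_of n b' (of_mat M)"
  using assms by (simp add: map_image_def image_of_def free_module_eq image_image mult_mat_vec_vec[OF assms])

lemma map_kernel_eq:
  assumes M: "M \<in> graded_maps n b d b' d'"
  shows "map_kernel n M = vec b' ` kernel_of n b' (of_mat M)"
proof -
  have dim: "M \<in> carrier_mat b b'" "graded_matrix n b d b' d' (of_mat M)"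
    using M by (auto simp: graded_maps_iff)
  have "M *\<^sub>v vec b' f = 0\<^sub>v b \<longleftrightarrow> mat_apply b' (of_mat M) f = (\<lambda>_. 0)" if "f \<in> free n b'" for f
  proof -
    have "0\<^sub>v b = vec b (\<lambda>_. 0 :: 'a mpoly)" by (intro eq_vecI) auto
    then have "M *\<^sub>v vec b' f = 0\<^sub>v b \<longleftrightarrow> vec b (mat_apply b' (of_mat M) f) = vec b (\<lambda>_. 0)"
      unfolding mult_mat_vec_vec[OF dim(1)] by simp
    also have "\<dots> \<longleftrightarrow> mat_apply b' (of_mat M) f = (\<lambda>_. 0)"
      using inj_on_vec[of b n] mat_apply_free[OF dim(2) that] submodule_0[OF submodule_free[of n b]]
      by (metis inj_onD)
    finally show ?thesis .
  qed
  then show ?thesis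
    using dim(1) by (auto simp: map_kernel_def kernel_of_def free_module_eq)
qed

lemma vec_image_eq_iff:
  "A \<subseteq> free n b \<Longrightarrow> B \<subseteq> free n b \<Longrightarrow> vec b ` A = vec b ` B \<longleftrightarrow> A = B"
  by (rule inj_on_image_eq_iff[OF inj_on_vec])

lemma image_of_free: "graded_matrix n b d b' d' A \<Longrightarrow> image_of n b' A \<subseteq> free n b"
  using graded_submodule_image[of n b d b' d' A] by (simp add: graded_submodule_def)

lemma kernel_of_free: "kernel_of n b' A \<subseteq> free n b'"
  by (auto simp: kernel_of_def)

lemma minimal_graded_free_resolution_iff:
  fixes D :: "nat \<Rightarrow> 'a::field mpoly mat"
  assumes L: "L \<subseteq> monomials n"
  shows "minimal_graded_free_resolution n {f. keys f \<subseteq> L} p b d D \<longleftrightarrow>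
    D 0 \<in> carrier_mat 1 (b 0) \<and> (\<forall>i<p. D (Suc i) \<in> carrier_mat (b i) (b (Suc i))) \<and>
    minimal_resolution n 1 (\<lambda>_. 0) (monomial_module L 1) p b d (\<lambda>i. of_mat (D i))"
    (is "?G \<longleftrightarrow> ?R")
proof (cases "D 0 \<in> graded_maps n 1 (\<lambda>_. 0) (b 0) (d 0) \<and>
     (\<forall>i<p. D (Suc i) \<in> graded_maps n (b i) (d i) (b (Suc i)) (d (Suc i)))")
  case False
  then show ?thesis
    unfolding minimal_graded_free_resolution_def graded_free_resolution_def minimal_resolution_def
      graded_maps_iff by blast
next
  case maps: True
  \<comment> \<open>The augmentation to the ring counts as the module before \<open>F\<^sub>0\<close>, of rank \<open>1\<close> in degree \<open>0\<close>.\<close>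
  define rows where "rows i = (case i of 0 \<Rightarrow> 1 | Suc i \<Rightarrow> b i)" for i
  define rdeg where "rdeg i = (case i of 0 \<Rightarrow> (\<lambda>_. 0) | Suc i \<Rightarrow> d i)" for i
  have D: "D i \<in> graded_maps n (rows i) (rdeg i) (b i) (d i)" if "i \<le> p" for i
    using maps that by (cases i) (auto simp: rows_def rdeg_def)
  have D': "D i \<in> carrier_mat (rows i) (b i)"
    "graded_matrix n (rows i) (rdeg i) (b i) (d i) (of_mat (D i))" if "i \<le> p" for i
    using D[OF that] by (auto simp: graded_maps_iff)
  have im: "map_image n (D i) = vec (rows i) ` image_of n (b i) (of_mat (D i))" if "i \<le> p" for i
    by (rule map_image_eq[OF D'(1)[OF that]])
  have ker: "map_kernel n (D i) = vec (b i) ` kernel_of n (b i) (of_mat (D i))" if "i \<le> p" for i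
    by (rule map_kernel_eq[OF D[OF that]])
  have 1: "(\<lambda>w. w $ 0) ` map_image n (D 0) = {f. keys f \<subseteq> L} \<longleftrightarrow>
      image_of n (b 0) (of_mat (D 0)) = monomial_module L 1"
  proof -
    let ?S = "image_of n (b 0) (of_mat (D 0))"
    have "(\<lambda>w. w $ 0) ` map_image n (D 0) = (\<lambda>f. f 0) ` ?S"
      using im[of 0] by (simp add: rows_def image_image)
    moreover have "{f. keys f \<subseteq> L} = (\<lambda>f. f 0) ` (monomial_module L 1 :: (nat \<Rightarrow> 'a mpoly) set)"
    proof
      show "{f. keys f \<subseteq> L} \<subseteq> (\<lambda>f. f 0) ` (monomial_module L 1 :: (nat \<Rightarrow> 'a mpoly) set)"
      proof
        fix f :: "'a mpoly" assume "f \<in> {f. keys f \<subseteq> L}"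
        then have "(\<lambda>r. if r = 0 then f else 0) \<in> monomial_module L 1"
          by (simp add: monomial_module_def)
        then show "f \<in> (\<lambda>f. f 0) ` monomial_module L 1" by (rule rev_image_eqI) simp
      qed
    qed (auto simp: monomial_module_def)
    moreover have "inj_on (\<lambda>f. f 0) (free n 1 :: (nat \<Rightarrow> 'a mpoly) set)"
    proof (rule inj_onI, rule ext)
      fix f g :: "nat \<Rightarrow> 'a mpoly" and r
      assume "f \<in> free n 1" "g \<in> free n 1" "f 0 = g 0"
      then show "f r = g r" by (cases r) (auto simp: free_iff)
    qed
    moreover have "?S \<subseteq> free n 1" using image_of_free[OF D'(2)[of 0]] by (simp add: rows_def)
    moreover have "monomial_module L 1 \<subseteq> (free n 1 :: (nat \<Rightarrow> 'a mpoly) set)"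
      using L by (auto simp: monomial_module_def)
    ultimately show ?thesis using inj_on_image_eq_iff by metis
  qed
  have 2: "map_image n (D (Suc i)) = map_kernel n (D i) \<longleftrightarrow>
      image_of n (b (Suc i)) (of_mat (D (Suc i))) = kernel_of n (b i) (of_mat (D i))" if "i < p" for i
  proof -
    have "image_of n (b (Suc i)) (of_mat (D (Suc i))) \<subseteq> free n (b i)"
      using image_of_free[OF D'(2)[of "Suc i"]] that by (simp add: rows_def)
    from vec_image_eq_iff[OF this kernel_of_free] show ?thesis
      using im[of "Suc i"] ker[of i] that by (simp add: rows_def)
  qed
  have 3: "map_kernel n (D p) = {0\<^sub>v (b p)} \<longleftrightarrow> kernel_of n (b p) (of_mat (D p)) = {\<lambda>_. 0}"
  proof -
    have "{0\<^sub>v (b p)} = vec (b p) ` {\<lambda>_. 0 :: 'a mpoly}" by (auto intro: eq_vecI)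
    moreover have "{\<lambda>_. 0 :: 'a mpoly} \<subseteq> free n (b p)" using submodule_0[OF submodule_free] by auto
    from vec_image_eq_iff[OF kernel_of_free this]
    have "vec (b p) ` kernel_of n (b p) (of_mat (D p)) = vec (b p) ` {\<lambda>_. 0} \<longleftrightarrow>
      kernel_of n (b p) (of_mat (D p)) = {\<lambda>_. 0}" .
    ultimately show ?thesis using ker[of p] by simp
  qed
  have 4: "(\<forall>w \<in> map_image n (D (Suc i)). \<forall>r < b i. w $ r \<in> irrelevant_ideal n) \<longleftrightarrow>
      (\<forall>v \<in> kernel_of n (b i) (of_mat (D i)). \<forall>r. lookup (v r) 0 = 0)"
    if "i < p" "image_of n (b (Suc i)) (of_mat (D (Suc i))) = kernel_of n (b i) (of_mat (D i))" for i
  proof -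
    have "(\<forall>r < b i. v r \<in> irrelevant_ideal n) \<longleftrightarrow> (\<forall>r. lookup (v r) 0 = 0)" if "v \<in> free n (b i)" for v
      using that by (auto simp: irrelevant_ideal_eq free_iff) (metis lookup_zero not_less)
    then show ?thesis
      using im[of "Suc i"] that kernel_of_free by (fastforce simp: rows_def)
  qed
  show ?thesis
    unfolding minimal_graded_free_resolution_def graded_free_resolution_def minimal_resolution_def
    using maps 1 2 3 4 unfolding graded_maps_iff by (smt (verit))
qed

lemma minimal_resolution_cong:
  assumes "minimal_resolution n b0 d0 N p b d A" "\<And>i. i \<le> p \<Longrightarrow> A' i = A i"
  shows "minimal_resolution n b0 d0 N p b d A'"
  using assms unfolding minimal_resolution_def by (simp add: Suc_leI)

text \<open>Uniqueness of the length enters as an assumption; for the ideals at hand it follows from their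
  Koszul homology.\<close>

lemma projective_dimension_eqI:
  fixes L :: "(nat \<Rightarrow>\<^sub>0 nat) set"
  assumes L: "L \<subseteq> monomials n"
    and ex: "\<exists>p b d A. minimal_resolution n 1 (\<lambda>_. 0) (monomial_module L 1 :: (nat \<Rightarrow> 'a::field mpoly) set) p b d A"
    and uniq: "\<And>p b d A. minimal_resolution n 1 (\<lambda>_. 0) (monomial_module L 1 :: (nat \<Rightarrow> 'a mpoly) set) p b d A \<Longrightarrow> p = q"
  shows "projective_dimension n {f :: 'a mpoly. keys f \<subseteq> L} = q"
  unfolding projective_dimension_def
proof (rule the_equality)
  obtain p b d A where
    A: "minimal_resolution n 1 (\<lambda>_. 0) (monomial_module L 1 :: (nat \<Rightarrow> 'a mpoly) set) p b d A"
    using ex by blast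
  define D where "D i = mat (case i of 0 \<Rightarrow> 1 | Suc i \<Rightarrow> b i) (b i) (\<lambda>(r, c). A i r c)" for i
  have "of_mat (D i) = A i" if "i \<le> p" for i
  proof (cases i)
    case 0
    then show ?thesis using A unfolding D_def minimal_resolution_def by (auto intro!: of_mat_mat)
  next
    case (Suc i')
    then have "graded_matrix n (b i') (d i') (b i) (d i) (A i)"
      using A that unfolding minimal_resolution_def by simp
    from of_mat_mat[OF this] show ?thesis by (simp add: D_def Suc)
  qed
  then have "minimal_resolution n 1 (\<lambda>_. 0) (monomial_module L 1) p b d (\<lambda>i. of_mat (D i))"
    by (rule minimal_resolution_cong[OF A])
  then have "minimal_graded_free_resolution n {f. keys f \<subseteq> L} p b d D"
    unfolding minimal_graded_free_resolution_iff[OF L] by (simp add: D_def)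
  then show "\<exists>b d D. minimal_graded_free_resolution n {f :: 'a mpoly. keys f \<subseteq> L} q b d D"
    using uniq[OF A] by blast
  show "p = q" if "\<exists>b d D. minimal_graded_free_resolution n {f :: 'a mpoly. keys f \<subseteq> L} p b d D" for p
    using that uniq unfolding minimal_graded_free_resolution_iff[OF L] by blast
qed

section \<open>The projective dimension\<close>

text \<open>For \<open>y > t\<close> the residue of \<open>y - 1\<close> modulo \<open>t\<close> is a neighbour of \<open>y\<close>; only for \<open>y = n - 1\<close>, where
  it is \<open>0\<close>, it has to be replaced by \<open>t\<close>.\<close>

lemma maximal_independent_set_GA':
  assumes t: "t \<ge> 1" and k: "k \<ge> 3" and n: "n = GA_order t k"
  shows "\<not> has_edge (GA'_edges t k) {..t}"
    and "y \<in> {..<n} - {..t} \<Longrightarrow> has_edge (GA'_edges t k) (insert y {..t})"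
proof -
  note adj = GA'_edge_iff[OF t k n]
  have n': "n = t * (k - 2) + t + 2"
  proof -
    have "k - 1 = Suc (k - 2)" using k by simp
    then show ?thesis unfolding n GA_order_def by simp
  qed
  show "\<not> has_edge (GA'_edges t k) {..t}"
  proof
    assume "has_edge (GA'_edges t k) {..t}"
    then obtain e where e: "e \<in> GA'_edges t k" "e \<subseteq> {..t}" by (auto simp: has_edge_def)
    obtain a b where ab: "e = {a, b}" "a \<noteq> b" using GA'_edges_card[OF t k e(1)] by (auto simp: card_2_iff)
    have False if uv: "u < v" "e = {u, v}" for u v
    proof -
      have v: "v \<le> t" "v < n" using e uv n' by auto
      have "{u, v} \<in> GA'_edges t k" using e uv by simp
      then obtain j where j: "j \<ge> 1" "v = u + 1 + j * t" using adj[OF uv(1) v(2)] by blast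
      then have "1 * t \<le> j * t" by (intro mult_right_mono) auto
      then show False using j(2) v(1) by linarith
    qed
    then show False using ab by (metis insert_commute nat_neq_iff)
  qed
  assume y: "y \<in> {..<n} - {..t}"
  show "has_edge (GA'_edges t k) (insert y {..t})"
  proof -
    have "\<exists>u \<le> t. {u, y} \<in> GA'_edges t k"
    proof (cases "y = n - 1")
      case True
      have "{t, y} \<in> GA'_edges t k"
      proof (subst adj)
        show "t < y" "y < n" using y by auto
        have "y = t + 1 + (k - 2) * t" using True n' by (simp add: mult.commute)
        moreover have "k - 2 \<ge> 1" using k by simp
        moreover have "y \<noteq> t + (n - 1)" using True t by simp
        ultimately show "(\<exists>j\<ge>1. y = t + 1 + j * t) \<and> y \<noteq> t + (n - 1)" by blast
      qed
      then show ?thesis by blast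
    next
      case False
      define u where "u = (y - 1) mod t"
      define j where "j = (y - 1) div t"
      have "u \<le> t" using t by (simp add: u_def less_imp_le)
      moreover have "{u, y} \<in> GA'_edges t k"
      proof (subst adj)
        have "t \<le> y - 1" using y by auto
        then have "j \<ge> 1" using t by (simp add: j_def div_greater_zero_iff Suc_le_eq)
        moreover have "y - 1 = u + j * t" by (simp add: u_def j_def)
        then have eq: "y = u + 1 + j * t" using y by auto
        moreover have "y \<noteq> u + (n - 1)" using False y by auto
        ultimately show "(\<exists>j\<ge>1. y = u + 1 + j * t) \<and> y \<noteq> u + (n - 1)" by blast
        show "u < y" "y < n" using eq y by auto
      qed
      ultimately show ?thesis by blast
    qed
    then obtain u where "u \<le> t" "{u, y} \<in> GA'_edges t k" by blast
    moreover from this have "{u, y} \<subseteq> insert y {..t}" by simp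
    ultimately show ?thesis unfolding has_edge_def by (intro bexI)
  qed
qed

theorem theorem6p15:
  fixes t k n :: nat
  assumes "t \<ge> 1" and "k \<ge> 3" and "n = t * (k - 1) + 2"
  shows "projective_dimension n (edge_ideal n (GA'_edges t k) :: 'a::field mpoly set) = n - t - 2
    \<and> n - t - 2 = t * (k - 2)"
proof -
  let ?E = "GA'_edges t k"
  let ?N = "edge_module n ?E :: (nat \<Rightarrow> 'a mpoly) set"
  let ?F = "{..t}"
  have n: "n = GA_order t k" using assms(3) by (simp add: GA_order_def)
  have "k - 1 = Suc (k - 2)" using assms(2) by simp
  then have n': "n = t * (k - 2) + t + 2" using assms(3) by simp
  have E: "card e = 2 \<and> e \<subseteq> {..<n}" if "e \<in> ?E" for e
    using GA'_edges_card[OF assms(1,2) that] n by simp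
  obtain I where I: "elimination_set ?E {..<n} I" "depth_ge TYPE('a) ?E {..<n} {..<n} (card I)"
    using ex_elimination_set[of "{..<n}" ?E "{..<n}"] E by auto
  have "t + 1 \<le> card I" by (rule card_elimination_set_GA'[OF assms(1,2) n I(1)])
  then have depth: "depth_ge TYPE('a) ?E {..<n} {..<n} (t + 1)" by (rule depth_ge_mono[OF I(2)])
  have upper: "koszul_exact {..<n} ?N (\<lambda>_. 0) j e" if "t * (k - 2) + 1 \<le> j" for j e
    by (rule koszul_exact_edge_module_depth[OF depth]) (use that n' in simp)
  have "{..<n} - ?F = {t + 1..<n}" by auto
  then have "card ({..<n} - ?F) = Suc (t * (k - 2))" using n' by simp
  moreover have "?F \<subseteq> {..<n}" using n' by auto
  ultimately have lower: "\<not> koszul_exact ({..<n} - ?F) ?N (\<lambda>_. 0) (t * (k - 2)) (int n)"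
    by (intro maximal_independent_set_not_koszul_exact maximal_independent_set_GA'[OF assms(1,2) n])
  have "projective_dimension n {f :: 'a mpoly. keys f \<subseteq> edge_monomials n ?E} = t * (k - 2)"
  proof (rule projective_dimension_eqI)
    show "edge_monomials n ?E \<subseteq> monomials n" by (auto simp: edge_monomials_def)
    have "?N \<noteq> {\<lambda>_. 0}"
    proof
      assume "?N = {\<lambda>_. 0}"
      have "koszul_exact ({..<n} - ?F) ?N (\<lambda>_. 0) (t * (k - 2)) (int n)"
        unfolding \<open>?N = {\<lambda>_. 0}\<close> by (rule koszul_exact_0)
      with lower show False by contradiction
    qed
    then show "\<exists>p b d A. minimal_resolution n 1 (\<lambda>_. 0) ?N p b d A"
      by (rule ex_minimal_resolution[OF graded_submodule_edge_module _ koszul_exact_edge_module_degree upper])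
    fix p b d A
    assume res: "minimal_resolution n 1 (\<lambda>_. 0) ?N p b d A"
    have "p < t * (k - 2) + 1" using length_less[OF res upper] .
    moreover have "\<not> p < t * (k - 2)"
    proof
      assume "p < t * (k - 2)"
      from koszul_exact_above_length[OF res Diff_subset this] lower show False by contradiction
    qed
    ultimately show "p = t * (k - 2)" by simp
  qed
  moreover have "edge_ideal n ?E = {f :: 'a mpoly. keys f \<subseteq> edge_monomials n ?E}"
    using E by (rule edge_ideal_eq)
  ultimately show ?thesis using n' by simp
qed

end
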